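(* Let $\mathcal C$ be a model category equipped with a skew closed structure $(\mathcal C,[-,-],I,L,i,j)$ satisfying Axiom C. Then $\mathrm{Ho}(\mathcal C)$ admits a skew closed structure $(\mathrm{Ho}(\mathcal C),[-,-]_r,I,L_r,i_r,j_r)$, where $[A,B]_r=[QA,RB]$ is the right derived functor of $[-,-]$ and the constraints are the following composites in $\mathrm{Ho}(\mathcal C)$: - $L_r:\ [QA,RB]\xrightarrow{[Qq_A,1]^{-1}}[QRA,RB]\xrightarrow{L}[[QC,QRA],[QC,RB]]\xrightarrow{[k,1]}[Q[QC,RA],[QC,RB]]\xrightarrow{[1,q]}[Q[QC,RA],R[QC,RB]]$; - $i_r:\ [QI,RA]\xrightarrow{[e,1]}[I,RA]\xrightarrow{i}RA\xrightarrow{q^{-1}}A$; - $j_r:\ I\xrightarrow{j}[A,A]\xrightarrow{[p,1]}[QA,A]\xrightarrow{[1,q]}[QA,RA]$.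
   Context: **Skew closed category** $(\mathcal C,[-,-],I,L,i,j)$: a bifunctor $[-,-]:\mathcal C^{op}\times\mathcal C\to\mathcal C$, an object $I$, maps $L=L^A_{B,C}:[B,C]\to[[A,B],[A,C]]$ natural in $B,C$ and extranatural in $A$, a natural $i_A:[I,A]\to A$, and an extranatural $j_A:I\to[A,A]$, with: (C1) $[L^A_{B,C},1]\circ L^{[A,B]}_{[A,C],[A,D]}\circ L^A_{C,D}=[1,L^A_{B,D}]\circ L^B_{C,D}$; (C2) $i_{[A,C]}\circ[j_A,1]\circ L^A_{A,C}=1$; (C3) $L^A_{B,B}\circ j_B=j_{[A,B]}$; (C4) $[1,i_C]\circ L^I_{B,C}=[i_B,1]$; (C5) $i_I\circ j_I=1$. **Model category conventions.** Model categories have functorial factorisations, giving cofibrant and fibrant replacement functors $Q,R$ with natural trivial fibrations $p_A:QA\to A$ and trivial cofibrations $q_A:A\to RA$. Maps of $\mathcal C$ and their images in $\mathrm{Ho}(\mathcal C)$ are denoted alike. **Axiom C**: for cofibrant $X$ the functor $[X,-]$ preserves fibrant objects and trivial fibrations; for fibrant $Y$ the functor $[-,Y]$ preserves weak equivalences between cofibrant objects; and the unit $I$ is cofibrant. Under Axiom C the map $[1,p_B]:[A,QB]\to[A,B]$ is a trivial fibration for $A$ cofibrant; $k_{A,B}:Q[A,B]\to[A,QB]$ denotes a chosen lifting with $[1,p_B]\circ k_{A,B}=p_{[A,B]}$. In $L_r$ above, $k=k_{QC,RA}:Q[QC,RA]\to[QC,QRA]$. Since $I$ is cofibrant there is a chosen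 $e:I\to QI$ with $p_I\circ e=1_I$. *)

theory Defs
  imports Main
begin

section \<open>Categories, functors, natural transformations\<close>

text \<open>
  A category has carrier sets of objects and of arrows; \<open>f \<cdot>\<^bsub>C\<^esub> g\<close> is the composite
  ``\<open>f\<close> after \<open>g\<close>'' and is only meaningful when \<open>Cod C g = Dom C f\<close>.
\<close>

record ('o, 'm) cat =
  Obj :: "'o set"
  Arr :: "'m set"
  Dom :: "'m \<Rightarrow> 'o"
  Cod :: "'m \<Rightarrow> 'o"
  ident :: "'o \<Rightarrow> 'm"
  Comp :: "'m \<Rightarrow> 'm \<Rightarrow> 'm"  (infixr "\<cdot>\<index>" 70)

definition hom :: "('o, 'm, 'x) cat_scheme \<Rightarrow> 'o \<Rightarrow> 'o \<Rightarrow> 'm set" where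
  "hom C a b = {f \<in> Arr C. Dom C f = a \<and> Cod C f = b}"

locale category =
  fixes C :: "('o, 'm, 'x) cat_scheme" (structure)
  assumes Dom_in_Obj: "f \<in> Arr C \<Longrightarrow> Dom C f \<in> Obj C"
    and Cod_in_Obj: "f \<in> Arr C \<Longrightarrow> Cod C f \<in> Obj C"
    and ident_in_hom: "a \<in> Obj C \<Longrightarrow> ident C a \<in> hom C a a"
    and comp_in_hom: "f \<in> hom C a b \<Longrightarrow> g \<in> hom C b c \<Longrightarrow> g \<cdot> f \<in> hom C a c"
    and comp_ident_right: "f \<in> hom C a b \<Longrightarrow> f \<cdot> ident C a = f"
    and comp_ident_left: "f \<in> hom C a b \<Longrightarrow> ident C b \<cdot> f = f"
    and comp_assoc: "f \<in> hom C a b \<Longrightarrow> g \<in> hom C b c \<Longrightarrow> h \<in> hom C c d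
      \<Longrightarrow> (h \<cdot> g) \<cdot> f = h \<cdot> (g \<cdot> f)"

definition opp :: "('o, 'm, 'x) cat_scheme \<Rightarrow> ('o, 'm) cat" where
  "opp C = \<lparr>Obj = Obj C, Arr = Arr C, Dom = Cod C, Cod = Dom C, ident = ident C,
            Comp = (\<lambda>f g. g \<cdot>\<^bsub>C\<^esub> f)\<rparr>"

definition prod_cat ::
  "('o, 'm, 'x) cat_scheme \<Rightarrow> ('p, 'n, 'y) cat_scheme \<Rightarrow> ('o \<times> 'p, 'm \<times> 'n) cat" where
  "prod_cat A B = \<lparr>Obj = Obj A \<times> Obj B, Arr = Arr A \<times> Arr B,
     Dom = map_prod (Dom A) (Dom B), Cod = map_prod (Cod A) (Cod B),
     ident = map_prod (ident A) (ident B),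
     Comp = (\<lambda>f g. (fst f \<cdot>\<^bsub>A\<^esub> fst g, snd f \<cdot>\<^bsub>B\<^esub> snd g))\<rparr>"

definition inv_arr :: "('o, 'm, 'x) cat_scheme \<Rightarrow> 'm \<Rightarrow> 'm" where
  "inv_arr C f = (THE g. g \<in> hom C (Cod C f) (Dom C f)
     \<and> g \<cdot>\<^bsub>C\<^esub> f = ident C (Dom C f) \<and> f \<cdot>\<^bsub>C\<^esub> g = ident C (Cod C f))"

record ('o, 'm, 'p, 'n) func =
  OMap :: "'o \<Rightarrow> 'p"
  AMap :: "'m \<Rightarrow> 'n"

definition is_functor ::
  "('o, 'm, 'x) cat_scheme \<Rightarrow> ('p, 'n, 'y) cat_scheme \<Rightarrow> ('o, 'm, 'p, 'n) func \<Rightarrow> bool" where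
  "is_functor A B F \<longleftrightarrow> category A \<and> category B
     \<and> (\<forall>a\<in>Obj A. OMap F a \<in> Obj B)
     \<and> (\<forall>f\<in>Arr A. AMap F f \<in> hom B (OMap F (Dom A f)) (OMap F (Cod A f)))
     \<and> (\<forall>a\<in>Obj A. AMap F (ident A a) = ident B (OMap F a))
     \<and> (\<forall>f\<in>Arr A. \<forall>g\<in>Arr A. Cod A f = Dom A g \<longrightarrow>
          AMap F (g \<cdot>\<^bsub>A\<^esub> f) = AMap F g \<cdot>\<^bsub>B\<^esub> AMap F f)"

definition comp_func ::
  "('p, 'n, 'q, 'r) func \<Rightarrow> ('o, 'm, 'p, 'n) func \<Rightarrow> ('o, 'm, 'q, 'r) func" where
  "comp_func G F = \<lparr>OMap = OMap G \<circ> OMap F, AMap = AMap G \<circ> AMap F\<rparr>"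

definition prod_func ::
  "('o, 'm, 'p, 'n) func \<Rightarrow> ('o2, 'm2, 'p2, 'n2) func
    \<Rightarrow> ('o \<times> 'o2, 'm \<times> 'm2, 'p \<times> 'p2, 'n \<times> 'n2) func" where
  "prod_func F G = \<lparr>OMap = map_prod (OMap F) (OMap G), AMap = map_prod (AMap F) (AMap G)\<rparr>"

definition nat_trans ::
  "('o, 'm, 'x) cat_scheme \<Rightarrow> ('p, 'n, 'y) cat_scheme
    \<Rightarrow> ('o, 'm, 'p, 'n) func \<Rightarrow> ('o, 'm, 'p, 'n) func \<Rightarrow> ('o \<Rightarrow> 'n) \<Rightarrow> bool" where
  "nat_trans A B F G \<tau> \<longleftrightarrow> is_functor A B F \<and> is_functor A B G
     \<and> (\<forall>a\<in>Obj A. \<tau> a \<in> hom B (OMap F a) (OMap G a))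
     \<and> (\<forall>f\<in>Arr A. AMap G f \<cdot>\<^bsub>B\<^esub> \<tau> (Dom A f) = \<tau> (Cod A f) \<cdot>\<^bsub>B\<^esub> AMap F f)"

text \<open>\<open>G : B \<rightarrow> D\<close>, with unit \<open>\<eta> : F \<Rightarrow> G K\<close>, is the left Kan extension of \<open>F : A \<rightarrow> D\<close>
  along \<open>K : A \<rightarrow> B\<close>.\<close>

definition left_kan_extension ::
  "('o, 'm, 'x) cat_scheme \<Rightarrow> ('p, 'n, 'y) cat_scheme \<Rightarrow> ('q, 'r, 'z) cat_scheme
    \<Rightarrow> ('o, 'm, 'p, 'n) func \<Rightarrow> ('o, 'm, 'q, 'r) func \<Rightarrow> ('p, 'n, 'q, 'r) func
    \<Rightarrow> ('o \<Rightarrow> 'r) \<Rightarrow> bool" where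
  "left_kan_extension A B D K F G \<eta> \<longleftrightarrow>
     is_functor A B K \<and> is_functor B D G \<and> nat_trans A D F (comp_func G K) \<eta>
     \<and> (\<forall>G' \<tau>. is_functor B D G' \<and> nat_trans A D F (comp_func G' K) \<tau> \<longrightarrow>
          (\<exists>\<theta>. nat_trans B D G G' \<theta> \<and> (\<forall>a\<in>Obj A. \<theta> (OMap K a) \<cdot>\<^bsub>D\<^esub> \<eta> a = \<tau> a)
             \<and> (\<forall>\<theta>'. nat_trans B D G G' \<theta>' \<and> (\<forall>a\<in>Obj A. \<theta>' (OMap K a) \<cdot>\<^bsub>D\<^esub> \<eta> a = \<tau> a)
                  \<longrightarrow> (\<forall>b\<in>Obj B. \<theta>' b = \<theta> b))))"


section \<open>Finite limits and colimits\<close>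

definition initial :: "('o, 'm, 'x) cat_scheme \<Rightarrow> 'o \<Rightarrow> bool" where
  "initial C z \<longleftrightarrow> z \<in> Obj C \<and> (\<forall>a\<in>Obj C. \<exists>!f. f \<in> hom C z a)"

definition terminal :: "('o, 'm, 'x) cat_scheme \<Rightarrow> 'o \<Rightarrow> bool" where
  "terminal C t \<longleftrightarrow> t \<in> Obj C \<and> (\<forall>a\<in>Obj C. \<exists>!f. f \<in> hom C a t)"

definition is_cone ::
  "('i, 'j, 'x) cat_scheme \<Rightarrow> ('o, 'm, 'y) cat_scheme \<Rightarrow> ('i, 'j, 'o, 'm) func
    \<Rightarrow> 'o \<Rightarrow> ('i \<Rightarrow> 'm) \<Rightarrow> bool" where
  "is_cone J C D c \<pi> \<longleftrightarrow> c \<in> Obj C \<and> (\<forall>x\<in>Obj J. \<pi> x \<in> hom C c (OMap D x))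
     \<and> (\<forall>f\<in>Arr J. AMap D f \<cdot>\<^bsub>C\<^esub> \<pi> (Dom J f) = \<pi> (Cod J f))"

definition is_limit ::
  "('i, 'j, 'x) cat_scheme \<Rightarrow> ('o, 'm, 'y) cat_scheme \<Rightarrow> ('i, 'j, 'o, 'm) func
    \<Rightarrow> 'o \<Rightarrow> ('i \<Rightarrow> 'm) \<Rightarrow> bool" where
  "is_limit J C D c \<pi> \<longleftrightarrow> is_cone J C D c \<pi>
     \<and> (\<forall>c' \<pi>'. is_cone J C D c' \<pi>' \<longrightarrow>
          (\<exists>!h. h \<in> hom C c' c \<and> (\<forall>x\<in>Obj J. \<pi> x \<cdot>\<^bsub>C\<^esub> h = \<pi>' x)))"

text \<open>Up to isomorphism, every finite category has natural numbers as objects and arrows.\<close>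

definition has_finite_limits :: "('o, 'm, 'x) cat_scheme \<Rightarrow> bool" where
  "has_finite_limits C \<longleftrightarrow>
     (\<forall>(J :: (nat, nat) cat) D. category J \<and> finite (Obj J) \<and> finite (Arr J)
        \<and> is_functor J C D \<longrightarrow> (\<exists>c \<pi>. is_limit J C D c \<pi>))"


section \<open>Model categories\<close>

definition comm_square :: "('o, 'm, 'x) cat_scheme \<Rightarrow> 'm \<Rightarrow> 'm \<Rightarrow> 'm \<Rightarrow> 'm \<Rightarrow> bool" where
  "comm_square C f g u v \<longleftrightarrow> f \<in> Arr C \<and> g \<in> Arr C
     \<and> u \<in> hom C (Dom C f) (Dom C g) \<and> v \<in> hom C (Cod C f) (Cod C g)
     \<and> g \<cdot>\<^bsub>C\<^esub> u = v \<cdot>\<^bsub>C\<^esub> f"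

definition has_lifting :: "('o, 'm, 'x) cat_scheme \<Rightarrow> 'm \<Rightarrow> 'm \<Rightarrow> bool" where
  "has_lifting C f g \<longleftrightarrow> (\<forall>u v. comm_square C f g u v \<longrightarrow>
     (\<exists>h \<in> hom C (Cod C f) (Dom C g). h \<cdot>\<^bsub>C\<^esub> f = u \<and> g \<cdot>\<^bsub>C\<^esub> h = v))"

definition retract_of :: "('o, 'm, 'x) cat_scheme \<Rightarrow> 'm \<Rightarrow> 'm \<Rightarrow> bool" where
  "retract_of C f g \<longleftrightarrow> (\<exists>s s' r r'. comm_square C f g s s' \<and> comm_square C g f r r'
     \<and> r \<cdot>\<^bsub>C\<^esub> s = ident C (Dom C f) \<and> r' \<cdot>\<^bsub>C\<^esub> s' = ident C (Cod C f))"

definition wide_subcategory :: "('o, 'm, 'x) cat_scheme \<Rightarrow> 'm set \<Rightarrow> bool" where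
  "wide_subcategory C S \<longleftrightarrow> S \<subseteq> Arr C \<and> (\<forall>a\<in>Obj C. ident C a \<in> S)
     \<and> (\<forall>f\<in>S. \<forall>g\<in>S. Cod C f = Dom C g \<longrightarrow> g \<cdot>\<^bsub>C\<^esub> f \<in> S)"

text \<open>
  A functorial factorisation sends \<open>f\<close> to \<open>fright f \<cdot> fleft f\<close>, and a commutative square
  \<open>(u, v) : f \<rightarrow> g\<close> to the arrow \<open>fmid f g u v\<close> between the middle objects.
\<close>

record 'm factorisation =
  fleft :: "'m \<Rightarrow> 'm"
  fright :: "'m \<Rightarrow> 'm"
  fmid :: "'m \<Rightarrow> 'm \<Rightarrow> 'm \<Rightarrow> 'm \<Rightarrow> 'm"

definition functorial_factorisation ::
  "('o, 'm, 'x) cat_scheme \<Rightarrow> 'm factorisation \<Rightarrow> bool" where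
  "functorial_factorisation C E \<longleftrightarrow>
     (\<forall>f\<in>Arr C. fleft E f \<in> Arr C \<and> fright E f \<in> Arr C
        \<and> Dom C (fleft E f) = Dom C f \<and> Cod C (fleft E f) = Dom C (fright E f)
        \<and> Cod C (fright E f) = Cod C f \<and> fright E f \<cdot>\<^bsub>C\<^esub> fleft E f = f)
     \<and> (\<forall>f g u v. comm_square C f g u v \<longrightarrow>
          comm_square C (fleft E f) (fleft E g) u (fmid E f g u v)
          \<and> comm_square C (fright E f) (fright E g) (fmid E f g u v) v)
     \<and> (\<forall>f\<in>Arr C. fmid E f f (ident C (Dom C f)) (ident C (Cod C f))
                    = ident C (Cod C (fleft E f)))
     \<and> (\<forall>f g h u v u' v'. comm_square C f g u v \<and> comm_square C g h u' v' \<longrightarrow>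
          fmid E f h (u' \<cdot>\<^bsub>C\<^esub> u) (v' \<cdot>\<^bsub>C\<^esub> v) = fmid E g h u' v' \<cdot>\<^bsub>C\<^esub> fmid E f g u v)"

text \<open>
  \<open>cof_fact\<close> factors an arrow as a cofibration followed by a trivial fibration, \<open>fib_fact\<close> as a
  trivial cofibration followed by a fibration.  The chosen initial and terminal objects only serve
  to turn these into replacement functors.
\<close>

record ('o, 'm) model_cat = "('o, 'm) cat" +
  weq :: "'m set"
  cof :: "'m set"
  fib :: "'m set"
  cof_fact :: "'m factorisation"
  fib_fact :: "'m factorisation"
  init_ob :: 'o
  term_ob :: 'o

locale model_category = category M
  for M :: "('o, 'm, 'x) model_cat_scheme" (structure) +
  assumes finite_limits: "has_finite_limits M"
    and finite_colimits: "has_finite_limits (opp M)"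
    and init_ob: "initial M (init_ob M)"
    and term_ob: "terminal M (term_ob M)"
    and weq_subcategory: "wide_subcategory M (weq M)"
    and cof_subcategory: "wide_subcategory M (cof M)"
    and fib_subcategory: "wide_subcategory M (fib M)"
    and two_of_three_left:
      "f \<in> Arr M \<Longrightarrow> g \<in> Arr M \<Longrightarrow> Cod M f = Dom M g
        \<Longrightarrow> g \<in> weq M \<Longrightarrow> g \<cdot> f \<in> weq M \<Longrightarrow> f \<in> weq M"
    and two_of_three_right:
      "f \<in> Arr M \<Longrightarrow> g \<in> Arr M \<Longrightarrow> Cod M f = Dom M g
        \<Longrightarrow> f \<in> weq M \<Longrightarrow> g \<cdot> f \<in> weq M \<Longrightarrow> g \<in> weq M"
    and weq_retract: "retract_of M f g \<Longrightarrow> g \<in> weq M \<Longrightarrow> f \<in> weq M"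
    and cof_retract: "retract_of M f g \<Longrightarrow> g \<in> cof M \<Longrightarrow> f \<in> cof M"
    and fib_retract: "retract_of M f g \<Longrightarrow> g \<in> fib M \<Longrightarrow> f \<in> fib M"
    and lifting_trivial_cof: "f \<in> cof M \<inter> weq M \<Longrightarrow> g \<in> fib M \<Longrightarrow> has_lifting M f g"
    and lifting_trivial_fib: "f \<in> cof M \<Longrightarrow> g \<in> fib M \<inter> weq M \<Longrightarrow> has_lifting M f g"
    and cof_fact: "functorial_factorisation M (cof_fact M)"
    and fib_fact: "functorial_factorisation M (fib_fact M)"
    and cof_fact_left: "f \<in> Arr M \<Longrightarrow> fleft (cof_fact M) f \<in> cof M"
    and cof_fact_right: "f \<in> Arr M \<Longrightarrow> fright (cof_fact M) f \<in> fib M \<inter> weq M"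
    and fib_fact_left: "f \<in> Arr M \<Longrightarrow> fleft (fib_fact M) f \<in> cof M \<inter> weq M"
    and fib_fact_right: "f \<in> Arr M \<Longrightarrow> fright (fib_fact M) f \<in> fib M"

definition init_arr :: "('o, 'm, 'x) model_cat_scheme \<Rightarrow> 'o \<Rightarrow> 'm" where
  "init_arr M A = (THE f. f \<in> hom M (init_ob M) A)"

definition term_arr :: "('o, 'm, 'x) model_cat_scheme \<Rightarrow> 'o \<Rightarrow> 'm" where
  "term_arr M A = (THE f. f \<in> hom M A (term_ob M))"

definition cofibrant :: "('o, 'm, 'x) model_cat_scheme \<Rightarrow> 'o \<Rightarrow> bool" where
  "cofibrant M A \<longleftrightarrow> A \<in> Obj M \<and> init_arr M A \<in> cof M"

definition fibrant :: "('o, 'm, 'x) model_cat_scheme \<Rightarrow> 'o \<Rightarrow> bool" where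
  "fibrant M A \<longleftrightarrow> A \<in> Obj M \<and> term_arr M A \<in> fib M"

text \<open>
  The replacements \<open>Q\<close> and \<open>R\<close> with \<open>p\<^sub>A : Q A \<rightarrow> A\<close> and \<open>q\<^sub>A : A \<rightarrow> R A\<close> come from
  factoring \<open>0 \<rightarrow> A\<close> and \<open>A \<rightarrow> 1\<close>.
\<close>

definition Qfun :: "('o, 'm, 'x) model_cat_scheme \<Rightarrow> ('o, 'm, 'o, 'm) func" where
  "Qfun M = \<lparr>OMap = (\<lambda>A. Cod M (fleft (cof_fact M) (init_arr M A))),
     AMap = (\<lambda>f. fmid (cof_fact M) (init_arr M (Dom M f)) (init_arr M (Cod M f))
                   (ident M (init_ob M)) f)\<rparr>"

definition pmap :: "('o, 'm, 'x) model_cat_scheme \<Rightarrow> 'o \<Rightarrow> 'm" where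
  "pmap M A = fright (cof_fact M) (init_arr M A)"

definition Rfun :: "('o, 'm, 'x) model_cat_scheme \<Rightarrow> ('o, 'm, 'o, 'm) func" where
  "Rfun M = \<lparr>OMap = (\<lambda>A. Cod M (fleft (fib_fact M) (term_arr M A))),
     AMap = (\<lambda>f. fmid (fib_fact M) (term_arr M (Dom M f)) (term_arr M (Cod M f))
                   f (ident M (term_ob M)))\<rparr>"

definition qmap :: "('o, 'm, 'x) model_cat_scheme \<Rightarrow> 'o \<Rightarrow> 'm" where
  "qmap M A = fleft (fib_fact M) (term_arr M A)"


section \<open>The homotopy category\<close>

text \<open>
  \<open>Ho M\<close> is the localisation of \<open>M\<close> at its weak equivalences: the free category on the arrows of
  \<open>M\<close> and the reversals of weak equivalences, modulo the usual relations.  Paths (zigzags) are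
  lists whose head is traversed first, i.e. in the order opposite to composition.
\<close>

datatype 'm step = Fwd 'm | Bwd 'm

fun zigzag :: "('o, 'm, 'x) model_cat_scheme \<Rightarrow> 'o \<Rightarrow> 'm step list \<Rightarrow> 'o \<Rightarrow> bool" where
  "zigzag M a [] b \<longleftrightarrow> a \<in> Obj M \<and> a = b"
| "zigzag M a (Fwd f # w) b \<longleftrightarrow> f \<in> Arr M \<and> Dom M f = a \<and> zigzag M (Cod M f) w b"
| "zigzag M a (Bwd f # w) b \<longleftrightarrow> f \<in> weq M \<and> Cod M f = a \<and> zigzag M (Dom M f) w b"

inductive zz_rel :: "('o, 'm, 'x) model_cat_scheme \<Rightarrow> 'm step list \<Rightarrow> 'm step list \<Rightarrow> bool"
  for M where
  zz_ident: "a \<in> Obj M \<Longrightarrow> zz_rel M [Fwd (ident M a)] []"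
| zz_comp: "f \<in> Arr M \<Longrightarrow> g \<in> Arr M \<Longrightarrow> Cod M f = Dom M g
    \<Longrightarrow> zz_rel M [Fwd f, Fwd g] [Fwd (g \<cdot>\<^bsub>M\<^esub> f)]"
| zz_fwd_bwd: "f \<in> weq M \<Longrightarrow> zz_rel M [Fwd f, Bwd f] []"
| zz_bwd_fwd: "f \<in> weq M \<Longrightarrow> zz_rel M [Bwd f, Fwd f] []"

inductive zz_eq ::
  "('o, 'm, 'x) model_cat_scheme \<Rightarrow> 'o \<Rightarrow> 'o \<Rightarrow> 'm step list \<Rightarrow> 'm step list \<Rightarrow> bool"
  for M a b where
  zz_refl: "zigzag M a u b \<Longrightarrow> zz_eq M a b u u"
| zz_sym: "zz_eq M a b u v \<Longrightarrow> zz_eq M a b v u"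
| zz_trans: "zz_eq M a b u v \<Longrightarrow> zz_eq M a b v w \<Longrightarrow> zz_eq M a b u w"
| zz_context: "zigzag M a u c \<Longrightarrow> zigzag M c x d \<Longrightarrow> zigzag M c y d \<Longrightarrow> zigzag M d v b
    \<Longrightarrow> zz_rel M x y \<Longrightarrow> zz_eq M a b (u @ x @ v) (u @ y @ v)"

text \<open>An arrow of \<open>Ho M\<close> is a triple of its domain, its codomain, and a class of zigzags.\<close>

definition Ho :: "('o, 'm, 'x) model_cat_scheme \<Rightarrow> ('o, 'o \<times> 'o \<times> 'm step list set) cat" where
  "Ho M = \<lparr>Obj = Obj M,
     Arr = {(a, b, Collect (zz_eq M a b w)) | a b w. zigzag M a w b},
     Dom = (\<lambda>(a, b, S). a),
     Cod = (\<lambda>(a, b, S). b),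
     ident = (\<lambda>a. (a, a, Collect (zz_eq M a a []))),
     Comp = (\<lambda>(b, c, T) (a, b', S). (a, c, {w. \<exists>u\<in>S. \<exists>v\<in>T. zz_eq M a c (u @ v) w}))\<rparr>"

definition Loc ::
  "('o, 'm, 'x) model_cat_scheme \<Rightarrow> ('o, 'm, 'o, 'o \<times> 'o \<times> 'm step list set) func" where
  "Loc M = \<lparr>OMap = (\<lambda>a. a),
     AMap = (\<lambda>f. (Dom M f, Cod M f, Collect (zz_eq M (Dom M f) (Cod M f) [Fwd f])))\<rparr>"

abbreviation ho_arr ::
  "('o, 'm, 'x) model_cat_scheme \<Rightarrow> 'm \<Rightarrow> 'o \<times> 'o \<times> 'm step list set" where
  "ho_arr M f \<equiv> AMap (Loc M) f"


section \<open>Skew closed categories\<close>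

type_synonym ('o, 'm) bifunc = "('o \<times> 'o, 'm \<times> 'm, 'o, 'm) func"

abbreviation hob :: "('o, 'm) bifunc \<Rightarrow> 'o \<Rightarrow> 'o \<Rightarrow> 'o" where
  "hob H A B \<equiv> OMap H (A, B)"

abbreviation harr :: "('o, 'm) bifunc \<Rightarrow> 'm \<Rightarrow> 'm \<Rightarrow> 'm" where
  "harr H f g \<equiv> AMap H (f, g)"

text \<open>
  In the locale, \<open>\<langle>A, B\<rangle>\<close> and \<open>\<langle>f | g\<rangle>\<close> are the values \<open>[A, B]\<close> and \<open>[f, g]\<close> of the internal
  hom on objects and on arrows; \<open>L A B C\<close> stands for \<open>L\<^sup>A\<close> at \<open>B, C\<close>.
\<close>

locale skew_closed_category = category C
  for C :: "('o, 'm, 'x) cat_scheme" (structure) +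
  fixes H :: "('o, 'm) bifunc"
    and I :: 'o
    and L :: "'o \<Rightarrow> 'o \<Rightarrow> 'o \<Rightarrow> 'm"
    and i :: "'o \<Rightarrow> 'm"
    and j :: "'o \<Rightarrow> 'm"
    and ob :: "'o \<Rightarrow> 'o \<Rightarrow> 'o"  ("\<langle>_, _\<rangle>")
    and ar :: "'m \<Rightarrow> 'm \<Rightarrow> 'm"  ("\<langle>_ | _\<rangle>")
    and one :: "'o \<Rightarrow> 'm"  ("\<one>")
  defines "ob A B \<equiv> hob H A B" and "ar f g \<equiv> harr H f g" and "one A \<equiv> ident C A"
  assumes bifunctor: "is_functor (prod_cat (opp C) C) C H"
    and unit_in_Obj: "I \<in> Obj C"
    and L_in_hom: "A \<in> Obj C \<Longrightarrow> B \<in> Obj C \<Longrightarrow> D \<in> Obj C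
      \<Longrightarrow> L A B D \<in> hom C \<langle>B, D\<rangle> \<langle>\<langle>A, B\<rangle>, \<langle>A, D\<rangle>\<rangle>"
    and L_natural: "A \<in> Obj C \<Longrightarrow> f \<in> hom C B' B \<Longrightarrow> g \<in> hom C D D'
      \<Longrightarrow> L A B' D' \<cdot> \<langle>f | g\<rangle> = \<langle>\<langle>\<one> A | f\<rangle> | \<langle>\<one> A | g\<rangle>\<rangle> \<cdot> L A B D"
    and L_extranatural: "f \<in> hom C A A' \<Longrightarrow> B \<in> Obj C \<Longrightarrow> D \<in> Obj C
      \<Longrightarrow> \<langle>\<langle>f | \<one> B\<rangle> | \<one> \<langle>A, D\<rangle>\<rangle> \<cdot> L A B D = \<langle>\<one> \<langle>A', B\<rangle> | \<langle>f | \<one> D\<rangle>\<rangle> \<cdot> L A' B D"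
    and i_in_hom: "A \<in> Obj C \<Longrightarrow> i A \<in> hom C \<langle>I, A\<rangle> A"
    and i_natural: "f \<in> hom C A B \<Longrightarrow> f \<cdot> i A = i B \<cdot> \<langle>\<one> I | f\<rangle>"
    and j_in_hom: "A \<in> Obj C \<Longrightarrow> j A \<in> hom C I \<langle>A, A\<rangle>"
    and j_extranatural: "f \<in> hom C A B \<Longrightarrow> \<langle>\<one> A | f\<rangle> \<cdot> j A = \<langle>f | \<one> B\<rangle> \<cdot> j B"
    and C1: "A \<in> Obj C \<Longrightarrow> B \<in> Obj C \<Longrightarrow> D \<in> Obj C \<Longrightarrow> E \<in> Obj C
      \<Longrightarrow> \<langle>L A B D | \<one> \<langle>\<langle>A, B\<rangle>, \<langle>A, E\<rangle>\<rangle>\<rangle> \<cdot> L \<langle>A, B\<rangle> \<langle>A, D\<rangle> \<langle>A, E\<rangle> \<cdot> L A D E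
          = \<langle>\<one> \<langle>B, D\<rangle> | L A B E\<rangle> \<cdot> L B D E"
    and C2: "A \<in> Obj C \<Longrightarrow> D \<in> Obj C
      \<Longrightarrow> i \<langle>A, D\<rangle> \<cdot> \<langle>j A | \<one> \<langle>A, D\<rangle>\<rangle> \<cdot> L A A D = \<one> \<langle>A, D\<rangle>"
    and C3: "A \<in> Obj C \<Longrightarrow> B \<in> Obj C \<Longrightarrow> L A B B \<cdot> j B = j \<langle>A, B\<rangle>"
    and C4: "B \<in> Obj C \<Longrightarrow> D \<in> Obj C
      \<Longrightarrow> \<langle>\<one> \<langle>I, B\<rangle> | i D\<rangle> \<cdot> L I B D = \<langle>i B | \<one> D\<rangle>"
    and C5: "i I \<cdot> j I = \<one> I"


section \<open>Axiom C and the derived structure\<close>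

definition axiom_C :: "('o, 'm, 'x) model_cat_scheme \<Rightarrow> ('o, 'm) bifunc \<Rightarrow> 'o \<Rightarrow> bool" where
  "axiom_C M H I \<longleftrightarrow>
     (\<forall>X. cofibrant M X \<longrightarrow>
        (\<forall>Y. fibrant M Y \<longrightarrow> fibrant M (hob H X Y))
        \<and> (\<forall>f \<in> fib M \<inter> weq M. harr H (ident M X) f \<in> fib M \<inter> weq M))
     \<and> (\<forall>Y. fibrant M Y \<longrightarrow>
          (\<forall>f \<in> weq M. cofibrant M (Dom M f) \<and> cofibrant M (Cod M f)
             \<longrightarrow> harr H f (ident M Y) \<in> weq M))
     \<and> cofibrant M I"

text \<open>The functor \<open>G\<close> on homotopy categories is the total right derived functor of the bifunctor
  \<open>H : M\<^sup>o\<^sup>p \<times> M \<rightarrow> M\<close>, with unit \<open>\<eta>\<close>.\<close>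

definition right_derived_bifunctor ::
  "('o, 'm, 'x) model_cat_scheme \<Rightarrow> ('o, 'm) bifunc
    \<Rightarrow> ('o, 'o \<times> 'o \<times> 'm step list set) bifunc
    \<Rightarrow> ('o \<times> 'o \<Rightarrow> 'o \<times> 'o \<times> 'm step list set) \<Rightarrow> bool" where
  "right_derived_bifunctor M H G \<eta> \<longleftrightarrow>
     left_kan_extension (prod_cat (opp M) M) (prod_cat (opp (Ho M)) (Ho M)) (Ho M)
       (prod_func (Loc M) (Loc M)) (comp_func (Loc M) H) G \<eta>"

text \<open>Admissible choices of the liftings \<open>k A B : Q[A, B] \<rightarrow> [A, QB]\<close>, for cofibrant \<open>A\<close>.\<close>

definition k_choice ::
  "('o, 'm, 'x) model_cat_scheme \<Rightarrow> ('o, 'm) bifunc \<Rightarrow> ('o \<Rightarrow> 'o \<Rightarrow> 'm) \<Rightarrow> bool" where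
  "k_choice M H k \<longleftrightarrow> (\<forall>A B. cofibrant M A \<and> B \<in> Obj M \<longrightarrow>
     k A B \<in> hom M (OMap (Qfun M) (hob H A B)) (hob H A (OMap (Qfun M) B))
     \<and> harr H (ident M A) (pmap M B) \<cdot>\<^bsub>M\<^esub> k A B = pmap M (hob H A B))"

definition L_r ::
  "('o, 'm, 'x) model_cat_scheme \<Rightarrow> ('o, 'm) bifunc \<Rightarrow> ('o \<Rightarrow> 'o \<Rightarrow> 'o \<Rightarrow> 'm)
    \<Rightarrow> ('o \<Rightarrow> 'o \<Rightarrow> 'm) \<Rightarrow> 'o \<Rightarrow> 'o \<Rightarrow> 'o \<Rightarrow> 'o \<times> 'o \<times> 'm step list set" where
  "L_r M H L k C A B =
     (let Q = OMap (Qfun M); R = OMap (Rfun M) in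
        ho_arr M (harr H (ident M (Q (hob H (Q C) (R A)))) (qmap M (hob H (Q C) (R B))))
        \<cdot>\<^bsub>Ho M\<^esub> ho_arr M (harr H (k (Q C) (R A)) (ident M (hob H (Q C) (R B))))
        \<cdot>\<^bsub>Ho M\<^esub> ho_arr M (L (Q C) (Q (R A)) (R B))
        \<cdot>\<^bsub>Ho M\<^esub> inv_arr (Ho M)
              (ho_arr M (harr H (AMap (Qfun M) (qmap M A)) (ident M (R B)))))"

definition i_r ::
  "('o, 'm, 'x) model_cat_scheme \<Rightarrow> ('o, 'm) bifunc \<Rightarrow> ('o \<Rightarrow> 'm) \<Rightarrow> 'm
    \<Rightarrow> 'o \<Rightarrow> 'o \<times> 'o \<times> 'm step list set" where
  "i_r M H i e A =
     (let R = OMap (Rfun M) in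
        inv_arr (Ho M) (ho_arr M (qmap M A))
        \<cdot>\<^bsub>Ho M\<^esub> ho_arr M (i (R A))
        \<cdot>\<^bsub>Ho M\<^esub> ho_arr M (harr H e (ident M (R A))))"

definition j_r ::
  "('o, 'm, 'x) model_cat_scheme \<Rightarrow> ('o, 'm) bifunc \<Rightarrow> ('o \<Rightarrow> 'm)
    \<Rightarrow> 'o \<Rightarrow> 'o \<times> 'o \<times> 'm step list set" where
  "j_r M H j A =
     (let Q = OMap (Qfun M) in
        ho_arr M (harr H (ident M (Q A)) (qmap M A))
        \<cdot>\<^bsub>Ho M\<^esub> ho_arr M (harr H (pmap M A) (ident M A))
        \<cdot>\<^bsub>Ho M\<^esub> ho_arr M (j A))"

end

theory Submission
  imports Defs
begin

text \<open>
  The derived structure is compared with the original one along the localisation functor, and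
  every axiom is pulled back to the corresponding axiom of \<open>M\<close>.

  The functor \<open>[Q -, R -]\<close> sends weak equivalences to isomorphisms of \<open>Ho M\<close>: contravariantly by Axiom C,
  covariantly because a functor that inverts trivial fibrations inverts weak equivalences between
  fibrant objects (\<open>Ken_Brown\<close>).  It therefore extends to a bifunctor \<open>Hr\<close> on \<open>Ho M\<close>.  The arrows
  \<open>eta a b = [p, q]\<close> from \<open>[a, b]\<close> to \<open>Hr (a, b)\<close> are natural, and invertible when \<open>a\<close> is cofibrant and
  \<open>b\<close> fibrant, which yields the universal property of the derived functor (\<open>right_derived\<close>).

  The lifts \<open>k\<close> are not natural in \<open>M\<close>, and \<open>[-, y]\<close> is applied to them although their codomain need not be
  cofibrant.  However, if \<open>f\<close> has cofibrant domain and \<open>y\<close> is fibrant, then the class of \<open>[f, y]\<close> in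
  \<open>Ho M\<close> depends only on that of \<open>f\<close> (\<open>homotopy_invariance\<close>).  Since the class of \<open>k\<close> is forced to be
  \<open>[1, p]\<close> inverse after \<open>p\<close>, this makes \<open>k\<close> as natural as is needed (\<open>ho_k_natural\<close>), and with it \<open>L_r\<close>.

  The heart of the proof is that \<open>eta\<close> makes the localisation a closed functor: it carries \<open>L\<close>, \<open>i\<close> and
  \<open>j\<close> to \<open>L_r\<close>, \<open>i_r\<close> and \<open>j_r\<close> (\<open>Lr_eta\<close>, \<open>ir_eta\<close>, \<open>jr_eq\<close>), for all objects of \<open>M\<close>.  Each object is
  isomorphic in \<open>Ho M\<close> to the cofibrant and fibrant object \<open>R Q a\<close>, and at such objects \<open>eta\<close> is invertible.
  Hence an axiom for the derived structure may be checked after composing with these comparisons,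
  and there naturality reduces it to the same axiom in \<open>M\<close>.
\<close>

section \<open>Composition, isomorphisms and opposites\<close>

definition is_iso :: "('o, 'm, 'x) cat_scheme \<Rightarrow> 'm \<Rightarrow> bool" where
  "is_iso C f \<longleftrightarrow> (\<exists>g. f \<in> Arr C \<and> g \<in> hom C (Cod C f) (Dom C f)
     \<and> g \<cdot>\<^bsub>C\<^esub> f = ident C (Dom C f) \<and> f \<cdot>\<^bsub>C\<^esub> g = ident C (Cod C f))"

context category
begin

lemma Dom_Obj [simp]: "f \<in> Arr C \<Longrightarrow> Dom C f \<in> Obj C"
  and Cod_Obj [simp]: "f \<in> Arr C \<Longrightarrow> Cod C f \<in> Obj C"
  by (fact Dom_in_Obj, fact Cod_in_Obj)

lemma ident_Arr [simp]: "a \<in> Obj C \<Longrightarrow> ident C a \<in> Arr C"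
  and Dom_ident [simp]: "a \<in> Obj C \<Longrightarrow> Dom C (ident C a) = a"
  and Cod_ident [simp]: "a \<in> Obj C \<Longrightarrow> Cod C (ident C a) = a"
  using ident_in_hom[of a] by (auto simp: hom_def)

lemma comp_Arr [simp]: "f \<in> Arr C \<Longrightarrow> g \<in> Arr C \<Longrightarrow> Cod C f = Dom C g \<Longrightarrow> g \<cdot> f \<in> Arr C"
  and Dom_comp [simp]:
    "f \<in> Arr C \<Longrightarrow> g \<in> Arr C \<Longrightarrow> Cod C f = Dom C g \<Longrightarrow> Dom C (g \<cdot> f) = Dom C f"
  and Cod_comp [simp]:
    "f \<in> Arr C \<Longrightarrow> g \<in> Arr C \<Longrightarrow> Cod C f = Dom C g \<Longrightarrow> Cod C (g \<cdot> f) = Cod C g"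
  using comp_in_hom[of f "Dom C f" "Cod C f" g "Cod C g"] by (auto simp: hom_def)

lemma ident_right [simp]: "f \<in> Arr C \<Longrightarrow> Dom C f = a \<Longrightarrow> f \<cdot> ident C a = f"
  and ident_left [simp]: "f \<in> Arr C \<Longrightarrow> Cod C f = b \<Longrightarrow> ident C b \<cdot> f = f"
  using comp_ident_right[of f a "Cod C f"] comp_ident_left[of f "Dom C f" b]
  by (auto simp: hom_def)

lemma assoc:
  "f \<in> Arr C \<Longrightarrow> g \<in> Arr C \<Longrightarrow> h \<in> Arr C \<Longrightarrow> Cod C f = Dom C g \<Longrightarrow> Cod C g = Dom C h
    \<Longrightarrow> (h \<cdot> g) \<cdot> f = h \<cdot> (g \<cdot> f)"
  using comp_assoc[of f "Dom C f" "Cod C f" g "Cod C g" h "Cod C h"] by (auto simp: hom_def)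

lemma is_isoI:
  "f \<in> Arr C \<Longrightarrow> g \<in> Arr C \<Longrightarrow> Dom C g = Cod C f \<Longrightarrow> Cod C g = Dom C f
    \<Longrightarrow> g \<cdot> f = ident C (Dom C f) \<Longrightarrow> f \<cdot> g = ident C (Cod C f) \<Longrightarrow> is_iso C f"
  unfolding is_iso_def hom_def by blast

lemma inv_arr_eqI:
  assumes "f \<in> Arr C" "g \<in> Arr C" "Dom C g = Cod C f" "Cod C g = Dom C f"
    "g \<cdot> f = ident C (Dom C f)" "f \<cdot> g = ident C (Cod C f)"
  shows "inv_arr C f = g"
  unfolding inv_arr_def
proof (rule the_equality)
  show "g \<in> hom C (Cod C f) (Dom C f) \<and> g \<cdot> f = ident C (Dom C f) \<and> f \<cdot> g = ident C (Cod C f)"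
    using assms by (simp add: hom_def)
next
  fix h
  assume h: "h \<in> hom C (Cod C f) (Dom C f) \<and> h \<cdot> f = ident C (Dom C f) \<and> f \<cdot> h = ident C (Cod C f)"
  have "h = h \<cdot> (f \<cdot> g)" using h assms by (simp add: hom_def)
  also have "\<dots> = (h \<cdot> f) \<cdot> g" using h assms by (intro assoc[symmetric]) (auto simp: hom_def)
  also have "\<dots> = g" using h assms by simp
  finally show "h = g" .
qed

lemma is_iso_inverse:
  assumes "is_iso C f"
  obtains g where "f \<in> Arr C" "g \<in> Arr C" "Dom C g = Cod C f" "Cod C g = Dom C f"
    "g \<cdot> f = ident C (Dom C f)" "f \<cdot> g = ident C (Cod C f)" "inv_arr C f = g"
  using assms inv_arr_eqI unfolding is_iso_def hom_def by blast

lemma is_iso_Arr: "is_iso C f \<Longrightarrow> f \<in> Arr C"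
  by (simp add: is_iso_def)

lemma inv_arr_Arr [simp]: "is_iso C f \<Longrightarrow> inv_arr C f \<in> Arr C"
  and Dom_inv_arr [simp]: "is_iso C f \<Longrightarrow> Dom C (inv_arr C f) = Cod C f"
  and Cod_inv_arr [simp]: "is_iso C f \<Longrightarrow> Cod C (inv_arr C f) = Dom C f"
  and inv_arr_comp [simp]: "is_iso C f \<Longrightarrow> inv_arr C f \<cdot> f = ident C (Dom C f)"
  and comp_inv_arr [simp]: "is_iso C f \<Longrightarrow> f \<cdot> inv_arr C f = ident C (Cod C f)"
  by (auto elim!: is_iso_inverse)

lemma is_iso_inv_arr [simp]: "is_iso C f \<Longrightarrow> is_iso C (inv_arr C f)"
  by (rule is_isoI[of _ f]) (simp_all add: is_iso_Arr)

lemma inv_arr_comp_cancel [simp]: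
  "is_iso C f \<Longrightarrow> g \<in> Arr C \<Longrightarrow> Cod C g = Dom C f \<Longrightarrow> inv_arr C f \<cdot> (f \<cdot> g) = g"
  by (simp add: is_iso_Arr flip: assoc)

lemma comp_inv_arr_cancel [simp]:
  "is_iso C f \<Longrightarrow> g \<in> Arr C \<Longrightarrow> Cod C g = Cod C f \<Longrightarrow> f \<cdot> (inv_arr C f \<cdot> g) = g"
  by (simp add: is_iso_Arr flip: assoc)

lemma is_iso_ident [simp]: "a \<in> Obj C \<Longrightarrow> is_iso C (ident C a)"
  by (rule is_isoI[of _ "ident C a"]) simp_all

lemma is_iso_comp:
  assumes "is_iso C f" "is_iso C g" "Cod C f = Dom C g"
  shows "is_iso C (g \<cdot> f)"
  using assms
  by (intro is_isoI[of _ "inv_arr C f \<cdot> inv_arr C g"]) (simp_all add: is_iso_Arr assoc)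

lemma iso_cancel_left:
  assumes "is_iso C h" "f \<in> Arr C" "g \<in> Arr C" "Cod C f = Dom C h" "Cod C g = Dom C h"
    and eq: "h \<cdot> f = h \<cdot> g"
  shows "f = g"
proof -
  have "f = inv_arr C h \<cdot> (h \<cdot> f)" using assms(1-5) by simp
  also have "\<dots> = g" unfolding eq using assms(1-5) by simp
  finally show ?thesis .
qed

lemma iso_cancel_right:
  assumes "is_iso C h" "f \<in> Arr C" "g \<in> Arr C" "Dom C f = Cod C h" "Dom C g = Cod C h"
    "f \<cdot> h = g \<cdot> h"
  shows "f = g"
proof -
  have "f = (f \<cdot> h) \<cdot> inv_arr C h" using assms(1-5) by (simp add: is_iso_Arr assoc)
  also have "\<dots> = g" unfolding assms(6) using assms(1-5) by (simp add: is_iso_Arr assoc)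
  finally show ?thesis .
qed

lemma is_iso_cancel_left:
  assumes "is_iso C g" "is_iso C (g \<cdot> f)" "f \<in> Arr C" "Cod C f = Dom C g"
  shows "is_iso C f"
proof -
  have "f = inv_arr C g \<cdot> (g \<cdot> f)" using assms by simp
  then show ?thesis
    using is_iso_comp[OF assms(2), of "inv_arr C g"] assms by (simp add: is_iso_Arr)
qed

text \<open>The middle arrow has a left inverse because \<open>h \<cdot> g\<close> is invertible and a right inverse because
  \<open>g \<cdot> f\<close> is, so it is invertible, and then so is \<open>f\<close>.\<close>

lemma is_iso_two_of_six:
  assumes gf: "is_iso C (g \<cdot> f)" and hg: "is_iso C (h \<cdot> g)"
    and [simp]: "f \<in> Arr C" "g \<in> Arr C" "h \<in> Arr C" "Cod C f = Dom C g" "Cod C g = Dom C h"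
  shows "is_iso C f"
proof -
  define l where "l = inv_arr C (h \<cdot> g) \<cdot> h"
  define r where "r = f \<cdot> inv_arr C (g \<cdot> f)"
  have [simp]: "l \<in> Arr C" "Dom C l = Cod C g" "Cod C l = Dom C g"
    "r \<in> Arr C" "Dom C r = Cod C g" "Cod C r = Dom C g"
    using gf hg by (simp_all add: l_def r_def)
  have lg: "l \<cdot> g = ident C (Dom C g)"
    using hg inv_arr_comp[OF hg] by (simp add: l_def assoc)
  have gr: "g \<cdot> r = ident C (Cod C g)"
    using gf comp_inv_arr[OF gf] by (simp add: r_def flip: assoc)
  have "l = l \<cdot> (g \<cdot> r)" by (simp add: gr)
  also have "\<dots> = r" by (simp add: lg flip: assoc)
  finally have "is_iso C g"
    using lg gr by (intro is_isoI[of _ l]) simp_all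
  then show ?thesis
    by (rule is_iso_cancel_left[OF _ gf]) simp_all
qed

end

lemma opp_simps [simp]:
  "Obj (opp C) = Obj C" "Arr (opp C) = Arr C" "Dom (opp C) = Cod C" "Cod (opp C) = Dom C"
  "ident (opp C) = ident C" "Comp (opp C) f g = g \<cdot>\<^bsub>C\<^esub> f"
  by (simp_all add: opp_def)

lemma prod_cat_simps [simp]:
  "Obj (prod_cat A B) = Obj A \<times> Obj B" "Arr (prod_cat A B) = Arr A \<times> Arr B"
  "Dom (prod_cat A B) (f, g) = (Dom A f, Dom B g)"
  "Cod (prod_cat A B) (f, g) = (Cod A f, Cod B g)"
  "ident (prod_cat A B) (a, b) = (ident A a, ident B b)"
  "Comp (prod_cat A B) (f, g) (f', g') = (f \<cdot>\<^bsub>A\<^esub> f', g \<cdot>\<^bsub>B\<^esub> g')"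
  by (simp_all add: prod_cat_def)

lemma category_opp:
  assumes "category C"
  shows "category (opp C)"
proof -
  interpret category C by fact
  show ?thesis by unfold_locales (auto simp: hom_def assoc)
qed

lemma category_prod_cat:
  assumes "category A" "category B"
  shows "category (prod_cat A B)"
proof -
  interpret A: category A by fact
  interpret B: category B by fact
  show ?thesis by unfold_locales (auto simp: hom_def A.assoc B.assoc)
qed

lemma inv_arr_opp [simp]: "inv_arr (opp C) f = inv_arr C f"
  by (simp add: inv_arr_def hom_def conj_ac)

lemma is_iso_opp [simp]: "is_iso (opp C) f = is_iso C f"
  by (auto simp: is_iso_def hom_def)


section \<open>Internal homs as bifunctors\<close>

locale internal_hom = category C
  for C :: "('o, 'm, 'x) cat_scheme" (structure) +
  fixes H :: "('o, 'm) bifunc"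
  assumes bifunctor: "is_functor (prod_cat (opp C) C) C H"
begin

lemma hob_Obj [simp]: "a \<in> Obj C \<Longrightarrow> b \<in> Obj C \<Longrightarrow> hob H a b \<in> Obj C"
  using bifunctor by (simp add: is_functor_def)

lemma harr_Arr [simp]: "f \<in> Arr C \<Longrightarrow> g \<in> Arr C \<Longrightarrow> harr H f g \<in> Arr C"
  and Dom_harr [simp]:
    "f \<in> Arr C \<Longrightarrow> g \<in> Arr C \<Longrightarrow> Dom C (harr H f g) = hob H (Cod C f) (Dom C g)"
  and Cod_harr [simp]:
    "f \<in> Arr C \<Longrightarrow> g \<in> Arr C \<Longrightarrow> Cod C (harr H f g) = hob H (Dom C f) (Cod C g)"
  using bifunctor by (simp_all add: is_functor_def hom_def)

lemma harr_ident [simp]: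
  "a \<in> Obj C \<Longrightarrow> b \<in> Obj C \<Longrightarrow> harr H (ident C a) (ident C b) = ident C (hob H a b)"
  using bifunctor by (simp add: is_functor_def)

lemma harr_comp:
  "f \<in> Arr C \<Longrightarrow> g \<in> Arr C \<Longrightarrow> f' \<in> Arr C \<Longrightarrow> g' \<in> Arr C \<Longrightarrow> Cod C f = Dom C f' \<Longrightarrow>
    Cod C g' = Dom C g \<Longrightarrow> harr H f g \<cdot> harr H f' g' = harr H (f' \<cdot> f) (g \<cdot> g')"
  using bifunctor by (simp add: is_functor_def)

lemma harr_comp_assoc:
  "f \<in> Arr C \<Longrightarrow> g \<in> Arr C \<Longrightarrow> f' \<in> Arr C \<Longrightarrow> g' \<in> Arr C \<Longrightarrow> Cod C f = Dom C f' \<Longrightarrow>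
    Cod C g' = Dom C g \<Longrightarrow> h \<in> Arr C \<Longrightarrow> Cod C h = hob H (Cod C f') (Dom C g') \<Longrightarrow>
    harr H f g \<cdot> (harr H f' g' \<cdot> h) = harr H (f' \<cdot> f) (g \<cdot> g') \<cdot> h"
  by (simp add: assoc[symmetric] harr_comp)

lemma is_iso_harr:
  assumes "is_iso C f" "is_iso C g"
  shows "is_iso C (harr H f g)"
  using assms
  by (intro is_isoI[of _ "harr H (inv_arr C f) (inv_arr C g)"])
    (simp_all add: is_iso_Arr harr_comp)

end

lemma internal_homI:
  assumes "category C"
    and "\<And>a b. a \<in> Obj C \<Longrightarrow> b \<in> Obj C \<Longrightarrow> hob H a b \<in> Obj C"
    and "\<And>f g. f \<in> Arr C \<Longrightarrow> g \<in> Arr C \<Longrightarrow>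
      harr H f g \<in> hom C (hob H (Cod C f) (Dom C g)) (hob H (Dom C f) (Cod C g))"
    and "\<And>a b. a \<in> Obj C \<Longrightarrow> b \<in> Obj C \<Longrightarrow>
      harr H (ident C a) (ident C b) = ident C (hob H a b)"
    and "\<And>f g f' g'. f \<in> Arr C \<Longrightarrow> g \<in> Arr C \<Longrightarrow> f' \<in> Arr C \<Longrightarrow> g' \<in> Arr C \<Longrightarrow>
      Cod C f = Dom C f' \<Longrightarrow> Cod C g' = Dom C g \<Longrightarrow>
      harr H (f' \<cdot>\<^bsub>C\<^esub> f) (g \<cdot>\<^bsub>C\<^esub> g') = harr H f g \<cdot>\<^bsub>C\<^esub> harr H f' g'"
  shows "internal_hom C H"
proof -
  have "is_functor (prod_cat (opp C) C) C H"
    unfolding is_functor_def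
  proof (intro conjI ballI impI)
    fix f g
    assume "f \<in> Arr (prod_cat (opp C) C)" "g \<in> Arr (prod_cat (opp C) C)"
      "Cod (prod_cat (opp C) C) f = Dom (prod_cat (opp C) C) g"
    then show "AMap H (g \<cdot>\<^bsub>prod_cat (opp C) C\<^esub> f) = AMap H g \<cdot>\<^bsub>C\<^esub> AMap H f"
      using assms(5) by (cases f; cases g) simp
  qed (use assms(1-4) in \<open>auto simp: category_opp category_prod_cat\<close>)
  then show ?thesis
    using assms(1) by (simp add: internal_hom_def internal_hom_axioms_def)
qed

section \<open>The localisation and its universal property\<close>

definition zz_arr :: "('o, 'm, 'x) model_cat_scheme \<Rightarrow> 'o \<Rightarrow> 'm step list \<Rightarrow> 'o
    \<Rightarrow> 'o \<times> 'o \<times> 'm step list set" where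
  "zz_arr M a w b = (a, b, Collect (zz_eq M a b w))"

context model_category
begin

lemma weq_Arr [simp]: "f \<in> weq M \<Longrightarrow> f \<in> Arr M"
  using weq_subcategory by (auto simp: wide_subcategory_def)

lemma zigzag_Obj:
  "zigzag M a w b \<Longrightarrow> a \<in> Obj M" "zigzag M a w b \<Longrightarrow> b \<in> Obj M"
proof -
  have "zigzag M a w b \<Longrightarrow> a \<in> Obj M \<and> b \<in> Obj M"
    by (induction w arbitrary: a rule: list.induct) (auto split: step.splits elim: zigzag.elims)
  then show "zigzag M a w b \<Longrightarrow> a \<in> Obj M" "zigzag M a w b \<Longrightarrow> b \<in> Obj M" by simp_all
qed

lemma zigzag_append:
  assumes "zigzag M a u b" "zigzag M b v c"
  shows "zigzag M a (u @ v) c"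
  using assms
proof (induction u arbitrary: a)
  case (Cons s u)
  then show ?case by (cases s) auto
qed simp

lemma zz_eq_zigzag:
  assumes "zz_eq M a b u v"
  shows "zigzag M a u b" "zigzag M a v b"
proof -
  have "zigzag M a u b \<and> zigzag M a v b"
    using assms by induction (auto intro: zigzag_append)
  then show "zigzag M a u b" "zigzag M a v b" by simp_all
qed

lemma zz_eq_append_left:
  assumes "zz_eq M a b u v" "zigzag M b w c"
  shows "zz_eq M a c (u @ w) (v @ w)"
  using assms
proof (induction)
  case (zz_context u d x e y v)
  then show ?case
    using zz_eq.zz_context[of M a u d x e y "v @ w" c] by (simp add: zigzag_append)
qed (auto intro: zz_eq.intros zigzag_append)

lemma zz_eq_append_right:
  assumes "zz_eq M a b u v" "zigzag M c w a"
  shows "zz_eq M c b (w @ u) (w @ v)"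
  using assms
proof (induction)
  case (zz_context u d x e y v)
  then show ?case
    using zz_eq.zz_context[of M c "w @ u" d x e y v b] by (simp add: zigzag_append)
qed (auto intro: zz_eq.intros zigzag_append)

lemma zz_eq_append: "zz_eq M a b u u' \<Longrightarrow> zz_eq M b c v v' \<Longrightarrow> zz_eq M a c (u @ v) (u' @ v')"
  using zz_eq_append_left zz_eq_append_right zz_trans zz_eq_zigzag by metis

lemma zz_eq_if_zz_rel:
  "zz_rel M x y \<Longrightarrow> zigzag M a x b \<Longrightarrow> zigzag M a y b \<Longrightarrow> zz_eq M a b x y"
  using zz_context[of M a "[]" a x b y "[]" b] by (simp add: zigzag_Obj)

lemma zz_arr_eq_iff:
  assumes "zigzag M a u b"
  shows "zz_arr M a u b = zz_arr M a v b \<longleftrightarrow> zz_eq M a b u v"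
  using assms unfolding zz_arr_def by (auto intro: zz_eq.intros)

lemma zz_arr_comp:
  assumes "zigzag M a u b" "zigzag M b v c"
  shows "zz_arr M b v c \<cdot>\<^bsub>Ho M\<^esub> zz_arr M a u b = zz_arr M a (u @ v) c"
  using assms
  by (auto simp: Ho_def zz_arr_def intro: zz_trans zz_eq_append zz_refl)

lemma Ho_simps [simp]:
  "Obj (Ho M) = Obj M" "Dom (Ho M) (zz_arr M a w b) = a" "Cod (Ho M) (zz_arr M a w b) = b"
  by (simp_all add: Ho_def zz_arr_def)

lemma ident_Ho: "ident (Ho M) a = zz_arr M a [] a"
  by (simp add: Ho_def zz_arr_def)

lemma Arr_Ho: "Arr (Ho M) = {zz_arr M a w b | a b w. zigzag M a w b}"
  by (simp add: Ho_def zz_arr_def)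

lemma zz_arr_Arr [simp]: "zigzag M a w b \<Longrightarrow> zz_arr M a w b \<in> Arr (Ho M)"
  by (auto simp: Arr_Ho)

lemma hom_Ho: "\<phi> \<in> hom (Ho M) a b \<longleftrightarrow> (\<exists>w. zigzag M a w b \<and> \<phi> = zz_arr M a w b)"
  by (auto simp: hom_def Arr_Ho)

lemma category_Ho: "category (Ho M)"
proof
  show "Dom (Ho M) f \<in> Obj (Ho M)" "Cod (Ho M) f \<in> Obj (Ho M)" if "f \<in> Arr (Ho M)" for f
    using that by (auto simp: Arr_Ho zigzag_Obj)
  show "ident (Ho M) a \<in> hom (Ho M) a a" if "a \<in> Obj (Ho M)" for a
    using that by (auto simp: ident_Ho hom_Ho intro: exI[of _ "[]"])
  show "g \<cdot>\<^bsub>Ho M\<^esub> f \<in> hom (Ho M) a c" if "f \<in> hom (Ho M) a b" "g \<in> hom (Ho M) b c" for f g a b c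
    using that by (auto simp: hom_Ho zz_arr_comp intro: zigzag_append)
  show "f \<cdot>\<^bsub>Ho M\<^esub> ident (Ho M) a = f" "ident (Ho M) b \<cdot>\<^bsub>Ho M\<^esub> f = f"
    if "f \<in> hom (Ho M) a b" for f a b
    using that by (auto simp: hom_Ho zz_arr_comp ident_Ho zigzag_Obj)
  show "(h \<cdot>\<^bsub>Ho M\<^esub> g) \<cdot>\<^bsub>Ho M\<^esub> f = h \<cdot>\<^bsub>Ho M\<^esub> g \<cdot>\<^bsub>Ho M\<^esub> f"
    if "f \<in> hom (Ho M) a b" "g \<in> hom (Ho M) b c" "h \<in> hom (Ho M) c d" for f g h a b c d
    using that by (auto simp: hom_Ho zz_arr_comp zigzag_append)
qed

sublocale Ho: category "Ho M"
  rewrites "Obj (Ho M) = Obj M"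
  by (rule category_Ho) simp

lemma ho_arr_eq: "ho_arr M f = zz_arr M (Dom M f) [Fwd f] (Cod M f)"
  by (simp add: Loc_def zz_arr_def)

lemma OMap_Loc [simp]: "OMap (Loc M) a = a"
  by (simp add: Loc_def)

lemma ho_arr_Arr [simp]: "f \<in> Arr M \<Longrightarrow> ho_arr M f \<in> Arr (Ho M)"
  and Dom_ho_arr [simp]: "Dom (Ho M) (ho_arr M f) = Dom M f"
  and Cod_ho_arr [simp]: "Cod (Ho M) (ho_arr M f) = Cod M f"
  by (simp_all add: ho_arr_eq)

lemma ho_arr_ident [simp]: "a \<in> Obj M \<Longrightarrow> ho_arr M (ident M a) = ident (Ho M) a"
  by (simp add: ho_arr_eq ident_Ho zz_arr_eq_iff zz_eq_if_zz_rel zz_ident)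

lemma ho_arr_comp:
  "f \<in> Arr M \<Longrightarrow> g \<in> Arr M \<Longrightarrow> Cod M f = Dom M g
    \<Longrightarrow> ho_arr M (g \<cdot> f) = ho_arr M g \<cdot>\<^bsub>Ho M\<^esub> ho_arr M f"
  using zz_arr_comp[of "Dom M f" "[Fwd f]" "Cod M f" "[Fwd g]" "Cod M g"]
  by (simp add: ho_arr_eq zz_arr_eq_iff zz_sym zz_eq_if_zz_rel zz_comp)

lemma is_functor_Loc: "is_functor M (Ho M) (Loc M)"
  unfolding is_functor_def
  by (intro conjI ballI impI) (simp_all add: hom_def ho_arr_comp category_axioms Ho.category_axioms)

lemma
  assumes "f \<in> weq M"
  shows is_iso_ho_arr [simp]: "is_iso (Ho M) (ho_arr M f)"
    and inv_ho_arr: "inv_arr (Ho M) (ho_arr M f) = zz_arr M (Cod M f) [Bwd f] (Dom M f)"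
proof -
  have eqs: "zz_arr M (Cod M f) [Bwd f] (Dom M f) \<cdot>\<^bsub>Ho M\<^esub> ho_arr M f = ident (Ho M) (Dom M f)"
      "ho_arr M f \<cdot>\<^bsub>Ho M\<^esub> zz_arr M (Cod M f) [Bwd f] (Dom M f) = ident (Ho M) (Cod M f)"
    using assms zz_fwd_bwd[OF assms] zz_bwd_fwd[OF assms]
    by (simp_all add: ho_arr_eq zz_arr_comp ident_Ho zz_arr_eq_iff zz_eq_if_zz_rel)
  then show "is_iso (Ho M) (ho_arr M f)"
      "inv_arr (Ho M) (ho_arr M f) = zz_arr M (Cod M f) [Bwd f] (Dom M f)"
    using assms
    by (auto intro!: Ho.is_isoI[of _ "zz_arr M (Cod M f) [Bwd f] (Dom M f)"] Ho.inv_arr_eqI)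
qed

text \<open>This is the form in which properties of arrows pass from \<open>M\<close> to \<open>Ho M\<close>: a zigzag is a
  composite of localised arrows and inverses of such.  The inversion case is stated for an arbitrary
  isomorphism since a naturality square, once known to commute, can be inverted without knowing
  where its sides come from.\<close>

lemma Ho_induct [consumes 1, case_names ho inv comp]:
  assumes "\<phi> \<in> Arr (Ho M)"
    and ho: "\<And>f. f \<in> Arr M \<Longrightarrow> P (ho_arr M f)"
    and inv: "\<And>\<phi>. is_iso (Ho M) \<phi> \<Longrightarrow> P \<phi> \<Longrightarrow> P (inv_arr (Ho M) \<phi>)"
    and comp: "\<And>\<phi> \<psi>. \<phi> \<in> Arr (Ho M) \<Longrightarrow> \<psi> \<in> Arr (Ho M) \<Longrightarrow> Cod (Ho M) \<phi> = Dom (Ho M) \<psi>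
      \<Longrightarrow> P \<phi> \<Longrightarrow> P \<psi> \<Longrightarrow> P (\<psi> \<cdot>\<^bsub>Ho M\<^esub> \<phi>)"
  shows "P \<phi>"
proof -
  have "P (zz_arr M a w b)" if "zigzag M a w b" for a w b
    using that
  proof (induction w arbitrary: a)
    case Nil
    then show ?case using ho[of "ident M a"] by (auto simp: ident_Ho)
  next
    case (Cons s w)
    show ?case
    proof (cases s)
      case (Fwd f)
      then show ?thesis
        using Cons comp[OF ho_arr_Arr zz_arr_Arr _ ho, of f "Cod M f" w b]
        by (simp add: ho_arr_eq zz_arr_comp)
    next
      case (Bwd f)
      then have f: "f \<in> weq M" "Cod M f = a" "zigzag M (Dom M f) w b" using Cons by simp_all
      then have "P (zz_arr M a [Bwd f] (Dom M f))"
        using inv[OF is_iso_ho_arr ho, of f] inv_ho_arr[of f] by simp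
      then show ?thesis
        using f Bwd Cons.IH[of "Dom M f"]
          comp[of "zz_arr M a [Bwd f] (Dom M f)" "zz_arr M (Dom M f) w b"]
        by (simp add: zz_arr_comp)
    qed
  qed
  then show ?thesis using assms(1) by (auto simp: Arr_Ho)
qed

end

fun zz_eval :: "('o, 'm, 'x) model_cat_scheme \<Rightarrow> ('p, 'n, 'y) cat_scheme \<Rightarrow> ('o, 'm, 'p, 'n) func
    \<Rightarrow> 'o \<Rightarrow> 'm step list \<Rightarrow> 'n" where
  "zz_eval M K F a [] = ident K (OMap F a)"
| "zz_eval M K F a (Fwd f # w) = zz_eval M K F (Cod M f) w \<cdot>\<^bsub>K\<^esub> AMap F f"
| "zz_eval M K F a (Bwd f # w) = zz_eval M K F (Dom M f) w \<cdot>\<^bsub>K\<^esub> inv_arr K (AMap F f)"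

text \<open>The value on a class of zigzags is computed from an arbitrary representative; the choice does not
  matter once \<open>F\<close> inverts weak equivalences, because then related zigzags have equal values.\<close>

definition Ho_ext :: "('o, 'm, 'x) model_cat_scheme \<Rightarrow> ('p, 'n, 'y) cat_scheme
    \<Rightarrow> ('o, 'm, 'p, 'n) func \<Rightarrow> ('o, 'o \<times> 'o \<times> 'm step list set, 'p, 'n) func" where
  "Ho_ext M K F = \<lparr>OMap = OMap F, AMap = (\<lambda>(a, b, S). zz_eval M K F a (SOME w. w \<in> S))\<rparr>"

locale inverting_functor = model_category M + K: category K
  for M :: "('o, 'm, 'x) model_cat_scheme" (structure)
    and K :: "('p, 'n, 'y) cat_scheme"
    and F :: "('o, 'm, 'p, 'n) func" +
  assumes F: "is_functor M K F"
    and F_weq: "f \<in> weq M \<Longrightarrow> is_iso K (AMap F f)"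
begin

lemma F_simps [simp]:
  "a \<in> Obj M \<Longrightarrow> OMap F a \<in> Obj K"
  "f \<in> Arr M \<Longrightarrow> AMap F f \<in> Arr K"
  "f \<in> Arr M \<Longrightarrow> Dom K (AMap F f) = OMap F (Dom M f)"
  "f \<in> Arr M \<Longrightarrow> Cod K (AMap F f) = OMap F (Cod M f)"
  "a \<in> Obj M \<Longrightarrow> AMap F (ident M a) = ident K (OMap F a)"
  "f \<in> Arr M \<Longrightarrow> g \<in> Arr M \<Longrightarrow> Cod M f = Dom M g
    \<Longrightarrow> AMap F (g \<cdot> f) = AMap F g \<cdot>\<^bsub>K\<^esub> AMap F f"
  using F by (simp_all add: is_functor_def hom_def)

lemma zz_eval_hom:
  assumes "zigzag M a w b"
  shows "zz_eval M K F a w \<in> Arr K"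
    "Dom K (zz_eval M K F a w) = OMap F a" "Cod K (zz_eval M K F a w) = OMap F b"
proof -
  have "zz_eval M K F a w \<in> Arr K \<and> Dom K (zz_eval M K F a w) = OMap F a
      \<and> Cod K (zz_eval M K F a w) = OMap F b"
    using assms
  proof (induction w arbitrary: a)
    case (Cons s w)
    then show ?case by (cases s) (auto simp: F_weq)
  qed simp
  then show "zz_eval M K F a w \<in> Arr K"
    "Dom K (zz_eval M K F a w) = OMap F a" "Cod K (zz_eval M K F a w) = OMap F b" by simp_all
qed

lemma zz_eval_append:
  assumes "zigzag M a u b" "zigzag M b v c"
  shows "zz_eval M K F a (u @ v) = zz_eval M K F b v \<cdot>\<^bsub>K\<^esub> zz_eval M K F a u"
  using assms
proof (induction u arbitrary: a)
  case Nil
  then show ?case by (simp add: zz_eval_hom)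
next
  case (Cons s u)
  then show ?case by (cases s) (auto simp: F_weq zz_eval_hom K.assoc)
qed

lemma zz_eval_rel:
  assumes "zz_rel M x y" "zigzag M a x b" "zigzag M a y b"
  shows "zz_eval M K F a x = zz_eval M K F a y"
  using assms by cases (auto simp: F_weq K.assoc)

lemma zz_eval_eq:
  assumes "zz_eq M a b u v"
  shows "zz_eval M K F a u = zz_eval M K F a v"
  using assms
proof (induction)
  case (zz_context u c x d y v)
  note z = zz_context
  have "zz_eval M K F a (u @ w @ v)
      = (zz_eval M K F d v \<cdot>\<^bsub>K\<^esub> zz_eval M K F c w) \<cdot>\<^bsub>K\<^esub> zz_eval M K F a u"
    if "zigzag M c w d" for w
    using that z zigzag_append[of c w d v b]
    by (simp add: zz_eval_append[of a u c _ b] zz_eval_append[of c w d v b])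
  then show ?case using z by (simp add: zz_eval_rel[of x y])
qed simp_all

lemma Ho_ext_zz_arr:
  assumes "zigzag M a w b"
  shows "AMap (Ho_ext M K F) (zz_arr M a w b) = zz_eval M K F a w"
proof -
  have "zz_eq M a b w (SOME v. zz_eq M a b w v)"
    using zz_refl[OF assms] by (rule someI)
  then show ?thesis by (simp add: Ho_ext_def zz_arr_def zz_eval_eq)
qed

lemma OMap_Ho_ext [simp]: "OMap (Ho_ext M K F) a = OMap F a"
  by (simp add: Ho_ext_def)

lemma Ho_ext_ho_arr [simp]: "f \<in> Arr M \<Longrightarrow> AMap (Ho_ext M K F) (ho_arr M f) = AMap F f"
  by (simp add: ho_arr_eq Ho_ext_zz_arr)

lemma is_functor_Ho_ext: "is_functor (Ho M) K (Ho_ext M K F)"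
  unfolding is_functor_def
proof (intro conjI ballI impI)
  show "AMap (Ho_ext M K F) (g \<cdot>\<^bsub>Ho M\<^esub> f) = AMap (Ho_ext M K F) g \<cdot>\<^bsub>K\<^esub> AMap (Ho_ext M K F) f"
    if "f \<in> Arr (Ho M)" "g \<in> Arr (Ho M)" "Cod (Ho M) f = Dom (Ho M) g" for f g
    using that by (auto simp: Arr_Ho zz_arr_comp Ho_ext_zz_arr zigzag_append zz_eval_append)
qed (auto simp: Ho.category_axioms K.category_axioms Arr_Ho Ho_ext_zz_arr hom_def zz_eval_hom
    ident_Ho)

end

section \<open>Cofibrant and fibrant replacement\<close>

lemma
  assumes "functorial_factorisation C E"
  shows fmid_square: "comm_square C f g u v \<Longrightarrow>
      comm_square C (fleft E f) (fleft E g) u (fmid E f g u v)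
      \<and> comm_square C (fright E f) (fright E g) (fmid E f g u v) v"
    and fmid_ident: "f \<in> Arr C \<Longrightarrow>
      fmid E f f (ident C (Dom C f)) (ident C (Cod C f)) = ident C (Cod C (fleft E f))"
    and fmid_comp: "comm_square C f g u v \<Longrightarrow> comm_square C g h u' v' \<Longrightarrow>
      fmid E f h (u' \<cdot>\<^bsub>C\<^esub> u) (v' \<cdot>\<^bsub>C\<^esub> v) = fmid E g h u' v' \<cdot>\<^bsub>C\<^esub> fmid E f g u v"
  using assms unfolding functorial_factorisation_def by blast+

context model_category
begin

abbreviation Qob :: "'o \<Rightarrow> 'o" where "Qob \<equiv> OMap (Qfun M)"
abbreviation Qar :: "'m \<Rightarrow> 'm" where "Qar \<equiv> AMap (Qfun M)"
abbreviation Rob :: "'o \<Rightarrow> 'o" where "Rob \<equiv> OMap (Rfun M)"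
abbreviation Rar :: "'m \<Rightarrow> 'm" where "Rar \<equiv> AMap (Rfun M)"

lemma cof_Arr [simp]: "f \<in> cof M \<Longrightarrow> f \<in> Arr M"
  and fib_Arr [simp]: "f \<in> fib M \<Longrightarrow> f \<in> Arr M"
  using cof_subcategory fib_subcategory by (auto simp: wide_subcategory_def)

lemma weq_ident [simp]: "a \<in> Obj M \<Longrightarrow> ident M a \<in> weq M"
  and weq_comp: "f \<in> weq M \<Longrightarrow> g \<in> weq M \<Longrightarrow> Cod M f = Dom M g \<Longrightarrow> g \<cdot> f \<in> weq M"
  and cof_comp: "f \<in> cof M \<Longrightarrow> g \<in> cof M \<Longrightarrow> Cod M f = Dom M g \<Longrightarrow> g \<cdot> f \<in> cof M"
  and fib_comp: "f \<in> fib M \<Longrightarrow> g \<in> fib M \<Longrightarrow> Cod M f = Dom M g \<Longrightarrow> g \<cdot> f \<in> fib M"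
  using weq_subcategory cof_subcategory fib_subcategory by (auto simp: wide_subcategory_def)

lemma init_ob_Obj [simp]: "init_ob M \<in> Obj M"
  and term_ob_Obj [simp]: "term_ob M \<in> Obj M"
  using init_ob term_ob by (simp_all add: initial_def terminal_def)

lemma init_arr_unique: "f \<in> hom M (init_ob M) a \<Longrightarrow> init_arr M a = f"
  and term_arr_unique: "f \<in> hom M a (term_ob M) \<Longrightarrow> term_arr M a = f"
proof -
  assume f: "f \<in> hom M (init_ob M) a"
  then have "a \<in> Obj M" by (auto simp: hom_def)
  then have "\<exists>!g. g \<in> hom M (init_ob M) a" using init_ob by (simp add: initial_def)
  then show "init_arr M a = f" unfolding init_arr_def using f by (rule the1_equality)
next
  assume f: "f \<in> hom M a (term_ob M)"
  then have "a \<in> Obj M" by (auto simp: hom_def)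
  then have "\<exists>!g. g \<in> hom M a (term_ob M)" using term_ob by (simp add: terminal_def)
  then show "term_arr M a = f" unfolding term_arr_def using f by (rule the1_equality)
qed

lemma init_arr_simps [simp]:
  assumes "a \<in> Obj M"
  shows "init_arr M a \<in> Arr M" "Dom M (init_arr M a) = init_ob M" "Cod M (init_arr M a) = a"
    "term_arr M a \<in> Arr M" "Dom M (term_arr M a) = a" "Cod M (term_arr M a) = term_ob M"
proof -
  have "init_arr M a \<in> hom M (init_ob M) a" "term_arr M a \<in> hom M a (term_ob M)"
    using init_ob term_ob assms init_arr_unique term_arr_unique unfolding initial_def terminal_def
    by metis+
  then show "init_arr M a \<in> Arr M" "Dom M (init_arr M a) = init_ob M" "Cod M (init_arr M a) = a"
    "term_arr M a \<in> Arr M" "Dom M (term_arr M a) = a" "Cod M (term_arr M a) = term_ob M"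
    by (simp_all add: hom_def)
qed

lemma cofibrant_Obj [simp]: "cofibrant M a \<Longrightarrow> a \<in> Obj M"
  and fibrant_Obj [simp]: "fibrant M a \<Longrightarrow> a \<in> Obj M"
  by (simp_all add: cofibrant_def fibrant_def)

lemma comp_init_arr: "f \<in> Arr M \<Longrightarrow> f \<cdot> init_arr M (Dom M f) = init_arr M (Cod M f)"
  and term_arr_comp: "f \<in> Arr M \<Longrightarrow> term_arr M (Cod M f) \<cdot> f = term_arr M (Dom M f)"
  by (simp_all add: init_arr_unique[symmetric] term_arr_unique[symmetric] hom_def)

lemma cofibrant_Cod: "f \<in> cof M \<Longrightarrow> cofibrant M (Dom M f) \<Longrightarrow> cofibrant M (Cod M f)"
  unfolding cofibrant_def using cof_comp[of "init_arr M (Dom M f)" f] comp_init_arr[of f] by simp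

lemma fibrant_Dom: "f \<in> fib M \<Longrightarrow> fibrant M (Cod M f) \<Longrightarrow> fibrant M (Dom M f)"
  unfolding fibrant_def using fib_comp[of f "term_arr M (Cod M f)"] term_arr_comp[of f] by simp

lemma fact_simps [simp]:
  assumes "f \<in> Arr M"
  shows "fleft (cof_fact M) f \<in> Arr M" "fright (cof_fact M) f \<in> Arr M"
    "Dom M (fleft (cof_fact M) f) = Dom M f" "Cod M (fright (cof_fact M) f) = Cod M f"
    "Dom M (fright (cof_fact M) f) = Cod M (fleft (cof_fact M) f)"
    "fright (cof_fact M) f \<cdot> fleft (cof_fact M) f = f"
    "fleft (fib_fact M) f \<in> Arr M" "fright (fib_fact M) f \<in> Arr M"
    "Dom M (fleft (fib_fact M) f) = Dom M f" "Cod M (fright (fib_fact M) f) = Cod M f"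
    "Dom M (fright (fib_fact M) f) = Cod M (fleft (fib_fact M) f)"
    "fright (fib_fact M) f \<cdot> fleft (fib_fact M) f = f"
  using cof_fact fib_fact assms by (auto simp: functorial_factorisation_def)

lemma replacement_Obj [simp]: "a \<in> Obj M \<Longrightarrow> Qob a \<in> Obj M" "a \<in> Obj M \<Longrightarrow> Rob a \<in> Obj M"
  by (simp_all add: Qfun_def Rfun_def)

lemma pmap_simps [simp]:
  assumes "a \<in> Obj M"
  shows "pmap M a \<in> weq M" "pmap M a \<in> fib M" "Dom M (pmap M a) = Qob a" "Cod M (pmap M a) = a"
  using assms cof_fact_right[of "init_arr M a"] by (simp_all add: pmap_def Qfun_def)

lemma qmap_simps [simp]:
  assumes "a \<in> Obj M"
  shows "qmap M a \<in> weq M" "qmap M a \<in> cof M" "Dom M (qmap M a) = a" "Cod M (qmap M a) = Rob a"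
  using assms fib_fact_left[of "term_arr M a"] by (simp_all add: qmap_def Rfun_def)

lemma cofibrant_Q [simp]:
  assumes "a \<in> Obj M"
  shows "cofibrant M (Qob a)"
proof -
  have "init_arr M (Qob a) = fleft (cof_fact M) (init_arr M a)"
    using assms by (intro init_arr_unique) (simp add: hom_def Qfun_def)
  then show ?thesis using assms by (simp add: cofibrant_def cof_fact_left)
qed

lemma fibrant_R [simp]:
  assumes "a \<in> Obj M"
  shows "fibrant M (Rob a)"
proof -
  have "term_arr M (Rob a) = fright (fib_fact M) (term_arr M a)"
    using assms by (intro term_arr_unique) (simp add: hom_def Rfun_def)
  then show ?thesis using assms by (simp add: fibrant_def fib_fact_right)
qed

lemma cofibrant_R [simp]: "cofibrant M a \<Longrightarrow> cofibrant M (Rob a)"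
  using cofibrant_Cod[of "qmap M a"] by simp

lemma Qar_square:
  "f \<in> Arr M \<Longrightarrow>
    comm_square M (init_arr M (Dom M f)) (init_arr M (Cod M f)) (ident M (init_ob M)) f"
  and Rar_square:
  "f \<in> Arr M \<Longrightarrow>
    comm_square M (term_arr M (Dom M f)) (term_arr M (Cod M f)) f (ident M (term_ob M))"
  by (simp_all add: comm_square_def hom_def comp_init_arr term_arr_comp)

lemma Qar_simps [simp]:
  assumes "f \<in> Arr M"
  shows "Qar f \<in> Arr M" "Dom M (Qar f) = Qob (Dom M f)" "Cod M (Qar f) = Qob (Cod M f)"
    and pmap_natural: "pmap M (Cod M f) \<cdot> Qar f = f \<cdot> pmap M (Dom M f)"
  using fmid_square[OF cof_fact Qar_square[OF assms], THEN conjunct2] assms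
  by (auto simp: Qfun_def pmap_def comm_square_def hom_def)

lemma Rar_simps [simp]:
  assumes "f \<in> Arr M"
  shows "Rar f \<in> Arr M" "Dom M (Rar f) = Rob (Dom M f)" "Cod M (Rar f) = Rob (Cod M f)"
    and qmap_natural: "Rar f \<cdot> qmap M (Dom M f) = qmap M (Cod M f) \<cdot> f"
  using fmid_square[OF fib_fact Rar_square[OF assms], THEN conjunct1] assms
  by (auto simp: Rfun_def qmap_def comm_square_def hom_def)

lemma replacement_ident [simp]:
  "a \<in> Obj M \<Longrightarrow> Qar (ident M a) = ident M (Qob a)"
  "a \<in> Obj M \<Longrightarrow> Rar (ident M a) = ident M (Rob a)"
  using fmid_ident[OF cof_fact, of "init_arr M a"] fmid_ident[OF fib_fact, of "term_arr M a"]
  by (simp_all add: Qfun_def Rfun_def)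

lemma Qar_comp:
  "f \<in> Arr M \<Longrightarrow> g \<in> Arr M \<Longrightarrow> Cod M f = Dom M g \<Longrightarrow> Qar (g \<cdot> f) = Qar g \<cdot> Qar f"
  using fmid_comp[OF cof_fact, of "init_arr M (Dom M f)" "init_arr M (Cod M f)"
      "ident M (init_ob M)" f "init_arr M (Cod M g)" "ident M (init_ob M)" g]
    Qar_square[of f] Qar_square[of g]
  by (simp add: Qfun_def)

lemma Rar_comp:
  "f \<in> Arr M \<Longrightarrow> g \<in> Arr M \<Longrightarrow> Cod M f = Dom M g \<Longrightarrow> Rar (g \<cdot> f) = Rar g \<cdot> Rar f"
  using fmid_comp[OF fib_fact, of "term_arr M (Dom M f)" "term_arr M (Cod M f)"
      f "ident M (term_ob M)" "term_arr M (Cod M g)" g "ident M (term_ob M)"]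
    Rar_square[of f] Rar_square[of g]
  by (simp add: Rfun_def)

lemma Qar_weq [simp]:
  assumes "f \<in> weq M"
  shows "Qar f \<in> weq M"
  using assms pmap_natural[of f] weq_comp[of "pmap M (Dom M f)" f]
  by (intro two_of_three_left[of "Qar f" "pmap M (Cod M f)"]) simp_all

lemma Rar_weq [simp]:
  assumes "f \<in> weq M"
  shows "Rar f \<in> weq M"
  using assms qmap_natural[of f] weq_comp[of f "qmap M (Cod M f)"]
  by (intro two_of_three_right[of "qmap M (Dom M f)" "Rar f"]) simp_all


section \<open>Functors inverting trivial fibrations\<close>

lemma trivial_cof_retraction:
  assumes "f \<in> cof M \<inter> weq M" "fibrant M (Dom M f)"
  obtains r where "r \<in> Arr M" "Dom M r = Cod M f" "Cod M r = Dom M f" "r \<cdot> f = ident M (Dom M f)"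
proof -
  have "has_lifting M f (term_arr M (Dom M f))"
    using assms by (auto intro: lifting_trivial_cof simp: fibrant_def)
  moreover have "comm_square M f (term_arr M (Dom M f)) (ident M (Dom M f)) (term_arr M (Cod M f))"
    using assms by (simp add: comm_square_def hom_def term_arr_comp)
  ultimately show ?thesis
    using that assms by (auto simp: has_lifting_def hom_def)
qed

text \<open>Since the domain of \<open>f\<close> is fibrant, \<open>f\<close> has a retraction \<open>r\<close>; factor \<open>r = t \<cdot> g\<close> as a trivial cofibration
  followed by a fibration.  By two-out-of-three \<open>t\<close> is a trivial fibration, and \<open>t \<cdot> (g \<cdot> f)\<close> is an
  identity, so \<open>F\<close> inverts \<open>g \<cdot> f\<close>.  The same argument for \<open>g\<close> gives a trivial cofibration \<open>h\<close> such
  that \<open>F\<close> inverts \<open>h \<cdot> g\<close>, and two-out-of-six for isomorphisms applies.\<close>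

lemma trivial_cof_iso:
  assumes F: "is_functor M K F"
    and tfib: "\<And>t. t \<in> fib M \<inter> weq M \<Longrightarrow> is_iso K (AMap F t)"
    and f: "f \<in> cof M \<inter> weq M" "fibrant M (Dom M f)" "fibrant M (Cod M f)"
  shows "is_iso K (AMap F f)"
proof -
  interpret K: category K using F by (simp add: is_functor_def)
  have [simp]: "AMap F g \<in> Arr K" "Dom K (AMap F g) = OMap F (Dom M g)"
    "Cod K (AMap F g) = OMap F (Cod M g)" if "g \<in> Arr M" for g
    using F that by (simp_all add: is_functor_def hom_def)
  have F_comp: "AMap F (h \<cdot> g) = AMap F h \<cdot>\<^bsub>K\<^esub> AMap F g"
    if "g \<in> Arr M" "h \<in> Arr M" "Cod M g = Dom M h" for g h
    using F that by (simp add: is_functor_def)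
  have F_ident: "AMap F (ident M a) = ident K (OMap F a)" "OMap F a \<in> Obj K" if "a \<in> Obj M" for a
    using F that by (simp_all add: is_functor_def)
  have step: "\<exists>g. g \<in> cof M \<inter> weq M \<and> Dom M g = Cod M f \<and> fibrant M (Cod M g)
      \<and> is_iso K (AMap F (g \<cdot> f))"
    if f: "f \<in> cof M \<inter> weq M" "fibrant M (Dom M f)" "fibrant M (Cod M f)" for f
  proof -
    obtain r where r: "r \<in> Arr M" "Dom M r = Cod M f" "Cod M r = Dom M f" "r \<cdot> f = ident M (Dom M f)"
      using trivial_cof_retraction f(1,2) by blast
    define g where "g = fleft (fib_fact M) r"
    define t where "t = fright (fib_fact M) r"
    have g: "g \<in> cof M" "g \<in> weq M" "Dom M g = Cod M f"
      and t: "t \<in> fib M" "Dom M t = Cod M g" "Cod M t = Dom M f" "t \<cdot> g = r"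
      using r fib_fact_left[of r] fib_fact_right[of r] by (simp_all add: g_def t_def)
    have "r \<in> weq M" using f r two_of_three_right[of f r] by simp
    then have "t \<in> weq M" using g t two_of_three_right[of g t] by simp
    have "t \<cdot> (g \<cdot> f) = ident M (Dom M f)" using f g t r by (simp flip: assoc)
    then have "AMap F t \<cdot>\<^bsub>K\<^esub> AMap F (g \<cdot> f) = ident K (OMap F (Dom M f))"
      using f g t by (simp add: F_ident flip: F_comp)
    then have "is_iso K (AMap F (g \<cdot> f))"
      using tfib[of t] f g t \<open>t \<in> weq M\<close> F_ident
        K.is_iso_cancel_left[of "AMap F t" "AMap F (g \<cdot> f)"] by simp
    then show ?thesis
      using f g t fibrant_Dom[of t] by auto
  qed
  obtain g where g: "g \<in> cof M \<inter> weq M" "Dom M g = Cod M f" "fibrant M (Cod M g)"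
      "is_iso K (AMap F (g \<cdot> f))"
    using step f by blast
  obtain h where h: "h \<in> cof M \<inter> weq M" "Dom M h = Cod M g" "is_iso K (AMap F (h \<cdot> g))"
    using step[of g] f g by auto
  show ?thesis
    by (rule K.is_iso_two_of_six[of "AMap F g" _ "AMap F h"])
      (use f g h in \<open>simp_all flip: F_comp\<close>)
qed

text \<open>A weak equivalence factors as a trivial cofibration followed by a fibration that is again a weak
  equivalence, and the intermediate object is fibrant if the codomain is.\<close>

lemma Ken_Brown:
  assumes F: "is_functor M K F"
    and tfib: "\<And>t. t \<in> fib M \<inter> weq M \<Longrightarrow> is_iso K (AMap F t)"
    and f: "f \<in> weq M" "fibrant M (Dom M f)" "fibrant M (Cod M f)"
  shows "is_iso K (AMap F f)"
proof -
  interpret K: category K using F by (simp add: is_functor_def)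
  define g where "g = fleft (fib_fact M) f"
  define t where "t = fright (fib_fact M) f"
  have g: "g \<in> cof M" "g \<in> weq M" "Dom M g = Dom M f"
    and t: "t \<in> fib M" "Dom M t = Cod M g" "Cod M t = Cod M f" "t \<cdot> g = f"
    using f fib_fact_left[of f] fib_fact_right[of f] by (simp_all add: g_def t_def)
  have "t \<in> weq M" using f g t two_of_three_right[of g t] by simp
  moreover have "fibrant M (Cod M g)" using f t fibrant_Dom[of t] by simp
  ultimately have "is_iso K (AMap F t)" "is_iso K (AMap F g)"
    using f g t tfib trivial_cof_iso[OF F tfib, of g] by simp_all
  moreover have "AMap F (t \<cdot> g) = AMap F t \<cdot>\<^bsub>K\<^esub> AMap F g" "Cod K (AMap F g) = Dom K (AMap F t)"
    using F g(1) t(1,2) by (simp_all add: is_functor_def hom_def)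
  ultimately show ?thesis using t(4) K.is_iso_comp[of "AMap F g" "AMap F t"] by simp
qed

end

section \<open>Naturality over the localisation\<close>

lemma (in category) square_comp:
  assumes "t' \<cdot> a = b \<cdot> t" "t'' \<cdot> a' = b' \<cdot> t'"
    and "t \<in> Arr C" "t' \<in> Arr C" "t'' \<in> Arr C" "a \<in> Arr C" "b \<in> Arr C" "a' \<in> Arr C" "b' \<in> Arr C"
    and "Cod C a = Dom C t'" "Cod C t = Dom C b" "Cod C a' = Dom C t''" "Cod C t' = Dom C b'"
      "Cod C a = Dom C a'" "Cod C b = Dom C b'"
  shows "t'' \<cdot> (a' \<cdot> a) = (b' \<cdot> b) \<cdot> t"
proof -
  have "t'' \<cdot> (a' \<cdot> a) = (t'' \<cdot> a') \<cdot> a" using assms(3-) by (simp add: assoc)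
  also have "\<dots> = b' \<cdot> (t' \<cdot> a)" unfolding assms(2) using assms(3-) by (simp add: assoc)
  also have "\<dots> = (b' \<cdot> b) \<cdot> t" unfolding assms(1) using assms(3-) by (simp add: assoc)
  finally show ?thesis .
qed

lemma (in category) square_inv:
  assumes "t' \<cdot> a = b \<cdot> t" "is_iso C a" "is_iso C b" "t \<in> Arr C" "t' \<in> Arr C"
    "Dom C t = Dom C a" "Dom C t' = Cod C a" "Cod C t = Dom C b" "Cod C t' = Cod C b"
  shows "t \<cdot> inv_arr C a = inv_arr C b \<cdot> t'"
proof (rule iso_cancel_left[of b])
  have "b \<cdot> (t \<cdot> inv_arr C a) = (b \<cdot> t) \<cdot> inv_arr C a"
    using assms(2-) by (simp add: assoc is_iso_Arr)
  also have "\<dots> = t'" unfolding assms(1)[symmetric] using assms(2-) by (simp add: assoc is_iso_Arr)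
  finally show "b \<cdot> (t \<cdot> inv_arr C a) = b \<cdot> (inv_arr C b \<cdot> t')" using assms(2-) by simp
qed (use assms in \<open>simp_all add: is_iso_Arr\<close>)

lemma functor_inv:
  assumes "is_functor A B F" "is_iso A f"
  shows is_iso_functor: "is_iso B (AMap F f)" and functor_inv_arr: "AMap F (inv_arr A f) = inv_arr B (AMap F f)"
proof -
  interpret A: category A using assms by (simp add: is_functor_def)
  interpret B: category B using assms by (simp add: is_functor_def)
  have F: "AMap F g \<in> Arr B \<and> Dom B (AMap F g) = OMap F (Dom A g)
      \<and> Cod B (AMap F g) = OMap F (Cod A g)" if "g \<in> Arr A" for g
    using assms(1) that by (simp add: is_functor_def hom_def)
  have "AMap F (inv_arr A f) \<cdot>\<^bsub>B\<^esub> AMap F f = AMap F (inv_arr A f \<cdot>\<^bsub>A\<^esub> f)"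
    "AMap F f \<cdot>\<^bsub>B\<^esub> AMap F (inv_arr A f) = AMap F (f \<cdot>\<^bsub>A\<^esub> inv_arr A f)"
    using assms by (simp_all add: is_functor_def A.is_iso_Arr del: A.inv_arr_comp A.comp_inv_arr)
  moreover have "AMap F (ident A a) = ident B (OMap F a)" if "a \<in> Obj A" for a
    using assms(1) that by (simp add: is_functor_def)
  ultimately show "is_iso B (AMap F f)" "AMap F (inv_arr A f) = inv_arr B (AMap F f)"
    using F[of f] F[of "inv_arr A f"] assms(2)
    by (auto simp: A.is_iso_Arr intro!: B.is_isoI[of _ "AMap F (inv_arr A f)"] B.inv_arr_eqI[symmetric])
qed

text \<open>Naturality squares can be pasted, and inverted when the arrow is invertible, so it suffices to
  check them on the arrows of \<open>M\<close>.\<close>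

lemma (in model_category) Ho_natural:
  assumes F: "is_functor (Ho M) K F" and G: "is_functor (Ho M) K G"
    and \<tau>: "\<And>a. a \<in> Obj M \<Longrightarrow> \<tau> a \<in> hom K (OMap F a) (OMap G a)"
    and nat: "\<And>f. f \<in> Arr M \<Longrightarrow>
      \<tau> (Cod M f) \<cdot>\<^bsub>K\<^esub> AMap F (ho_arr M f) = AMap G (ho_arr M f) \<cdot>\<^bsub>K\<^esub> \<tau> (Dom M f)"
    and \<phi>: "\<phi> \<in> Arr (Ho M)"
  shows "\<tau> (Cod (Ho M) \<phi>) \<cdot>\<^bsub>K\<^esub> AMap F \<phi> = AMap G \<phi> \<cdot>\<^bsub>K\<^esub> \<tau> (Dom (Ho M) \<phi>)"
  using \<phi>
proof (induction \<phi> rule: Ho_induct)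
  case (ho f)
  then show ?case by (simp add: nat)
next
  case (inv \<phi>)
  interpret K: category K using F by (simp add: is_functor_def)
  have [simp]: "\<phi> \<in> Arr (Ho M)" using inv by (simp add: Ho.is_iso_Arr)
  show ?case
    using inv F G \<tau>[of "Dom (Ho M) \<phi>"] \<tau>[of "Cod (Ho M) \<phi>"]
    by (auto simp: functor_inv_arr[OF F] functor_inv_arr[OF G] hom_def is_functor_def
        intro!: K.square_inv is_iso_functor[OF F] is_iso_functor[OF G])
next
  case (comp \<phi> \<psi>)
  interpret K: category K using F by (simp add: is_functor_def)
  have eq: "AMap F (\<psi> \<cdot>\<^bsub>Ho M\<^esub> \<phi>) = AMap F \<psi> \<cdot>\<^bsub>K\<^esub> AMap F \<phi>"
    "AMap G (\<psi> \<cdot>\<^bsub>Ho M\<^esub> \<phi>) = AMap G \<psi> \<cdot>\<^bsub>K\<^esub> AMap G \<phi>"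
    using F G comp by (simp_all add: is_functor_def)
  have hom: "AMap F \<chi> \<in> hom K (OMap F (Dom (Ho M) \<chi>)) (OMap F (Cod (Ho M) \<chi>))"
    "AMap G \<chi> \<in> hom K (OMap G (Dom (Ho M) \<chi>)) (OMap G (Cod (Ho M) \<chi>))"
    if "\<chi> \<in> Arr (Ho M)" for \<chi>
    using F G that by (simp_all add: is_functor_def)
  show ?case
    using comp hom[of \<phi>] hom[of \<psi>] \<tau>[of "Dom (Ho M) \<phi>"] \<tau>[of "Cod (Ho M) \<phi>"] \<tau>[of "Cod (Ho M) \<psi>"]
      K.square_comp[of "\<tau> (Cod (Ho M) \<phi>)" "AMap F \<phi>" "AMap G \<phi>" "\<tau> (Dom (Ho M) \<phi>)"
        "\<tau> (Cod (Ho M) \<psi>)" "AMap F \<psi>" "AMap G \<psi>"]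
    by (simp add: eq hom_def)
qed


lemma is_functor_comp_func:
  assumes "is_functor A B F" "is_functor B D G"
  shows "is_functor A D (comp_func G F)"
  using assms by (simp add: is_functor_def comp_func_def hom_def)

lemma (in internal_hom) is_functor_co:
  "a \<in> Obj C \<Longrightarrow> is_functor C C \<lparr>OMap = hob H a, AMap = harr H (ident C a)\<rparr>"
  by (simp add: is_functor_def hom_def category_axioms harr_comp)

lemma (in internal_hom) is_functor_contra:
  "b \<in> Obj C \<Longrightarrow>
    is_functor C (opp C) \<lparr>OMap = \<lambda>a. hob H a b, AMap = \<lambda>f. harr H f (ident C b)\<rparr>"
  by (simp add: is_functor_def hom_def category_axioms category_opp harr_comp)

lemma (in internal_hom) harr_factor:
  assumes "f \<in> Arr C" "g \<in> Arr C"
  shows "harr H f g = harr H f (ident C (Cod C g)) \<cdot> harr H (ident C (Cod C f)) g"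
  using assms by (simp add: harr_comp)

lemma (in model_category) Ho_natural_bifunctor:
  assumes F: "internal_hom (Ho M) F" and G: "internal_hom (Ho M) G"
    and \<tau>: "\<And>a b. a \<in> Obj M \<Longrightarrow> b \<in> Obj M \<Longrightarrow> \<tau> a b \<in> hom (Ho M) (hob F a b) (hob G a b)"
    and nat: "\<And>f g. f \<in> Arr M \<Longrightarrow> g \<in> Arr M \<Longrightarrow>
      \<tau> (Dom M f) (Cod M g) \<cdot>\<^bsub>Ho M\<^esub> harr F (ho_arr M f) (ho_arr M g)
      = harr G (ho_arr M f) (ho_arr M g) \<cdot>\<^bsub>Ho M\<^esub> \<tau> (Cod M f) (Dom M g)"
    and \<phi>: "\<phi> \<in> Arr (Ho M)" and \<psi>: "\<psi> \<in> Arr (Ho M)"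
  shows "\<tau> (Dom (Ho M) \<phi>) (Cod (Ho M) \<psi>) \<cdot>\<^bsub>Ho M\<^esub> harr F \<phi> \<psi>
      = harr G \<phi> \<psi> \<cdot>\<^bsub>Ho M\<^esub> \<tau> (Cod (Ho M) \<phi>) (Dom (Ho M) \<psi>)"
proof -
  interpret F: internal_hom "Ho M" F by fact
  interpret G: internal_hom "Ho M" G by fact
  note [simp] = F.hob_Obj[simplified] G.hob_Obj[simplified]
  have \<tau>' [simp]: "\<tau> a b \<in> Arr (Ho M)" "Dom (Ho M) (\<tau> a b) = hob F a b"
    "Cod (Ho M) (\<tau> a b) = hob G a b" if "a \<in> Obj M" "b \<in> Obj M" for a b
    using \<tau>[OF that] by (simp_all add: hom_def)
  have co: "\<tau> a (Cod (Ho M) \<psi>) \<cdot>\<^bsub>Ho M\<^esub> harr F (ident (Ho M) a) \<psi>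
      = harr G (ident (Ho M) a) \<psi> \<cdot>\<^bsub>Ho M\<^esub> \<tau> a (Dom (Ho M) \<psi>)" if a: "a \<in> Obj M" for a
    using Ho_natural[of "Ho M" "\<lparr>OMap = hob F a, AMap = harr F (ident (Ho M) a)\<rparr>"
        "\<lparr>OMap = hob G a, AMap = harr G (ident (Ho M) a)\<rparr>" "\<tau> a" \<psi>]
      F.is_functor_co[of a] G.is_functor_co[of a] \<tau> \<psi> a nat[of "ident M a"] by simp
  have contra: "\<tau> (Dom (Ho M) \<phi>) b \<cdot>\<^bsub>Ho M\<^esub> harr F \<phi> (ident (Ho M) b)
      = harr G \<phi> (ident (Ho M) b) \<cdot>\<^bsub>Ho M\<^esub> \<tau> (Cod (Ho M) \<phi>) b" if b: "b \<in> Obj M" for b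
    using Ho_natural[of "opp (Ho M)"
        "\<lparr>OMap = \<lambda>a. hob G a b, AMap = \<lambda>f. harr G f (ident (Ho M) b)\<rparr>"
        "\<lparr>OMap = \<lambda>a. hob F a b, AMap = \<lambda>f. harr F f (ident (Ho M) b)\<rparr>" "\<lambda>a. \<tau> a b" \<phi>]
      F.is_functor_contra[of b] G.is_functor_contra[of b] \<phi> b nat[of _ "ident M b"]
    by (simp add: hom_def)
  show ?thesis
    unfolding F.harr_factor[OF \<phi> \<psi>] G.harr_factor[OF \<phi> \<psi>]
    using \<phi> \<psi> by (intro Ho.square_comp[OF co contra]) simp_all
qed


section \<open>The derived internal hom\<close>

locale axiom_C_category = model_category M + internal_hom M H
  for M :: "('o, 'm, 'x) model_cat_scheme" (structure) and H :: "('o, 'm) bifunc" +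
  fixes I :: 'o
  assumes axiom_C: "axiom_C M H I"
begin

lemma is_functor_Loc2:
  "is_functor (prod_cat (opp M) M) (prod_cat (opp (Ho M)) (Ho M)) (prod_func (Loc M) (Loc M))"
  using is_functor_Loc category_opp[of M] category_opp[of "Ho M"]
    category_prod_cat[of "opp M" M] category_prod_cat[of "opp (Ho M)" "Ho M"]
  by (auto simp: is_functor_def prod_func_def hom_def)

abbreviation Ho_comp (infixr "\<star>" 70) where "\<phi> \<star> \<psi> \<equiv> \<phi> \<cdot>\<^bsub>Ho M\<^esub> \<psi>"

lemma cofibrant_unit [simp]: "cofibrant M I"
  using axiom_C by (simp add: axiom_C_def)

lemma fibrant_hob [simp]: "cofibrant M a \<Longrightarrow> fibrant M b \<Longrightarrow> fibrant M (hob H a b)"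
  using axiom_C by (simp add: axiom_C_def)

lemma harr_tfib:
  "cofibrant M a \<Longrightarrow> f \<in> fib M \<inter> weq M \<Longrightarrow> harr H (ident M a) f \<in> fib M \<inter> weq M"
  using axiom_C by (simp add: axiom_C_def)

lemma harr_weq_left:
  "f \<in> weq M \<Longrightarrow> cofibrant M (Dom M f) \<Longrightarrow> cofibrant M (Cod M f) \<Longrightarrow> fibrant M b \<Longrightarrow>
    harr H f (ident M b) \<in> weq M"
  using axiom_C by (simp add: axiom_C_def)

text \<open>The functor \<open>[a, -]\<close> is only assumed to preserve trivial fibrations, so this needs Ken Brown's
  argument.\<close>

lemma harr_iso_right:
  assumes "cofibrant M a" "f \<in> weq M" "fibrant M (Dom M f)" "fibrant M (Cod M f)"
  shows "is_iso (Ho M) (ho_arr M (harr H (ident M a) f))"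
proof -
  let ?F = "\<lparr>OMap = hob H a, AMap = \<lambda>f. ho_arr M (harr H (ident M a) f)\<rparr>"
  have "is_functor M (Ho M) ?F"
    unfolding is_functor_def using assms(1)
    by (simp add: hom_def category_axioms Ho.category_axioms harr_comp flip: ho_arr_comp)
  then show ?thesis
    using Ken_Brown[of "Ho M" ?F f] assms harr_tfib[of a] by simp
qed

lemma harr_iso:
  assumes "f \<in> weq M" "cofibrant M (Dom M f)" "cofibrant M (Cod M f)"
    and "g \<in> weq M" "fibrant M (Dom M g)" "fibrant M (Cod M g)"
  shows "is_iso (Ho M) (ho_arr M (harr H f g))"
proof -
  have "harr H f g = harr H f (ident M (Cod M g)) \<cdot> harr H (ident M (Cod M f)) g"
    using assms by (simp add: harr_comp)
  then have "ho_arr M (harr H f g)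
      = ho_arr M (harr H f (ident M (Cod M g))) \<star> ho_arr M (harr H (ident M (Cod M f)) g)"
    using assms by (simp add: ho_arr_comp)
  then show ?thesis
    using assms harr_iso_right[of "Cod M f" g] harr_weq_left[of f "Cod M g"]
    by (simp add: Ho.is_iso_comp)
qed

text \<open>Localising \<open>M\<^sup>o\<^sup>p \<times> M\<close> is done one variable at a time: the functors \<open>[Q -, R b]\<close> and \<open>[Q a, R -]\<close>
  are extended to \<open>Ho M\<close> separately, and the two extensions are then shown to commute.\<close>

definition contra_part :: "'o \<Rightarrow> ('o, 'm, 'o, 'o \<times> 'o \<times> 'm step list set) func" where
  "contra_part b = \<lparr>OMap = \<lambda>a. hob H (Qob a) (Rob b),
     AMap = \<lambda>f. ho_arr M (harr H (Qar f) (ident M (Rob b)))\<rparr>"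

definition co_part :: "'o \<Rightarrow> ('o, 'm, 'o, 'o \<times> 'o \<times> 'm step list set) func" where
  "co_part a = \<lparr>OMap = \<lambda>b. hob H (Qob a) (Rob b),
     AMap = \<lambda>g. ho_arr M (harr H (ident M (Qob a)) (Rar g))\<rparr>"

definition Ho_contra :: "'o \<Rightarrow> _" where "Ho_contra b = Ho_ext M (opp (Ho M)) (contra_part b)"
definition Ho_co :: "'o \<Rightarrow> _" where "Ho_co a = Ho_ext M (Ho M) (co_part a)"

lemma inverting_contra:
  assumes "b \<in> Obj M"
  shows "inverting_functor M (opp (Ho M)) (contra_part b)"
proof -
  interpret op: category "opp (Ho M)" by (rule category_opp) (rule Ho.category_axioms)
  show ?thesis
  proof
    show "is_functor M (opp (Ho M)) (contra_part b)"
      unfolding is_functor_def using assms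
      by (simp add: contra_part_def hom_def category_axioms op.category_axioms Qar_comp harr_comp
          flip: ho_arr_comp)
    show "is_iso (opp (Ho M)) (AMap (contra_part b) f)" if "f \<in> weq M" for f
      using that assms by (simp add: contra_part_def harr_weq_left)
  qed
qed

lemma inverting_co:
  assumes "a \<in> Obj M"
  shows "inverting_functor M (Ho M) (co_part a)"
proof
  show "is_functor M (Ho M) (co_part a)"
    unfolding is_functor_def using assms
    by (simp add: co_part_def hom_def category_axioms Ho.category_axioms Rar_comp harr_comp
        flip: ho_arr_comp)
  show "is_iso (Ho M) (AMap (co_part a) f)" if "f \<in> weq M" for f
    using that assms by (simp add: co_part_def harr_iso_right)
qed

lemma Ho_contra:
  assumes "b \<in> Obj M"
  shows is_functor_Ho_contra: "is_functor (Ho M) (opp (Ho M)) (Ho_contra b)"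
    and Ho_contra_ob [simp]: "OMap (Ho_contra b) a = hob H (Qob a) (Rob b)"
    and Ho_contra_ho_arr [simp]: "f \<in> Arr M \<Longrightarrow>
      AMap (Ho_contra b) (ho_arr M f) = ho_arr M (harr H (Qar f) (ident M (Rob b)))"
proof -
  interpret inverting_functor M "opp (Ho M)" "contra_part b" by (rule inverting_contra) fact
  show "is_functor (Ho M) (opp (Ho M)) (Ho_contra b)"
    "OMap (Ho_contra b) a = hob H (Qob a) (Rob b)"
    "f \<in> Arr M \<Longrightarrow> AMap (Ho_contra b) (ho_arr M f) = ho_arr M (harr H (Qar f) (ident M (Rob b)))"
    unfolding Ho_contra_def using is_functor_Ho_ext
    by (simp_all, simp_all add: contra_part_def)
qed

lemma Ho_co:
  assumes "a \<in> Obj M"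
  shows is_functor_Ho_co: "is_functor (Ho M) (Ho M) (Ho_co a)"
    and Ho_co_ob [simp]: "OMap (Ho_co a) b = hob H (Qob a) (Rob b)"
    and Ho_co_ho_arr [simp]: "g \<in> Arr M \<Longrightarrow>
      AMap (Ho_co a) (ho_arr M g) = ho_arr M (harr H (ident M (Qob a)) (Rar g))"
proof -
  interpret inverting_functor M "Ho M" "co_part a" by (rule inverting_co) fact
  show "is_functor (Ho M) (Ho M) (Ho_co a)"
    "OMap (Ho_co a) b = hob H (Qob a) (Rob b)"
    "g \<in> Arr M \<Longrightarrow> AMap (Ho_co a) (ho_arr M g) = ho_arr M (harr H (ident M (Qob a)) (Rar g))"
    unfolding Ho_co_def using is_functor_Ho_ext
    by (simp_all, simp_all add: co_part_def)
qed

lemma Ho_contra_simps [simp]: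
  assumes "b \<in> Obj M"
  shows "\<phi> \<in> Arr (Ho M) \<Longrightarrow> AMap (Ho_contra b) \<phi> \<in> Arr (Ho M)"
    "\<phi> \<in> Arr (Ho M) \<Longrightarrow> Dom (Ho M) (AMap (Ho_contra b) \<phi>) = hob H (Qob (Cod (Ho M) \<phi>)) (Rob b)"
    "\<phi> \<in> Arr (Ho M) \<Longrightarrow> Cod (Ho M) (AMap (Ho_contra b) \<phi>) = hob H (Qob (Dom (Ho M) \<phi>)) (Rob b)"
    "a \<in> Obj M \<Longrightarrow> AMap (Ho_contra b) (ident (Ho M) a) = ident (Ho M) (hob H (Qob a) (Rob b))"
    "\<phi> \<in> Arr (Ho M) \<Longrightarrow> \<psi> \<in> Arr (Ho M) \<Longrightarrow> Cod (Ho M) \<phi> = Dom (Ho M) \<psi> \<Longrightarrow>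
      AMap (Ho_contra b) (\<psi> \<star> \<phi>) = AMap (Ho_contra b) \<phi> \<star> AMap (Ho_contra b) \<psi>"
  using is_functor_Ho_contra[OF assms] assms by (simp_all add: is_functor_def hom_def)

lemma Ho_co_simps [simp]:
  assumes "a \<in> Obj M"
  shows "\<phi> \<in> Arr (Ho M) \<Longrightarrow> AMap (Ho_co a) \<phi> \<in> Arr (Ho M)"
    "\<phi> \<in> Arr (Ho M) \<Longrightarrow> Dom (Ho M) (AMap (Ho_co a) \<phi>) = hob H (Qob a) (Rob (Dom (Ho M) \<phi>))"
    "\<phi> \<in> Arr (Ho M) \<Longrightarrow> Cod (Ho M) (AMap (Ho_co a) \<phi>) = hob H (Qob a) (Rob (Cod (Ho M) \<phi>))"
    "b \<in> Obj M \<Longrightarrow> AMap (Ho_co a) (ident (Ho M) b) = ident (Ho M) (hob H (Qob a) (Rob b))"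
    "\<phi> \<in> Arr (Ho M) \<Longrightarrow> \<psi> \<in> Arr (Ho M) \<Longrightarrow> Cod (Ho M) \<phi> = Dom (Ho M) \<psi> \<Longrightarrow>
      AMap (Ho_co a) (\<psi> \<star> \<phi>) = AMap (Ho_co a) \<psi> \<star> AMap (Ho_co a) \<phi>"
  using is_functor_Ho_co[OF assms] assms by (simp_all add: is_functor_def hom_def)

text \<open>The two extensions commute on arrows of \<open>M\<close> by bifunctoriality of \<open>H\<close>.  With one arrow of \<open>M\<close>
  fixed, its action is a transformation between extended functors of the other variable, hence
  natural over all of \<open>Ho M\<close>; then the roles are exchanged.\<close>

lemma interchange:
  assumes \<phi>: "\<phi> \<in> Arr (Ho M)" and \<psi>: "\<psi> \<in> Arr (Ho M)"
  shows "AMap (Ho_co (Dom (Ho M) \<phi>)) \<psi> \<star> AMap (Ho_contra (Dom (Ho M) \<psi>)) \<phi>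
       = AMap (Ho_contra (Cod (Ho M) \<psi>)) \<phi> \<star> AMap (Ho_co (Cod (Ho M) \<phi>)) \<psi>"
proof -
  have ho: "AMap (Ho_co (Dom M f)) \<psi> \<star> ho_arr M (harr H (Qar f) (ident M (Rob (Dom (Ho M) \<psi>))))
       = ho_arr M (harr H (Qar f) (ident M (Rob (Cod (Ho M) \<psi>)))) \<star> AMap (Ho_co (Cod M f)) \<psi>"
    if "f \<in> Arr M" for f
    using that
    by (intro Ho_natural[symmetric, of "Ho M" "Ho_co (Cod M f)" "Ho_co (Dom M f)"
          "\<lambda>b. ho_arr M (harr H (Qar f) (ident M (Rob b)))", OF _ _ _ _ \<psi>])
      (simp_all add: is_functor_Ho_co hom_def harr_comp flip: ho_arr_comp)
  show ?thesis
    using Ho_natural[of "opp (Ho M)" "Ho_contra (Cod (Ho M) \<psi>)" "Ho_contra (Dom (Ho M) \<psi>)"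
        "\<lambda>a. AMap (Ho_co a) \<psi>", OF _ _ _ _ \<phi>] \<psi> ho
    by (simp add: is_functor_Ho_contra hom_def)
qed

definition Hr :: "('o, 'o \<times> 'o \<times> 'm step list set) bifunc" where
  "Hr = \<lparr>OMap = \<lambda>(a, b). hob H (Qob a) (Rob b),
     AMap = \<lambda>(\<phi>, \<psi>). AMap (Ho_co (Dom (Ho M) \<phi>)) \<psi> \<star> AMap (Ho_contra (Dom (Ho M) \<psi>)) \<phi>\<rparr>"

lemma hob_Hr: "hob Hr a b = hob H (Qob a) (Rob b)"
  by (simp add: Hr_def)

lemma harr_Hr:
  "harr Hr \<phi> \<psi> = AMap (Ho_co (Dom (Ho M) \<phi>)) \<psi> \<star> AMap (Ho_contra (Dom (Ho M) \<psi>)) \<phi>"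
  by (simp add: Hr_def)

lemma harr_Hr_ho_arr:
  "f \<in> Arr M \<Longrightarrow> g \<in> Arr M \<Longrightarrow>
    harr Hr (ho_arr M f) (ho_arr M g) = ho_arr M (harr H (Qar f) (Rar g))"
  by (simp add: harr_Hr harr_comp flip: ho_arr_comp)

lemma internal_hom_Hr: "internal_hom (Ho M) Hr"
proof (rule internal_homI)
  fix f g f' g'
  assume A: "f \<in> Arr (Ho M)" "g \<in> Arr (Ho M)" "f' \<in> Arr (Ho M)" "g' \<in> Arr (Ho M)"
    "Cod (Ho M) f = Dom (Ho M) f'" "Cod (Ho M) g' = Dom (Ho M) g"
  let ?co = "\<lambda>a \<psi>. AMap (Ho_co a) \<psi>" and ?contra = "\<lambda>b \<phi>. AMap (Ho_contra b) \<phi>"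
  let ?a = "Dom (Ho M) f" and ?b = "Dom (Ho M) g'"
  have "harr Hr (f' \<star> f) (g \<star> g')
      = ?co ?a g \<star> ((?co ?a g' \<star> ?contra ?b f) \<star> ?contra ?b f')"
    using A by (simp add: harr_Hr Ho.assoc)
  also have "?co ?a g' \<star> ?contra ?b f = ?contra (Cod (Ho M) g') f \<star> ?co (Cod (Ho M) f) g'"
    using A by (intro interchange)
  finally show "harr Hr (f' \<star> f) (g \<star> g') = harr Hr f g \<star> harr Hr f' g'"
    using A by (simp add: harr_Hr Ho.assoc)
qed (simp_all add: Ho.category_axioms hob_Hr harr_Hr hom_def)

sublocale Hr: internal_hom "Ho M" Hr
  rewrites "Obj (Ho M) = Obj M"
  by (rule internal_hom_Hr) simp

text \<open>The unit exhibiting \<open>Hr\<close> as the right derived functor of \<open>H\<close>.\<close>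

definition eta :: "'o \<Rightarrow> 'o \<Rightarrow> 'o \<times> 'o \<times> 'm step list set" where
  "eta a b = ho_arr M (harr H (pmap M a) (qmap M b))"

lemma eta_simps [simp]:
  "a \<in> Obj M \<Longrightarrow> b \<in> Obj M \<Longrightarrow> eta a b \<in> Arr (Ho M)"
  "a \<in> Obj M \<Longrightarrow> b \<in> Obj M \<Longrightarrow> Dom (Ho M) (eta a b) = hob H a b"
  "a \<in> Obj M \<Longrightarrow> b \<in> Obj M \<Longrightarrow> Cod (Ho M) (eta a b) = hob Hr a b"
  by (simp_all add: eta_def hob_Hr)

lemma eta_natural:
  assumes "f \<in> Arr M" "g \<in> Arr M"
  shows "harr Hr (ho_arr M f) (ho_arr M g) \<star> eta (Cod M f) (Dom M g)
       = eta (Dom M f) (Cod M g) \<star> ho_arr M (harr H f g)"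
  using assms
  by (simp add: harr_Hr_ho_arr eta_def harr_comp pmap_natural qmap_natural flip: ho_arr_comp)

lemma eta_iso: "cofibrant M a \<Longrightarrow> fibrant M b \<Longrightarrow> is_iso (Ho M) (eta a b)"
  unfolding eta_def by (intro harr_iso) simp_all

text \<open>By naturality of \<open>eta\<close>, \<open>[f, b]\<close> followed by \<open>eta (Dom M g) b\<close> is \<open>eta\<close> at the codomain followed by
  \<open>Hr\<close> applied to the class of \<open>f\<close>, and the first of these two \<open>eta\<close> can be cancelled.\<close>

lemma homotopy_invariance:
  assumes "f \<in> Arr M" "g \<in> Arr M" "Dom M f = Dom M g" "Cod M f = Cod M g" "ho_arr M f = ho_arr M g"
    and "cofibrant M (Dom M g)" "fibrant M b"
  shows "ho_arr M (harr H f (ident M b)) = ho_arr M (harr H g (ident M b))"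
proof (rule Ho.iso_cancel_left[of "eta (Dom M g) b"])
  show "eta (Dom M g) b \<star> ho_arr M (harr H f (ident M b))
      = eta (Dom M g) b \<star> ho_arr M (harr H g (ident M b))"
    using eta_natural[of f "ident M b"] eta_natural[of g "ident M b"] assms by simp
qed (use assms in \<open>simp_all add: eta_iso\<close>)


lemma eta_nat_trans:
  "nat_trans (prod_cat (opp M) M) (Ho M) (comp_func (Loc M) H)
    (comp_func Hr (prod_func (Loc M) (Loc M))) (\<lambda>(a, b). eta a b)"
proof -
  have "is_functor (prod_cat (opp M) M) (Ho M) (comp_func (Loc M) H)"
    using bifunctor is_functor_Loc by (rule is_functor_comp_func)
  moreover have "is_functor (prod_cat (opp M) M) (Ho M) (comp_func Hr (prod_func (Loc M) (Loc M)))"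
    using is_functor_Loc2 Hr.bifunctor by (rule is_functor_comp_func)
  ultimately show ?thesis
    unfolding nat_trans_def
    by (simp add: comp_func_def prod_func_def hom_def eta_natural)
qed

text \<open>Given \<open>\<tau>\<close>, the induced transformation at \<open>(a, b)\<close> is \<open>\<tau>\<close> at \<open>(Q a, R b)\<close>, transported along
  the isomorphisms \<open>p\<close> and \<open>q\<close>; naturality of \<open>\<tau>\<close> along \<open>p\<close> and \<open>q\<close> makes it extend \<open>\<tau>\<close>.  It is unique because \<open>eta\<close> is invertible at \<open>(Q a, R b)\<close> and every pair of
  objects is isomorphic in \<open>Ho M\<close> to one of this form.\<close>

lemma right_derived:
  "right_derived_bifunctor M H Hr (\<lambda>(A, B). ho_arr M (harr H (pmap M A) (qmap M B)))"
  unfolding right_derived_bifunctor_def left_kan_extension_def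
proof (intro conjI allI impI)
  show "is_functor (prod_cat (opp M) M) (prod_cat (opp (Ho M)) (Ho M)) (prod_func (Loc M) (Loc M))"
    by (rule is_functor_Loc2)
  show "is_functor (prod_cat (opp (Ho M)) (Ho M)) (Ho M) Hr"
    by (rule Hr.bifunctor)
  show "nat_trans (prod_cat (opp M) M) (Ho M) (comp_func (Loc M) H)
      (comp_func Hr (prod_func (Loc M) (Loc M))) (\<lambda>(A, B). ho_arr M (harr H (pmap M A) (qmap M B)))"
    using eta_nat_trans by (simp add: eta_def)
next
  fix G \<tau>
  assume A: "is_functor (prod_cat (opp (Ho M)) (Ho M)) (Ho M) G \<and>
    nat_trans (prod_cat (opp M) M) (Ho M) (comp_func (Loc M) H)
      (comp_func G (prod_func (Loc M) (Loc M))) \<tau>"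
  interpret G: internal_hom "Ho M" G
    using A by (simp add: internal_hom_def internal_hom_axioms_def Ho.category_axioms)
  note [simp] = G.hob_Obj[simplified]
  have \<tau> [simp]: "\<tau> (a, b) \<in> Arr (Ho M)" "Dom (Ho M) (\<tau> (a, b)) = hob H a b"
      "Cod (Ho M) (\<tau> (a, b)) = hob G a b" if "a \<in> Obj M" "b \<in> Obj M" for a b
    using A that by (auto simp: nat_trans_def comp_func_def prod_func_def hom_def)
  have \<tau>_natural: "harr G (ho_arr M f) (ho_arr M g) \<star> \<tau> (Cod M f, Dom M g)
      = \<tau> (Dom M f, Cod M g) \<star> ho_arr M (harr H f g)" if "f \<in> Arr M" "g \<in> Arr M" for f g
    using A that by (auto simp: nat_trans_def comp_func_def prod_func_def)
  let ?p = "\<lambda>a. inv_arr (Ho M) (ho_arr M (pmap M a))"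
  let ?q = "\<lambda>b. inv_arr (Ho M) (ho_arr M (qmap M b))"
  define \<theta> where "\<theta> = (\<lambda>(a, b). harr G (?p a) (?q b) \<star> \<tau> (Qob a, Rob b))"
  have \<theta>_natural: "\<theta> (Dom (Ho M) \<phi>, Cod (Ho M) \<psi>) \<star> harr Hr \<phi> \<psi>
      = harr G \<phi> \<psi> \<star> \<theta> (Cod (Ho M) \<phi>, Dom (Ho M) \<psi>)"
    if "\<phi> \<in> Arr (Ho M)" "\<psi> \<in> Arr (Ho M)" for \<phi> \<psi>
  proof (rule Ho_natural_bifunctor[OF internal_hom_Hr G.internal_hom_axioms _ _ that,
        of "\<lambda>a b. \<theta> (a, b)"])
    show "\<theta> (a, b) \<in> hom (Ho M) (hob Hr a b) (hob G a b)" if "a \<in> Obj M" "b \<in> Obj M" for a b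
      using that by (simp add: hom_def \<theta>_def hob_Hr)
    fix f g
    assume [simp]: "f \<in> Arr M" "g \<in> Arr M"
    have p: "ho_arr M (Qar f) \<star> ?p (Dom M f) = ?p (Cod M f) \<star> ho_arr M f"
      by (rule Ho.square_inv) (simp_all add: pmap_natural flip: ho_arr_comp)
    have q: "?q (Cod M g) \<star> ho_arr M (Rar g) = ho_arr M g \<star> ?q (Dom M g)"
      by (rule Ho.square_inv[symmetric]) (simp_all add: qmap_natural flip: ho_arr_comp)
    show "\<theta> (Dom M f, Cod M g) \<star> harr Hr (ho_arr M f) (ho_arr M g)
        = harr G (ho_arr M f) (ho_arr M g) \<star> \<theta> (Cod M f, Dom M g)"
      using \<tau>_natural[of "Qar f" "Rar g", symmetric]
      by (simp add: \<theta>_def harr_Hr_ho_arr Ho.assoc G.harr_comp_assoc p q)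
  qed
  have \<theta>_nat_trans: "nat_trans (prod_cat (opp (Ho M)) (Ho M)) (Ho M) Hr G \<theta>"
    using A unfolding nat_trans_def
    by (simp add: Hr.bifunctor \<theta>_natural) (simp add: \<theta>_def hom_def hob_Hr)
  have \<theta>_eta: "\<theta> (a, b) \<star> eta a b = \<tau> (a, b)" if "a \<in> Obj M" "b \<in> Obj M" for a b
  proof -
    have "\<theta> (a, b) \<star> eta a b
        = harr G (?p a) (?q b) \<star> (harr G (ho_arr M (pmap M a)) (ho_arr M (qmap M b)) \<star> \<tau> (a, b))"
      using that \<tau>_natural[of "pmap M a" "qmap M b"] by (simp add: \<theta>_def eta_def Ho.assoc)
    also have "\<dots> = \<tau> (a, b)" using that by (simp add: G.harr_comp_assoc)
    finally show ?thesis .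
  qed
  have unique: "\<theta>' (a, b) = \<theta> (a, b)"
    if \<theta>': "nat_trans (prod_cat (opp (Ho M)) (Ho M)) (Ho M) Hr G \<theta>'"
      "\<forall>x\<in>Obj (prod_cat (opp M) M). \<theta>' (OMap (prod_func (Loc M) (Loc M)) x)
        \<star> (case x of (a, b) \<Rightarrow> eta a b) = \<tau> x"
      and ab [simp]: "a \<in> Obj M" "b \<in> Obj M" for \<theta>' a b
  proof -
    have \<theta>'_hom [simp]: "\<theta>' (a, b) \<in> Arr (Ho M)" "Dom (Ho M) (\<theta>' (a, b)) = hob Hr a b"
      "Cod (Ho M) (\<theta>' (a, b)) = hob G a b" if "a \<in> Obj M" "b \<in> Obj M" for a b
      using \<theta>'(1) that by (auto simp: nat_trans_def hom_def)
    have \<theta>_hom [simp]: "\<theta> (a, b) \<in> Arr (Ho M)" "Dom (Ho M) (\<theta> (a, b)) = hob Hr a b"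
      "Cod (Ho M) (\<theta> (a, b)) = hob G a b" if "a \<in> Obj M" "b \<in> Obj M" for a b
      using that by (simp_all add: \<theta>_def hob_Hr)
    have \<theta>'_natural: "harr G \<phi> \<psi> \<star> \<theta>' (Cod (Ho M) \<phi>, Dom (Ho M) \<psi>)
        = \<theta>' (Dom (Ho M) \<phi>, Cod (Ho M) \<psi>) \<star> harr Hr \<phi> \<psi>"
      if "\<phi> \<in> Arr (Ho M)" "\<psi> \<in> Arr (Ho M)" for \<phi> \<psi>
    proof -
      have "\<forall>x\<in>Arr (prod_cat (opp (Ho M)) (Ho M)).
          AMap G x \<star> \<theta>' (Dom (prod_cat (opp (Ho M)) (Ho M)) x)
          = \<theta>' (Cod (prod_cat (opp (Ho M)) (Ho M)) x) \<star> AMap Hr x"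
        using \<theta>'(1) unfolding nat_trans_def by blast
      from bspec[OF this, of "(\<phi>, \<psi>)"] that show ?thesis by simp
    qed
    have "\<theta>' (Qob a, Rob b) = \<theta> (Qob a, Rob b)"
      by (rule Ho.iso_cancel_right[of "eta (Qob a) (Rob b)"])
        (use \<theta>'(2) in \<open>simp_all add: eta_iso \<theta>_eta prod_func_def\<close>)
    then have "\<theta>' (a, b) \<star> harr Hr (?p a) (?q b) = \<theta> (a, b) \<star> harr Hr (?p a) (?q b)"
      using \<theta>'_natural[of "?p a" "?q b", symmetric] \<theta>_natural[of "?p a" "?q b"] by simp
    then show ?thesis
      by (rule Ho.iso_cancel_right[rotated -1]) (simp_all add: Hr.is_iso_harr hob_Hr)
  qed
  show "\<exists>\<theta>. nat_trans (prod_cat (opp (Ho M)) (Ho M)) (Ho M) Hr G \<theta> \<and>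
      (\<forall>a\<in>Obj (prod_cat (opp M) M). \<theta> (OMap (prod_func (Loc M) (Loc M)) a)
        \<star> (case a of (A, B) \<Rightarrow> ho_arr M (harr H (pmap M A) (qmap M B))) = \<tau> a) \<and>
      (\<forall>\<theta>'. nat_trans (prod_cat (opp (Ho M)) (Ho M)) (Ho M) Hr G \<theta>' \<and>
        (\<forall>a\<in>Obj (prod_cat (opp M) M). \<theta>' (OMap (prod_func (Loc M) (Loc M)) a)
          \<star> (case a of (A, B) \<Rightarrow> ho_arr M (harr H (pmap M A) (qmap M B))) = \<tau> a) \<longrightarrow>
        (\<forall>b\<in>Obj (prod_cat (opp (Ho M)) (Ho M)). \<theta>' b = \<theta> b))"
    unfolding eta_def[symmetric]
  proof (intro exI[of _ \<theta>] conjI allI impI)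
    show "nat_trans (prod_cat (opp (Ho M)) (Ho M)) (Ho M) Hr G \<theta>" by (rule \<theta>_nat_trans)
    show "\<forall>a\<in>Obj (prod_cat (opp M) M). \<theta> (OMap (prod_func (Loc M) (Loc M)) a)
        \<star> (case a of (A, B) \<Rightarrow> eta A B) = \<tau> a"
      using \<theta>_eta by (simp add: prod_func_def)
      fix \<theta>'
    assume "nat_trans (prod_cat (opp (Ho M)) (Ho M)) (Ho M) Hr G \<theta>' \<and>
        (\<forall>a\<in>Obj (prod_cat (opp M) M). \<theta>' (OMap (prod_func (Loc M) (Loc M)) a)
          \<star> (case a of (A, B) \<Rightarrow> eta A B) = \<tau> a)"
    then show "\<forall>b\<in>Obj (prod_cat (opp (Ho M)) (Ho M)). \<theta>' b = \<theta> b"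
      by (auto intro: unique)
  qed
qed

end

section \<open>The derived constraints\<close>

locale skew_closed_model_category = axiom_C_category M H I
  for M :: "('o, 'm, 'x) model_cat_scheme" (structure) and H :: "('o, 'm) bifunc" and I :: 'o +
  fixes L :: "'o \<Rightarrow> 'o \<Rightarrow> 'o \<Rightarrow> 'm"
    and i :: "'o \<Rightarrow> 'm"
    and j :: "'o \<Rightarrow> 'm"
    and k :: "'o \<Rightarrow> 'o \<Rightarrow> 'm"
    and e :: 'm
  assumes skew_closed: "skew_closed_category M H I L i j"
    and k_choice: "k_choice M H k"
    and e_hom: "e \<in> hom M I (Qob I)"
    and e_section: "pmap M I \<cdot> e = ident M I"
begin

lemma L_simps [simp]:
  assumes "a \<in> Obj M" "b \<in> Obj M" "d \<in> Obj M"
  shows "L a b d \<in> Arr M" "Dom M (L a b d) = hob H b d"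
    "Cod M (L a b d) = hob H (hob H a b) (hob H a d)"
  using skew_closed_category.L_in_hom[OF skew_closed assms] by (simp_all add: hom_def)

lemma L_natural:
  assumes "a \<in> Obj M" "f \<in> Arr M" "g \<in> Arr M" "Dom M f = b" "Cod M g = d"
  shows "L a b d \<cdot> harr H f g
    = harr H (harr H (ident M a) f) (harr H (ident M a) g) \<cdot> L a (Cod M f) (Dom M g)"
  using skew_closed_category.L_natural[OF skew_closed assms(1), of f b "Cod M f" g "Dom M g" d] assms
  by (simp add: hom_def)

lemma L_extranatural:
  assumes "f \<in> Arr M" "b \<in> Obj M" "d \<in> Obj M"
  shows "harr H (harr H f (ident M b)) (ident M (hob H (Dom M f) d)) \<cdot> L (Dom M f) b d
    = harr H (ident M (hob H (Cod M f) b)) (harr H f (ident M d)) \<cdot> L (Cod M f) b d"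
  using skew_closed_category.L_extranatural[OF skew_closed, of f] assms by (simp add: hom_def)

lemma i_simps [simp]:
  assumes "a \<in> Obj M"
  shows "i a \<in> Arr M" "Dom M (i a) = hob H I a" "Cod M (i a) = a"
  using skew_closed_category.i_in_hom[OF skew_closed assms] by (simp_all add: hom_def)

lemma i_natural: "f \<in> Arr M \<Longrightarrow> f \<cdot> i (Dom M f) = i (Cod M f) \<cdot> harr H (ident M I) f"
  using skew_closed_category.i_natural[OF skew_closed, of f] by (simp add: hom_def)

lemma j_simps [simp]:
  assumes "a \<in> Obj M"
  shows "j a \<in> Arr M" "Dom M (j a) = I" "Cod M (j a) = hob H a a"
  using skew_closed_category.j_in_hom[OF skew_closed assms] by (simp_all add: hom_def)

lemma j_extranatural:
  "f \<in> Arr M \<Longrightarrow> harr H (ident M (Dom M f)) f \<cdot> j (Dom M f)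
    = harr H f (ident M (Cod M f)) \<cdot> j (Cod M f)"
  using skew_closed_category.j_extranatural[OF skew_closed, of f] by (simp add: hom_def)

lemma e_simps [simp]: "e \<in> Arr M" "Dom M e = I" "Cod M e = Qob I"
  using e_hom by (simp_all add: hom_def)

lemma k_simps [simp]:
  assumes "cofibrant M a" "b \<in> Obj M"
  shows "k a b \<in> Arr M" "Dom M (k a b) = Qob (hob H a b)" "Cod M (k a b) = hob H a (Qob b)"
    and k_lift: "harr H (ident M a) (pmap M b) \<cdot> k a b = pmap M (hob H a b)"
  using k_choice assms by (simp_all add: k_choice_def hom_def)

text \<open>Two lifts of one arrow through the trivial fibration \<open>[a, p]\<close> agree in \<open>Ho M\<close>; homotopy invariance
  carries this over to their images under \<open>[-, g]\<close>, although \<open>[a, Q b]\<close> need not be cofibrant.\<close>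

lemma ho_lift_unique:
  assumes f: "f \<in> Arr M" "Dom M f = x" "Cod M f = hob H a (Qob b)"
    and f': "f' \<in> Arr M" "Dom M f' = x" "Cod M f' = hob H a (Qob b)"
    and a: "cofibrant M a" and b: "b \<in> Obj M" and x: "cofibrant M x"
    and eq: "harr H (ident M a) (pmap M b) \<cdot> f = harr H (ident M a) (pmap M b) \<cdot> f'"
    and g: "g \<in> Arr M" "fibrant M (Cod M g)"
  shows "ho_arr M (harr H f g) = ho_arr M (harr H f' g)"
proof -
  have p: "harr H (ident M a) (pmap M b) \<in> weq M"
    using harr_tfib[OF a, of "pmap M b"] b by simp
  have "ho_arr M (harr H (ident M a) (pmap M b)) \<star> ho_arr M f
      = ho_arr M (harr H (ident M a) (pmap M b)) \<star> ho_arr M f'"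
    using f f' a b eq by (simp flip: ho_arr_comp)
  then have "ho_arr M f = ho_arr M f'"
    by (rule Ho.iso_cancel_left[rotated -1]) (use f f' a b p in simp_all)
  then have "ho_arr M (harr H f (ident M (Cod M g))) = ho_arr M (harr H f' (ident M (Cod M g)))"
    using f f' x g by (intro homotopy_invariance) simp_all
  then show ?thesis
    using f f' g a b unfolding harr_factor[OF f(1) g(1)] harr_factor[OF f'(1) g(1)]
    by (simp add: ho_arr_comp)
qed

text \<open>The arrows \<open>k\<close> are chosen without any coherence, but both ways around the naturality square lift
  \<open>[h, f] \<cdot> p\<close> through the same trivial fibration.\<close>

lemma ho_k_natural:
  assumes h [simp]: "h \<in> Arr M" "cofibrant M (Dom M h)" "cofibrant M (Cod M h)"
    and f [simp]: "f \<in> Arr M" and g: "g \<in> Arr M" "fibrant M (Cod M g)"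
  shows "ho_arr M (harr H (harr H h (Qar f) \<cdot> k (Cod M h) (Dom M f)) g)
    = ho_arr M (harr H (k (Dom M h) (Cod M f) \<cdot> Qar (harr H h f)) g)"
proof -
  let ?p = "harr H (ident M (Dom M h)) (pmap M (Cod M f))"
  have [simp]: "Dom M h \<in> Obj M" "Cod M h \<in> Obj M" by simp_all
  have "?p \<cdot> (harr H h (Qar f) \<cdot> k (Cod M h) (Dom M f))
      = harr H h (f \<cdot> pmap M (Dom M f)) \<cdot> k (Cod M h) (Dom M f)"
    by (simp add: harr_comp_assoc pmap_natural)
  also have "\<dots> = harr H h f \<cdot> (harr H (ident M (Cod M h)) (pmap M (Dom M f)) \<cdot> k (Cod M h) (Dom M f))"
    by (simp add: harr_comp_assoc del: k_lift)
  also have "\<dots> = pmap M (hob H (Dom M h) (Cod M f)) \<cdot> Qar (harr H h f)"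
    using pmap_natural[of "harr H h f"] by (simp add: k_lift)
  also have "\<dots> = (?p \<cdot> k (Dom M h) (Cod M f)) \<cdot> Qar (harr H h f)"
    by (simp add: k_lift)
  also have "\<dots> = ?p \<cdot> (k (Dom M h) (Cod M f) \<cdot> Qar (harr H h f))"
    by (simp add: assoc del: k_lift)
  finally show ?thesis
    using g by (intro ho_lift_unique[of _ "Qob (hob H (Cod M h) (Dom M f))" "Dom M h" "Cod M f"]) simp_all
qed

text \<open>All of \<open>L_r\<close> except the inverse of \<open>[Q q, 1]\<close>, as a single arrow of \<open>M\<close>.\<close>

definition Lr_core :: "'o \<Rightarrow> 'o \<Rightarrow> 'o \<Rightarrow> 'm" where
  "Lr_core c a b = harr H (k (Qob c) (Rob a)) (qmap M (hob H (Qob c) (Rob b)))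
     \<cdot> L (Qob c) (Qob (Rob a)) (Rob b)"

lemma Lr_core_simps [simp]:
  assumes "a \<in> Obj M" "b \<in> Obj M" "c \<in> Obj M"
  shows "Lr_core c a b \<in> Arr M" "Dom M (Lr_core c a b) = hob H (Qob (Rob a)) (Rob b)"
    "Cod M (Lr_core c a b) = hob Hr (hob Hr c a) (hob Hr c b)"
  using assms by (simp_all add: Lr_core_def hob_Hr)

lemma Qq_iso:
  "a \<in> Obj M \<Longrightarrow> b \<in> Obj M \<Longrightarrow>
    is_iso (Ho M) (ho_arr M (harr H (Qar (qmap M a)) (ident M (Rob b))))"
  by (rule harr_iso) simp_all

abbreviation "Lr \<equiv> L_r M H L k"
abbreviation "ir \<equiv> i_r M H i e"
abbreviation "jr \<equiv> j_r M H j"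

lemma Lr_eq:
  assumes "a \<in> Obj M" "b \<in> Obj M" "c \<in> Obj M"
  shows "Lr c a b
    = ho_arr M (Lr_core c a b) \<star> inv_arr (Ho M) (ho_arr M (harr H (Qar (qmap M a)) (ident M (Rob b))))"
proof -
  let ?a = "hob H (Qob c) (Rob a)" and ?b = "hob H (Qob c) (Rob b)"
  have "Lr_core c a b = harr H (ident M (Qob ?a)) (qmap M ?b)
      \<cdot> (harr H (k (Qob c) (Rob a)) (ident M ?b) \<cdot> L (Qob c) (Qob (Rob a)) (Rob b))"
    using assms by (simp add: Lr_core_def harr_comp_assoc)
  then show ?thesis
    using assms Qq_iso[of a b] by (simp add: L_r_def Let_def ho_arr_comp Ho.assoc)
qed

lemma Lr_simps [simp]:
  assumes "a \<in> Obj M" "b \<in> Obj M" "c \<in> Obj M"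
  shows "Lr c a b \<in> Arr (Ho M)" "Dom (Ho M) (Lr c a b) = hob Hr a b"
    "Cod (Ho M) (Lr c a b) = hob Hr (hob Hr c a) (hob Hr c b)"
  using assms Qq_iso[of a b] by (simp_all add: Lr_eq) (simp add: hob_Hr)

lemma harr_Hr_ident_ho_arr:
  "a \<in> Obj M \<Longrightarrow> g \<in> Arr M \<Longrightarrow>
    harr Hr (ident (Ho M) a) (ho_arr M g) = ho_arr M (harr H (ident M (Qob a)) (Rar g))"
  "b \<in> Obj M \<Longrightarrow> f \<in> Arr M \<Longrightarrow>
    harr Hr (ho_arr M f) (ident (Ho M) b) = ho_arr M (harr H (Qar f) (ident M (Rob b)))"
  using harr_Hr_ho_arr[of "ident M a" g] harr_Hr_ho_arr[of f "ident M b"] by simp_all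

lemma Lr_natural_right_ho:
  assumes [simp]: "c \<in> Obj M" "a \<in> Obj M" "g \<in> Arr M"
  shows "Lr c a (Cod M g) \<star> harr Hr (ident (Ho M) a) (ho_arr M g)
    = harr Hr (ident (Ho M) (hob Hr c a)) (harr Hr (ident (Ho M) c) (ho_arr M g)) \<star> Lr c a (Dom M g)"
proof -
  let ?Qq = "\<lambda>b. ho_arr M (harr H (Qar (qmap M a)) (ident M (Rob b)))"
  let ?g = "harr H (ident M (Qob (Rob a))) (Rar g)"
  let ?g' = "harr H (ident M (Qob (hob H (Qob c) (Rob a)))) (Rar (harr H (ident M (Qob c)) (Rar g)))"
  have iso [simp]: "is_iso (Ho M) (?Qq b)" if "b \<in> Obj M" for b using that by (simp add: Qq_iso)
  have "inv_arr (Ho M) (?Qq (Cod M g)) \<star> ho_arr M (harr H (ident M (Qob a)) (Rar g))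
      = ho_arr M ?g \<star> inv_arr (Ho M) (?Qq (Dom M g))"
    by (rule Ho.square_inv[symmetric]) (simp_all add: harr_comp flip: ho_arr_comp)
  moreover have "Lr_core c a (Cod M g) \<cdot> ?g = ?g' \<cdot> Lr_core c a (Dom M g)"
    using qmap_natural[of "harr H (ident M (Qob c)) (Rar g)"]
    by (simp add: Lr_core_def assoc L_natural harr_comp harr_comp_assoc)
  then have "ho_arr M (Lr_core c a (Cod M g)) \<star> ho_arr M ?g = ho_arr M ?g' \<star> ho_arr M (Lr_core c a (Dom M g))"
    by (simp add: hob_Hr flip: ho_arr_comp)
  ultimately have "ho_arr M (Lr_core c a (Cod M g))
      \<star> (inv_arr (Ho M) (?Qq (Cod M g)) \<star> ho_arr M (harr H (ident M (Qob a)) (Rar g)))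
    = (ho_arr M ?g' \<star> ho_arr M (Lr_core c a (Dom M g))) \<star> inv_arr (Ho M) (?Qq (Dom M g))"
    by (simp add: hob_Hr flip: Ho.assoc)
  then show ?thesis
    by (simp add: Lr_eq harr_Hr_ident_ho_arr hob_Hr Ho.assoc)
qed

text \<open>In this variable, as in \<open>c\<close> below, the square contains a naturality square of \<open>k\<close>, which commutes
  only after passing to \<open>Ho M\<close>.\<close>

lemma Lr_natural_left_ho:
  assumes [simp]: "c \<in> Obj M" "b \<in> Obj M" "f \<in> Arr M"
  shows "Lr c (Dom M f) b \<star> harr Hr (ho_arr M f) (ident (Ho M) b)
    = harr Hr (harr Hr (ident (Ho M) c) (ho_arr M f)) (ident (Ho M) (hob Hr c b)) \<star> Lr c (Cod M f) b"
proof -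
  let ?Qq = "\<lambda>a. ho_arr M (harr H (Qar (qmap M a)) (ident M (Rob b)))"
  let ?f = "harr H (Qar (Rar f)) (ident M (Rob b))"
  let ?f' = "harr H (Qar (harr H (ident M (Qob c)) (Rar f))) (ident M (Rob (hob Hr c b)))"
  have iso [simp]: "is_iso (Ho M) (?Qq b)" if "b \<in> Obj M" for b using that by (simp add: Qq_iso)
  have "inv_arr (Ho M) (?Qq (Dom M f)) \<star> ho_arr M (harr H (Qar f) (ident M (Rob b)))
      = ho_arr M ?f \<star> inv_arr (Ho M) (?Qq (Cod M f))"
    by (rule Ho.square_inv[symmetric])
      (simp_all add: harr_comp qmap_natural flip: ho_arr_comp Qar_comp)
  moreover have "ho_arr M (Lr_core c (Dom M f) b) \<star> ho_arr M ?f = ho_arr M ?f' \<star> ho_arr M (Lr_core c (Cod M f) b)"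
  proof -
    let ?k = "k (Qob c) (Rob (Dom M f))" and ?k' = "k (Qob c) (Rob (Cod M f))"
    let ?q = "qmap M (hob H (Qob c) (Rob b))" and ?L = "L (Qob c) (Qob (Rob (Cod M f))) (Rob b)"
    have 1: "Lr_core c (Dom M f) b \<cdot> ?f = harr H (harr H (ident M (Qob c)) (Qar (Rar f)) \<cdot> ?k) ?q \<cdot> ?L"
      by (simp add: Lr_core_def assoc L_natural harr_comp harr_comp_assoc)
    have 2: "?f' \<cdot> Lr_core c (Cod M f) b
        = harr H (?k' \<cdot> Qar (harr H (ident M (Qob c)) (Rar f))) ?q \<cdot> ?L"
      by (simp add: Lr_core_def assoc harr_comp_assoc hob_Hr)
    have "ho_arr M (Lr_core c (Dom M f) b) \<star> ho_arr M ?f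
        = ho_arr M (harr H (harr H (ident M (Qob c)) (Qar (Rar f)) \<cdot> ?k) ?q) \<star> ho_arr M ?L"
      using 1 by (simp flip: ho_arr_comp)
    also have "ho_arr M (harr H (harr H (ident M (Qob c)) (Qar (Rar f)) \<cdot> ?k) ?q)
        = ho_arr M (harr H (?k' \<cdot> Qar (harr H (ident M (Qob c)) (Rar f))) ?q)"
      using ho_k_natural[of "ident M (Qob c)" "Rar f" ?q] by simp
    also have "\<dots> \<star> ho_arr M ?L = ho_arr M ?f' \<star> ho_arr M (Lr_core c (Cod M f) b)"
      using 2 by (simp add: hob_Hr flip: ho_arr_comp)
    finally show ?thesis .
  qed
  ultimately have "ho_arr M (Lr_core c (Dom M f) b)
      \<star> (inv_arr (Ho M) (?Qq (Dom M f)) \<star> ho_arr M (harr H (Qar f) (ident M (Rob b))))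
    = (ho_arr M ?f' \<star> ho_arr M (Lr_core c (Cod M f) b)) \<star> inv_arr (Ho M) (?Qq (Cod M f))"
    by (simp add: hob_Hr flip: Ho.assoc)
  then show ?thesis
    by (simp add: Lr_eq harr_Hr_ident_ho_arr hob_Hr Ho.assoc)
qed

lemma Lr_extranatural_ho:
  assumes [simp]: "a \<in> Obj M" "b \<in> Obj M" "h \<in> Arr M"
  shows "harr Hr (harr Hr (ho_arr M h) (ident (Ho M) a)) (ident (Ho M) (hob Hr (Dom M h) b))
      \<star> Lr (Dom M h) a b
    = harr Hr (ident (Ho M) (hob Hr (Cod M h) a)) (harr Hr (ho_arr M h) (ident (Ho M) b))
      \<star> Lr (Cod M h) a b"
proof -
  let ?Ra = "Rob a" and ?Rb = "Rob b" and ?c' = "Qob (Dom M h)" and ?c = "Qob (Cod M h)"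
  let ?k' = "k ?c' ?Ra" and ?k = "k ?c ?Ra"
  let ?h = "harr H (Qar (harr H (Qar h) (ident M ?Ra))) (ident M (Rob (hob H ?c' ?Rb)))"
  let ?h' = "harr H (ident M (Qob (hob H ?c ?Ra))) (Rar (harr H (Qar h) (ident M ?Rb)))"
  let ?q = "qmap M (hob H ?c' ?Rb)" and ?L' = "L ?c' (Qob ?Ra) ?Rb" and ?L = "L ?c (Qob ?Ra) ?Rb"
  have "?h \<cdot> Lr_core (Dom M h) a b = harr H (?k' \<cdot> Qar (harr H (Qar h) (ident M ?Ra))) ?q \<cdot> ?L'"
    by (simp add: Lr_core_def harr_comp_assoc)
  then have 1: "ho_arr M ?h \<star> ho_arr M (Lr_core (Dom M h) a b)
      = ho_arr M (harr H (?k' \<cdot> Qar (harr H (Qar h) (ident M ?Ra))) ?q) \<star> ho_arr M ?L'"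
    by (simp add: hob_Hr flip: ho_arr_comp)
  have "?h' \<cdot> Lr_core (Cod M h) a b = harr H ?k ?q \<cdot>
      (harr H (ident M (hob H ?c (Qob ?Ra))) (harr H (Qar h) (ident M ?Rb)) \<cdot> ?L)"
    using qmap_natural[of "harr H (Qar h) (ident M ?Rb)"] by (simp add: Lr_core_def harr_comp_assoc)
  also have "harr H (ident M (hob H ?c (Qob ?Ra))) (harr H (Qar h) (ident M ?Rb)) \<cdot> ?L
      = harr H (harr H (Qar h) (ident M (Qob ?Ra))) (ident M (hob H ?c' ?Rb)) \<cdot> ?L'"
    using L_extranatural[of "Qar h" "Qob ?Ra" ?Rb] by simp
  also have "harr H ?k ?q \<cdot> \<dots> = harr H (harr H (Qar h) (ident M (Qob ?Ra)) \<cdot> ?k) ?q \<cdot> ?L'"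
    by (simp add: harr_comp_assoc)
  finally have "ho_arr M ?h' \<star> ho_arr M (Lr_core (Cod M h) a b)
      = ho_arr M (harr H (harr H (Qar h) (ident M (Qob ?Ra)) \<cdot> ?k) ?q) \<star> ho_arr M ?L'"
    by (simp add: hob_Hr flip: ho_arr_comp)
  also have "ho_arr M (harr H (harr H (Qar h) (ident M (Qob ?Ra)) \<cdot> ?k) ?q)
      = ho_arr M (harr H (?k' \<cdot> Qar (harr H (Qar h) (ident M ?Ra))) ?q)"
    using ho_k_natural[of "Qar h" "ident M ?Ra" ?q] by simp
  finally have "ho_arr M ?h \<star> ho_arr M (Lr_core (Dom M h) a b)
      = ho_arr M ?h' \<star> ho_arr M (Lr_core (Cod M h) a b)"
    using 1 by simp
  then have "(ho_arr M ?h \<star> ho_arr M (Lr_core (Dom M h) a b))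
        \<star> inv_arr (Ho M) (ho_arr M (harr H (Qar (qmap M a)) (ident M ?Rb)))
      = (ho_arr M ?h' \<star> ho_arr M (Lr_core (Cod M h) a b))
        \<star> inv_arr (Ho M) (ho_arr M (harr H (Qar (qmap M a)) (ident M ?Rb)))"
    by simp
  then show ?thesis
    by (simp add: Lr_eq harr_Hr_ident_ho_arr hob_Hr Ho.assoc Qq_iso)
qed

section \<open>Naturality of the constraints in the homotopy category\<close>

lemma Lr_natural_right:
  assumes [simp]: "c \<in> Obj M" "a \<in> Obj M" "\<psi> \<in> Arr (Ho M)"
  shows "Lr c a (Cod (Ho M) \<psi>) \<star> harr Hr (ident (Ho M) a) \<psi>
    = harr Hr (ident (Ho M) (hob Hr c a)) (harr Hr (ident (Ho M) c) \<psi>) \<star> Lr c a (Dom (Ho M) \<psi>)"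
  using Ho_natural[OF Hr.is_functor_co[of a] is_functor_comp_func[OF Hr.is_functor_co[of c]
        Hr.is_functor_co[of "hob Hr c a"]], of "Lr c a" \<psi>] Lr_natural_right_ho[of c a]
  by (simp add: comp_func_def hom_def)

lemma Lr_natural_left:
  assumes [simp]: "c \<in> Obj M" "b \<in> Obj M" "\<phi> \<in> Arr (Ho M)"
  shows "Lr c (Dom (Ho M) \<phi>) b \<star> harr Hr \<phi> (ident (Ho M) b)
    = harr Hr (harr Hr (ident (Ho M) c) \<phi>) (ident (Ho M) (hob Hr c b)) \<star> Lr c (Cod (Ho M) \<phi>) b"
  using Ho_natural[OF is_functor_comp_func[OF Hr.is_functor_co[of c]
        Hr.is_functor_contra[of "hob Hr c b"]] Hr.is_functor_contra[of b], of "\<lambda>a. Lr c a b" \<phi>]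
    Lr_natural_left_ho[of c b]
  by (simp add: comp_func_def hom_def)

lemma Lr_natural:
  assumes [simp]: "c \<in> Obj M" "\<phi> \<in> Arr (Ho M)" "\<psi> \<in> Arr (Ho M)"
    and ab: "Dom (Ho M) \<phi> = a" "Cod (Ho M) \<psi> = b"
  shows "Lr c a b \<star> harr Hr \<phi> \<psi>
    = harr Hr (harr Hr (ident (Ho M) c) \<phi>) (harr Hr (ident (Ho M) c) \<psi>)
      \<star> Lr c (Cod (Ho M) \<phi>) (Dom (Ho M) \<psi>)"
proof -
  have "Lr c a b \<star> harr Hr \<phi> \<psi> = (harr Hr (harr Hr (ident (Ho M) c) \<phi>) (ident (Ho M) (hob Hr c b))
      \<cdot>\<^bsub>Ho M\<^esub> harr Hr (ident (Ho M) (hob Hr c (Cod (Ho M) \<phi>))) (harr Hr (ident (Ho M) c) \<psi>))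
      \<star> Lr c (Cod (Ho M) \<phi>) (Dom (Ho M) \<psi>)"
    unfolding Hr.harr_factor[OF assms(2,3)] ab[symmetric]
    by (rule Ho.square_comp[OF Lr_natural_right Lr_natural_left]) simp_all
  moreover have "a \<in> Obj M" "b \<in> Obj M" using ab by auto
  ultimately show ?thesis using ab by (simp add: Hr.harr_comp)
qed

lemma Lr_extranatural:
  assumes [simp]: "a \<in> Obj M" "b \<in> Obj M" and \<phi>: "\<phi> \<in> Arr (Ho M)"
  shows "harr Hr (harr Hr \<phi> (ident (Ho M) a)) (ident (Ho M) (hob Hr (Dom (Ho M) \<phi>) b))
      \<star> Lr (Dom (Ho M) \<phi>) a b
    = harr Hr (ident (Ho M) (hob Hr (Cod (Ho M) \<phi>) a)) (harr Hr \<phi> (ident (Ho M) b))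
      \<star> Lr (Cod (Ho M) \<phi>) a b"
  using \<phi>
proof (induction \<phi> rule: Ho_induct)
  case (ho f)
  then show ?case using Lr_extranatural_ho[of a b f] by simp
next
  case (inv \<phi>)
  let ?c = "Dom (Ho M) \<phi>" and ?d = "Cod (Ho M) \<phi>" and ?\<phi> = "inv_arr (Ho M) \<phi>"
  have [simp]: "\<phi> \<in> Arr (Ho M)" using inv by (simp add: Ho.is_iso_Arr)
  have "harr Hr (ident (Ho M) (hob Hr ?c a)) (harr Hr ?\<phi> (ident (Ho M) b)) \<star> Lr ?c a b
      = harr Hr (harr Hr ?\<phi> (ident (Ho M) a)) (harr Hr ?\<phi> (ident (Ho M) b))
        \<star> (harr Hr (harr Hr \<phi> (ident (Ho M) a)) (ident (Ho M) (hob Hr ?c b)) \<star> Lr ?c a b)"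
    using inv.hyps by (simp add: Hr.harr_comp Hr.harr_comp_assoc)
  also have "\<dots> = harr Hr (harr Hr ?\<phi> (ident (Ho M) a)) (ident (Ho M) (hob Hr ?d b)) \<star> Lr ?d a b"
    unfolding inv.IH using inv.hyps by (simp add: Hr.harr_comp Hr.harr_comp_assoc)
  finally show ?case using inv.hyps by simp
next
  case (comp \<phi> \<psi>)
  let ?b = "Dom (Ho M) \<phi>" and ?c = "Dom (Ho M) \<psi>" and ?d = "Cod (Ho M) \<psi>"
  have [simp]: "\<phi> \<in> Arr (Ho M)" "\<psi> \<in> Arr (Ho M)" "Cod (Ho M) \<phi> = ?c" using comp by simp_all
  have "harr Hr (harr Hr (\<psi> \<star> \<phi>) (ident (Ho M) a)) (ident (Ho M) (hob Hr ?b b)) \<star> Lr ?b a b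
      = harr Hr (harr Hr \<psi> (ident (Ho M) a)) (ident (Ho M) (hob Hr ?b b))
        \<star> (harr Hr (harr Hr \<phi> (ident (Ho M) a)) (ident (Ho M) (hob Hr ?b b)) \<star> Lr ?b a b)"
    by (simp add: Hr.harr_comp Hr.harr_comp_assoc)
  also have "\<dots> = harr Hr (ident (Ho M) (hob Hr ?d a)) (harr Hr \<phi> (ident (Ho M) b))
        \<star> (harr Hr (harr Hr \<psi> (ident (Ho M) a)) (ident (Ho M) (hob Hr ?c b)) \<star> Lr ?c a b)"
    unfolding comp.IH(1) by (simp add: Hr.harr_comp Hr.harr_comp_assoc)
  also have "\<dots> = harr Hr (ident (Ho M) (hob Hr ?d a)) (harr Hr (\<psi> \<star> \<phi>) (ident (Ho M) b))
        \<star> Lr ?d a b"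
    unfolding comp.IH(2) by (simp add: Hr.harr_comp Hr.harr_comp_assoc)
  finally show ?case by simp
qed

lemma ir_simps [simp]:
  assumes "a \<in> Obj M"
  shows "ir a \<in> Arr (Ho M)" "Dom (Ho M) (ir a) = hob Hr I a" "Cod (Ho M) (ir a) = a"
  using assms by (simp_all add: i_r_def Let_def hob_Hr)

lemma ir_natural:
  assumes "\<phi> \<in> Arr (Ho M)"
  shows "\<phi> \<star> ir (Dom (Ho M) \<phi>) = ir (Cod (Ho M) \<phi>) \<star> harr Hr (ident (Ho M) I) \<phi>"
proof -
  have ho: "ir (Cod M f) \<star> harr Hr (ident (Ho M) I) (ho_arr M f) = ho_arr M f \<star> ir (Dom M f)"
    if [simp]: "f \<in> Arr M" for f
  proof -
    let ?q = "\<lambda>a. inv_arr (Ho M) (ho_arr M (qmap M a))"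
    have "?q (Cod M f) \<star> ho_arr M (Rar f) = ho_arr M f \<star> ?q (Dom M f)"
      by (rule Ho.square_inv[symmetric]) (simp_all flip: ho_arr_comp)
    moreover have "ho_arr M (i (Rob (Cod M f)) \<cdot> harr H e (ident M (Rob (Cod M f)))
          \<cdot> harr H (ident M (Qob I)) (Rar f))
        = ho_arr M (Rar f \<cdot> i (Rob (Dom M f)) \<cdot> harr H e (ident M (Rob (Dom M f))))"
      using i_natural[of "Rar f"] by (simp add: harr_comp flip: assoc) (simp add: harr_comp assoc)
    ultimately show ?thesis
      by (simp add: i_r_def Let_def harr_Hr_ident_ho_arr Ho.assoc ho_arr_comp)
        (simp flip: Ho.assoc)
  qed
  have "is_functor (Ho M) (Ho M) \<lparr>OMap = \<lambda>a. a, AMap = \<lambda>f. f\<rparr>"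
    by (simp add: is_functor_def hom_def Ho.category_axioms)
  from Ho_natural[OF Hr.is_functor_co[of I] this, of ir \<phi>] ho assms
  show ?thesis by (simp add: hom_def)
qed

lemma jr_eq: "a \<in> Obj M \<Longrightarrow> jr a = eta a a \<star> ho_arr M (j a)"
  by (simp add: j_r_def eta_def Let_def harr_comp_assoc flip: ho_arr_comp)

lemma jr_simps [simp]:
  assumes "a \<in> Obj M"
  shows "jr a \<in> Arr (Ho M)" "Dom (Ho M) (jr a) = I" "Cod (Ho M) (jr a) = hob Hr a a"
  using assms by (simp_all add: jr_eq)

lemma jr_extranatural:
  assumes "\<phi> \<in> Arr (Ho M)"
  shows "harr Hr (ident (Ho M) (Dom (Ho M) \<phi>)) \<phi> \<star> jr (Dom (Ho M) \<phi>)
    = harr Hr \<phi> (ident (Ho M) (Cod (Ho M) \<phi>)) \<star> jr (Cod (Ho M) \<phi>)"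
  using assms
proof (induction \<phi> rule: Ho_induct)
  case (ho f)
  note [simp] = ho
  let ?a = "Dom M f" and ?b = "Cod M f"
  have "harr Hr (ident (Ho M) ?a) (ho_arr M f) \<star> jr ?a
      = eta ?a ?b \<star> ho_arr M (harr H (ident M ?a) f \<cdot> j ?a)"
    using eta_natural[of "ident M ?a" f] by (simp add: jr_eq ho_arr_comp flip: Ho.assoc)
  also have "\<dots> = harr Hr (ho_arr M f) (ident (Ho M) ?b) \<star> jr ?b"
    using eta_natural[of f "ident M ?b"]
    by (simp add: jr_eq j_extranatural ho_arr_comp flip: Ho.assoc)
  finally show ?case by simp
next
  case (inv \<phi>)
  let ?a = "Dom (Ho M) \<phi>" and ?b = "Cod (Ho M) \<phi>" and ?\<phi> = "inv_arr (Ho M) \<phi>"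
  have [simp]: "\<phi> \<in> Arr (Ho M)" using inv by (simp add: Ho.is_iso_Arr)
  have "harr Hr ?\<phi> (ident (Ho M) ?a) \<star> jr ?a
      = harr Hr ?\<phi> ?\<phi> \<star> (harr Hr (ident (Ho M) ?a) \<phi> \<star> jr ?a)"
    using inv.hyps by (simp add: Hr.harr_comp_assoc)
  also have "\<dots> = harr Hr (ident (Ho M) ?b) ?\<phi> \<star> jr ?b"
    unfolding inv.IH using inv.hyps by (simp add: Hr.harr_comp_assoc)
  finally show ?case using inv.hyps by simp
next
  case (comp \<phi> \<psi>)
  let ?a = "Dom (Ho M) \<phi>" and ?b = "Dom (Ho M) \<psi>" and ?c = "Cod (Ho M) \<psi>"
  have [simp]: "\<phi> \<in> Arr (Ho M)" "\<psi> \<in> Arr (Ho M)" "Cod (Ho M) \<phi> = ?b" using comp by simp_all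
  have "harr Hr (ident (Ho M) ?a) (\<psi> \<star> \<phi>) \<star> jr ?a
      = harr Hr (ident (Ho M) ?a) \<psi> \<star> (harr Hr (ident (Ho M) ?a) \<phi> \<star> jr ?a)"
    by (simp add: Hr.harr_comp_assoc)
  also have "\<dots> = harr Hr \<phi> (ident (Ho M) ?c) \<star> (harr Hr (ident (Ho M) ?b) \<psi> \<star> jr ?b)"
    unfolding comp.IH(1) by (simp add: Hr.harr_comp_assoc)
  also have "\<dots> = harr Hr (\<psi> \<star> \<phi>) (ident (Ho M) ?c) \<star> jr ?c"
    unfolding comp.IH(2) by (simp add: Hr.harr_comp_assoc)
  finally show ?case by simp
qed

section \<open>The localisation as a closed functor\<close>

lemma ir_eta:
  assumes [simp]: "b \<in> Obj M"
  shows "ir b \<star> eta I b = ho_arr M (i b)"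
proof -
  have "ir b \<star> eta I b = inv_arr (Ho M) (ho_arr M (qmap M b))
      \<star> ho_arr M (i (Rob b) \<cdot> harr H (ident M I) (qmap M b))"
    by (simp add: i_r_def Let_def eta_def Ho.assoc assoc harr_comp e_section flip: ho_arr_comp)
  also have "\<dots> = ho_arr M (i b)"
    using i_natural[of "qmap M b", symmetric] by (simp add: ho_arr_comp)
  finally show ?thesis .
qed

text \<open>This equation and its analogues for \<open>i\<close> and \<open>j\<close> say that \<open>Loc\<close> with \<open>eta\<close> is a closed
  functor from \<open>M\<close> to \<open>Ho M\<close>.  It holds for arbitrary objects: composing with \<open>eta c a\<close> makes the
  lift \<open>k\<close> meet the map \<open>p\<close> that it lifts, after which naturality of \<open>L\<close> removes the inverse of
  \<open>[Q q, 1]\<close> and extranaturality of \<open>L\<close> along \<open>p\<close> replaces \<open>Q c\<close> by \<open>c\<close>.\<close>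

lemma Lr_eta:
  assumes [simp]: "a \<in> Obj M" "b \<in> Obj M" "c \<in> Obj M"
  shows "harr Hr (eta c a) (ident (Ho M) (hob Hr c b)) \<star> Lr c a b \<star> eta a b
    = harr Hr (ident (Ho M) (hob H c a)) (eta c b) \<star> eta (hob H c a) (hob H c b) \<star> ho_arr M (L c a b)"
proof -
  let ?Qc = "Qob c" and ?Qa = "Qob a" and ?Ra = "Rob a" and ?Rb = "Rob b"
  let ?q = "qmap M (hob H ?Qc ?Rb)" and ?k = "k ?Qc a" and ?k' = "k ?Qc ?Ra"
  let ?Qp = "Qar (harr H (pmap M c) (ident M a))" and ?Qq = "Qar (harr H (ident M ?Qc) (qmap M a))"
  let ?L = "L ?Qc ?Qa ?Rb" and ?L' = "L ?Qc (Qob ?Ra) ?Rb"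
  let ?pq = "harr H (pmap M c) (qmap M b)"
  let ?X = "harr H (?k \<cdot> ?Qp) ?q \<cdot> ?L" and ?Y = "harr H (Qar (qmap M a)) (ident M ?Rb)"
  \<comment> \<open>Here \<open>[-, q]\<close> is applied to a naturality square of \<open>k\<close>, so the equation holds only in \<open>Ho M\<close>.\<close>
  have k: "ho_arr M (harr H (?k' \<cdot> ?Qq) ?q)
      = ho_arr M (harr H (harr H (ident M ?Qc) (Qar (qmap M a)) \<cdot> ?k) ?q)"
    using ho_k_natural[of "ident M ?Qc" "qmap M a" ?q] by simp
  have Qpq: "Qar (harr H (pmap M c) (qmap M a)) = ?Qq \<cdot> ?Qp"
    by (simp add: harr_comp flip: Qar_comp)
  have "harr Hr (eta c a) (ident (Ho M) (hob Hr c b)) \<star> ho_arr M (Lr_core c a b)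
      = ho_arr M (harr H ?Qp (ident M (Rob (hob H ?Qc ?Rb))))
        \<star> (ho_arr M (harr H (?k' \<cdot> ?Qq) ?q) \<star> ho_arr M ?L')"
    by (simp add: eta_def harr_Hr_ident_ho_arr Lr_core_def harr_comp_assoc hob_Hr Qpq assoc
        flip: ho_arr_comp)
  also have "\<dots> = ho_arr M (harr H (harr H (ident M ?Qc) (Qar (qmap M a)) \<cdot> (?k \<cdot> ?Qp)) ?q \<cdot> ?L')"
    unfolding k by (simp add: harr_comp_assoc assoc flip: ho_arr_comp)
  also have "\<dots> = ho_arr M ?X \<star> ho_arr M ?Y"
    by (simp add: harr_comp_assoc harr_comp assoc L_natural flip: ho_arr_comp)
  finally have "harr Hr (eta c a) (ident (Ho M) (hob Hr c b)) \<star> Lr c a b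
      = (ho_arr M ?X \<star> ho_arr M ?Y) \<star> inv_arr (Ho M) (ho_arr M ?Y)"
    by (simp add: Lr_eq Qq_iso eta_def hob_Hr flip: Ho.assoc)
  also have "\<dots> = ho_arr M ?X"
    by (simp add: Ho.assoc Qq_iso)
  finally have 1: "harr Hr (eta c a) (ident (Ho M) (hob Hr c b)) \<star> Lr c a b = ho_arr M ?X" .
  have "?X \<cdot> harr H (pmap M a) (qmap M b)
      = harr H ((harr H (ident M ?Qc) (pmap M a) \<cdot> ?k) \<cdot> ?Qp)
          (?q \<cdot> harr H (ident M ?Qc) (qmap M b)) \<cdot> L ?Qc a b"
    by (simp add: harr_comp_assoc harr_comp assoc L_natural del: k_lift)
  also have "(harr H (ident M ?Qc) (pmap M a) \<cdot> ?k) \<cdot> ?Qp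
      = harr H (pmap M c) (ident M a) \<cdot> pmap M (hob H c a)"
    using pmap_natural[of "harr H (pmap M c) (ident M a)"] by simp
  also have "harr H (harr H (pmap M c) (ident M a) \<cdot> pmap M (hob H c a))
          (?q \<cdot> harr H (ident M ?Qc) (qmap M b)) \<cdot> L ?Qc a b
      = harr H (pmap M (hob H c a)) (?q \<cdot> harr H (ident M ?Qc) (qmap M b))
        \<cdot> (harr H (harr H (pmap M c) (ident M a)) (ident M (hob H ?Qc b)) \<cdot> L ?Qc a b)"
    by (simp add: harr_comp_assoc)
  also have "harr H (harr H (pmap M c) (ident M a)) (ident M (hob H ?Qc b)) \<cdot> L ?Qc a b
      = harr H (ident M (hob H c a)) (harr H (pmap M c) (ident M b)) \<cdot> L c a b"
    using L_extranatural[of "pmap M c" a b] by simp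
  also have "harr H (pmap M (hob H c a)) (?q \<cdot> harr H (ident M ?Qc) (qmap M b)) \<cdot> \<dots>
      = harr H (ident M (Qob (hob H c a))) (Rar ?pq)
        \<cdot> (harr H (pmap M (hob H c a)) (qmap M (hob H c b)) \<cdot> L c a b)"
    using qmap_natural[of ?pq] by (simp add: harr_comp_assoc harr_comp assoc)
  finally have 2: "?X \<cdot> harr H (pmap M a) (qmap M b) = harr H (ident M (Qob (hob H c a))) (Rar ?pq)
      \<cdot> (harr H (pmap M (hob H c a)) (qmap M (hob H c b)) \<cdot> L c a b)" .
  have "harr Hr (eta c a) (ident (Ho M) (hob Hr c b)) \<star> Lr c a b \<star> eta a b
      = ho_arr M ?X \<star> eta a b"
    unfolding 1[symmetric] by (simp add: Ho.assoc)
  also have "\<dots> = ho_arr M (?X \<cdot> harr H (pmap M a) (qmap M b))"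
    unfolding eta_def by (rule ho_arr_comp[symmetric]) simp_all
  also have "\<dots> = harr Hr (ident (Ho M) (hob H c a)) (eta c b)
      \<star> eta (hob H c a) (hob H c b) \<star> ho_arr M (L c a b)"
    unfolding 2 by (simp add: eta_def harr_Hr_ident_ho_arr hob_Hr ho_arr_comp)
  finally show ?thesis .
qed

end

section \<open>Cofibrant-fibrant representatives and the five axioms\<close>

context skew_closed_model_category
begin

text \<open>Following \<open>eta\<close> by the action of isomorphisms of \<open>Ho M\<close> turns it from a comparison at good objects into one at arbitrary
  ones.\<close>

definition eta_along where
  "eta_along \<phi> \<psi> = harr Hr \<phi> \<psi> \<star> eta (Cod (Ho M) \<phi>) (Dom (Ho M) \<psi>)"

lemma eta_along_simps [simp]:
  assumes "\<phi> \<in> Arr (Ho M)" "\<psi> \<in> Arr (Ho M)"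
  shows "eta_along \<phi> \<psi> \<in> Arr (Ho M)"
    "Dom (Ho M) (eta_along \<phi> \<psi>) = hob H (Cod (Ho M) \<phi>) (Dom (Ho M) \<psi>)"
    "Cod (Ho M) (eta_along \<phi> \<psi>) = hob Hr (Dom (Ho M) \<phi>) (Cod (Ho M) \<psi>)"
  using assms by (simp_all add: eta_along_def)

lemma Lr_eta_along:
  assumes [simp]: "\<gamma> \<in> Arr (Ho M)" "\<beta> \<in> Arr (Ho M)" and \<alpha> [simp]: "is_iso (Ho M) \<alpha>"
    and [simp]: "Dom (Ho M) \<gamma> = c" "Cod (Ho M) \<gamma> = c'" "Dom (Ho M) \<alpha> = a" "Cod (Ho M) \<alpha> = a'"
      "Dom (Ho M) \<beta> = b'" "Cod (Ho M) \<beta> = b"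
  shows "harr Hr (eta_along \<gamma> (inv_arr (Ho M) \<alpha>)) (ident (Ho M) (hob Hr c b)) \<star> Lr c a b \<star> eta_along \<alpha> \<beta>
    = harr Hr (ident (Ho M) (hob H c' a')) (eta_along \<gamma> \<beta>)
      \<star> eta (hob H c' a') (hob H c' b') \<star> ho_arr M (L c' a' b')"
proof -
  have [simp]: "\<alpha> \<in> Arr (Ho M)" using \<alpha> by (rule Ho.is_iso_Arr)
  have [simp]: "a \<in> Obj M" "a' \<in> Obj M" "b \<in> Obj M" "b' \<in> Obj M" "c \<in> Obj M" "c' \<in> Obj M"
    using Ho.Dom_Obj[of \<alpha>] Ho.Cod_Obj[of \<alpha>] Ho.Dom_Obj[of \<beta>] Ho.Cod_Obj[of \<beta>]
      Ho.Dom_Obj[of \<gamma>] Ho.Cod_Obj[of \<gamma>] by simp_all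
  let ?one = "ident (Ho M)"
  have "Lr c a b \<star> eta_along \<alpha> \<beta>
      = harr Hr (harr Hr (?one c) \<alpha>) (harr Hr (?one c) \<beta>) \<star> Lr c a' b' \<star> eta a' b'"
    using Lr_natural[of c \<alpha> \<beta> a b] by (simp add: eta_along_def flip: Ho.assoc)
  then have "harr Hr (eta_along \<gamma> (inv_arr (Ho M) \<alpha>)) (?one (hob Hr c b)) \<star> Lr c a b \<star> eta_along \<alpha> \<beta>
      = harr Hr (eta c' a') (harr Hr (?one c) \<beta>)
        \<star> (harr Hr (harr Hr \<gamma> (?one a')) (?one (hob Hr c b')) \<star> Lr c a' b') \<star> eta a' b'"
    by (simp add: eta_along_def Ho.assoc Hr.harr_comp Hr.harr_comp_assoc)
  also have "harr Hr (harr Hr \<gamma> (?one a')) (?one (hob Hr c b')) \<star> Lr c a' b'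
      = harr Hr (?one (hob Hr c' a')) (harr Hr \<gamma> (?one b')) \<star> Lr c' a' b'"
    using Lr_extranatural[of a' b' \<gamma>] by simp
  also have "harr Hr (eta c' a') (harr Hr (?one c) \<beta>)
        \<star> (harr Hr (?one (hob Hr c' a')) (harr Hr \<gamma> (?one b')) \<star> Lr c' a' b') \<star> eta a' b'
      = harr Hr (?one (hob H c' a')) (harr Hr \<gamma> \<beta>)
        \<star> (harr Hr (eta c' a') (?one (hob Hr c' b')) \<star> Lr c' a' b' \<star> eta a' b')"
    by (simp add: Ho.assoc Hr.harr_comp Hr.harr_comp_assoc)
  also have "\<dots> = harr Hr (?one (hob H c' a')) (eta_along \<gamma> \<beta>)
      \<star> eta (hob H c' a') (hob H c' b') \<star> ho_arr M (L c' a' b')"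
    unfolding Lr_eta[OF \<open>a' \<in> Obj M\<close> \<open>b' \<in> Obj M\<close> \<open>c' \<in> Obj M\<close>]
    by (simp add: eta_along_def Ho.assoc Hr.harr_comp Hr.harr_comp_assoc)
  finally show ?thesis .
qed

text \<open>Every object is isomorphic in \<open>Ho M\<close> to one that is both cofibrant and fibrant.\<close>

abbreviation RQob :: "'o \<Rightarrow> 'o" where "RQob a \<equiv> Rob (Qob a)"

definition to_RQ where
  "to_RQ a = ho_arr M (qmap M (Qob a)) \<star> inv_arr (Ho M) (ho_arr M (pmap M a))"

lemma to_RQ_simps [simp]:
  assumes "a \<in> Obj M"
  shows "is_iso (Ho M) (to_RQ a)" "to_RQ a \<in> Arr (Ho M)" "Dom (Ho M) (to_RQ a) = a" "Cod (Ho M) (to_RQ a) = RQob a"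
  using assms by (simp_all add: to_RQ_def Ho.is_iso_comp)

abbreviation "from_RQ a \<equiv> inv_arr (Ho M) (to_RQ a)"

text \<open>Unlike \<open>eta a b\<close>, the comparison \<open>eta_RQ a b\<close> is always invertible.  The variant with the unit in the
  first place leaves \<open>I\<close>, which is already cofibrant, unchanged; it is needed because \<open>i\<close> mentions
  \<open>I\<close> itself.\<close>

definition eta_RQ where "eta_RQ a b = eta_along (to_RQ a) (from_RQ b)"
definition eta_RQ_unit where "eta_RQ_unit b = eta_along (ident (Ho M) I) (from_RQ b)"

lemma unit_Obj [simp]: "I \<in> Obj M"
  by (rule cofibrant_Obj) simp

lemma eta_RQ_simps [simp]:
  assumes "a \<in> Obj M" "b \<in> Obj M"
  shows "eta_RQ a b \<in> Arr (Ho M)" "Dom (Ho M) (eta_RQ a b) = hob H (RQob a) (RQob b)"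
    "Cod (Ho M) (eta_RQ a b) = hob Hr a b" "is_iso (Ho M) (eta_RQ a b)"
  using assms
  by (simp_all add: eta_RQ_def) (simp add: eta_along_def Ho.is_iso_comp Hr.is_iso_harr eta_iso)

lemma eta_RQ_unit_simps [simp]:
  assumes "b \<in> Obj M"
  shows "eta_RQ_unit b \<in> Arr (Ho M)" "Dom (Ho M) (eta_RQ_unit b) = hob H I (RQob b)"
    "Cod (Ho M) (eta_RQ_unit b) = hob Hr I b" "is_iso (Ho M) (eta_RQ_unit b)"
  using assms
  by (simp_all add: eta_RQ_unit_def) (simp add: eta_along_def Ho.is_iso_comp Hr.is_iso_harr eta_iso)

lemma Lr_eta_RQ:
  assumes "a \<in> Obj M" "b \<in> Obj M" "c \<in> Obj M"
  shows "harr Hr (eta_RQ c a) (ident (Ho M) (hob Hr c b)) \<star> Lr c a b \<star> eta_RQ a b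
    = harr Hr (ident (Ho M) (hob H (RQob c) (RQob a))) (eta_RQ c b)
      \<star> eta (hob H (RQob c) (RQob a)) (hob H (RQob c) (RQob b)) \<star> ho_arr M (L (RQob c) (RQob a) (RQob b))"
  unfolding eta_RQ_def using assms by (intro Lr_eta_along) simp_all

lemma Lr_eta_RQ_unit:
  assumes "a \<in> Obj M" "b \<in> Obj M"
  shows "harr Hr (eta_RQ_unit a) (ident (Ho M) (hob Hr I b)) \<star> Lr I a b \<star> eta_RQ a b
    = harr Hr (ident (Ho M) (hob H I (RQob a))) (eta_RQ_unit b)
      \<star> eta (hob H I (RQob a)) (hob H I (RQob b)) \<star> ho_arr M (L I (RQob a) (RQob b))"
  unfolding eta_RQ_def eta_RQ_unit_def using assms by (intro Lr_eta_along) simp_all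

lemma ir_eta_RQ_unit:
  assumes [simp]: "b \<in> Obj M"
  shows "ir b \<star> eta_RQ_unit b = from_RQ b \<star> ho_arr M (i (RQob b))"
proof -
  have "ir b \<star> eta_RQ_unit b = (ir b \<star> harr Hr (ident (Ho M) I) (from_RQ b)) \<star> eta I (RQob b)"
    by (simp add: eta_RQ_unit_def eta_along_def Ho.assoc)
  also have "ir b \<star> harr Hr (ident (Ho M) I) (from_RQ b) = from_RQ b \<star> ir (RQob b)"
    using ir_natural[of "from_RQ b"] by simp
  also have "\<dots> \<star> eta I (RQob b) = from_RQ b \<star> ho_arr M (i (RQob b))"
    by (simp add: Ho.assoc ir_eta)
  finally show ?thesis .
qed

lemma jr_eta_RQ:
  assumes [simp]: "a \<in> Obj M"
  shows "jr a = eta_RQ a a \<star> ho_arr M (j (RQob a))"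
proof -
  have "eta_RQ a a \<star> ho_arr M (j (RQob a))
      = harr Hr (to_RQ a) (ident (Ho M) a) \<star> (harr Hr (ident (Ho M) (RQob a)) (from_RQ a) \<star> jr (RQob a))"
    by (simp add: eta_RQ_def eta_along_def jr_eq Ho.assoc Hr.harr_comp_assoc)
  also have "\<dots> = jr a"
    using jr_extranatural[of "from_RQ a"] by (simp add: Hr.harr_comp_assoc)
  finally show ?thesis by simp
qed

lemma cancel_both:
  assumes "is_iso (Ho M) p" "is_iso (Ho M) z" "f \<in> Arr (Ho M)" "g \<in> Arr (Ho M)"
    "Dom (Ho M) f = Cod (Ho M) z" "Dom (Ho M) g = Cod (Ho M) z"
    "Cod (Ho M) f = Dom (Ho M) p" "Cod (Ho M) g = Dom (Ho M) p"
    "p \<star> f \<star> z = p \<star> g \<star> z"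
  shows "f = g"
proof -
  have "f \<star> z = g \<star> z"
    by (rule Ho.iso_cancel_left[OF assms(1) _ _ _ _ assms(9)])
      (use assms(1-8) in \<open>simp_all add: Ho.is_iso_Arr\<close>)
  then show ?thesis
    by (rule Ho.iso_cancel_right[OF assms(2-6)])
qed

text \<open>After composing with invertible comparisons \<open>eta_RQ\<close> on both sides, every occurrence of \<open>Lr\<close> is
  turned into the image of an \<open>L\<close>, and the two sides become images of the two sides of the axiom in
  \<open>M\<close>.  The middle occurrence on the left is at the internal homs themselves, which need not be
  cofibrant; there (extra)naturality moves it along the comparisons to the internal homs of \<open>M\<close>, where
  the plain \<open>eta\<close> is used.  The next three axioms follow the same pattern.\<close>

lemma derived_C1:
  assumes [simp]: "a \<in> Obj M" "b \<in> Obj M" "d \<in> Obj M" "x \<in> Obj M"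
  shows "harr Hr (Lr a b d) (ident (Ho M) (hob Hr (hob Hr a b) (hob Hr a x)))
      \<star> Lr (hob Hr a b) (hob Hr a d) (hob Hr a x) \<star> Lr a d x
    = harr Hr (ident (Ho M) (hob Hr b d)) (Lr a b x) \<star> Lr b d x"
proof -
  let ?one = "ident (Ho M)"
  let ?ab = "hob H (RQob a) (RQob b)" and ?ad = "hob H (RQob a) (RQob d)" and ?ax = "hob H (RQob a) (RQob x)"
    and ?bd = "hob H (RQob b) (RQob d)" and ?bx = "hob H (RQob b) (RQob x)"
  let ?AB = "hob Hr a b" and ?AD = "hob Hr a d" and ?AX = "hob Hr a x" and ?BD = "hob Hr b d"
  \<comment> \<open>Both sides are composed with the invertible arrow \<open>?P\<close> on the left and with \<open>eta_RQ d x\<close> on the right.\<close>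
  let ?P = "harr Hr (eta_RQ b d) (harr Hr (eta_RQ a b) (?one ?AX))"
  let ?T = "harr Hr (?one ?bd) (harr Hr (?one ?ab) (eta_RQ a x) \<star> eta ?ab ?ax)"
  let ?y = "eta ?ab ?ad \<star> ho_arr M (L (RQob a) (RQob b) (RQob d))"
  have "?P \<star> (harr Hr (Lr a b d) (?one (hob Hr ?AB ?AX)) \<star> Lr ?AB ?AD ?AX \<star> Lr a d x) \<star> eta_RQ d x
      = harr Hr (Lr a b d \<star> eta_RQ b d) (?one (hob Hr ?ab ?AX))
        \<star> (harr Hr (?one (hob Hr ?AB ?AD)) (harr Hr (eta_RQ a b) (?one ?AX)) \<star> Lr ?AB ?AD ?AX) \<star> Lr a d x \<star> eta_RQ d x"
    by (simp add: Ho.assoc Hr.harr_comp Hr.harr_comp_assoc)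
  also have "harr Hr (?one (hob Hr ?AB ?AD)) (harr Hr (eta_RQ a b) (?one ?AX)) \<star> Lr ?AB ?AD ?AX
      = harr Hr (harr Hr (eta_RQ a b) (?one ?AD)) (?one (hob Hr ?ab ?AX)) \<star> Lr ?ab ?AD ?AX"
    using Lr_extranatural[of ?AD ?AX "eta_RQ a b"] by simp
  also have "harr Hr (Lr a b d \<star> eta_RQ b d) (?one (hob Hr ?ab ?AX)) \<star> \<dots> \<star> Lr a d x \<star> eta_RQ d x
      = harr Hr (harr Hr (eta_RQ a b) (?one ?AD) \<star> Lr a b d \<star> eta_RQ b d) (?one (hob Hr ?ab ?AX))
        \<star> Lr ?ab ?AD ?AX \<star> Lr a d x \<star> eta_RQ d x"
    by (simp add: Ho.assoc Hr.harr_comp Hr.harr_comp_assoc)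
  also have "harr Hr (eta_RQ a b) (?one ?AD) \<star> Lr a b d \<star> eta_RQ b d = harr Hr (?one ?ab) (eta_RQ a d) \<star> ?y"
    by (rule Lr_eta_RQ) simp_all
  also have "harr Hr (harr Hr (?one ?ab) (eta_RQ a d) \<star> ?y) (?one (hob Hr ?ab ?AX))
        \<star> Lr ?ab ?AD ?AX \<star> Lr a d x \<star> eta_RQ d x
      = harr Hr ?y (?one (hob Hr ?ab ?AX))
        \<star> (harr Hr (harr Hr (?one ?ab) (eta_RQ a d)) (harr Hr (?one ?ab) (?one ?AX)) \<star> Lr ?ab ?AD ?AX)
        \<star> Lr a d x \<star> eta_RQ d x"
    by (simp add: Ho.assoc Hr.harr_comp Hr.harr_comp_assoc)
  also have "harr Hr (harr Hr (?one ?ab) (eta_RQ a d)) (harr Hr (?one ?ab) (?one ?AX)) \<star> Lr ?ab ?AD ?AX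
      = Lr ?ab ?ad ?AX \<star> harr Hr (eta_RQ a d) (?one ?AX)"
    using Lr_natural[of ?ab "eta_RQ a d" "?one ?AX" ?ad ?AX] by simp
  also have "harr Hr ?y (?one (hob Hr ?ab ?AX)) \<star> \<dots> \<star> Lr a d x \<star> eta_RQ d x
      = harr Hr ?y (?one (hob Hr ?ab ?AX)) \<star> Lr ?ab ?ad ?AX
        \<star> (harr Hr (eta_RQ a d) (?one ?AX) \<star> Lr a d x \<star> eta_RQ d x)"
    by (simp add: Ho.assoc)
  also have "harr Hr (eta_RQ a d) (?one ?AX) \<star> Lr a d x \<star> eta_RQ d x
      = harr Hr (?one ?ad) (eta_RQ a x) \<star> eta ?ad ?ax \<star> ho_arr M (L (RQob a) (RQob d) (RQob x))"
    by (rule Lr_eta_RQ) simp_all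
  also have "harr Hr ?y (?one (hob Hr ?ab ?AX)) \<star> Lr ?ab ?ad ?AX \<star> \<dots>
      = harr Hr ?y (?one (hob Hr ?ab ?AX)) \<star> (Lr ?ab ?ad ?AX \<star> harr Hr (?one ?ad) (eta_RQ a x))
        \<star> eta ?ad ?ax \<star> ho_arr M (L (RQob a) (RQob d) (RQob x))"
    by (simp add: Ho.assoc)
  also have "Lr ?ab ?ad ?AX \<star> harr Hr (?one ?ad) (eta_RQ a x)
      = harr Hr (?one (hob Hr ?ab ?ad)) (harr Hr (?one ?ab) (eta_RQ a x)) \<star> Lr ?ab ?ad ?ax"
    using Lr_natural[of ?ab "?one ?ad" "eta_RQ a x" ?ad ?AX] by simp
  also have "harr Hr ?y (?one (hob Hr ?ab ?AX)) \<star> \<dots> \<star> eta ?ad ?ax \<star> ho_arr M (L (RQob a) (RQob d) (RQob x))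
      = harr Hr (ho_arr M (L (RQob a) (RQob b) (RQob d))) (harr Hr (?one ?ab) (eta_RQ a x))
        \<star> (harr Hr (eta ?ab ?ad) (?one (hob Hr ?ab ?ax)) \<star> Lr ?ab ?ad ?ax \<star> eta ?ad ?ax)
        \<star> ho_arr M (L (RQob a) (RQob d) (RQob x))"
    by (simp add: Ho.assoc Hr.harr_comp Hr.harr_comp_assoc)
  also have "harr Hr (eta ?ab ?ad) (?one (hob Hr ?ab ?ax)) \<star> Lr ?ab ?ad ?ax \<star> eta ?ad ?ax
      = harr Hr (?one (hob H ?ab ?ad)) (eta ?ab ?ax)
        \<star> eta (hob H ?ab ?ad) (hob H ?ab ?ax) \<star> ho_arr M (L ?ab ?ad ?ax)"
    by (rule Lr_eta) simp_all
  also have "harr Hr (ho_arr M (L (RQob a) (RQob b) (RQob d))) (harr Hr (?one ?ab) (eta_RQ a x)) \<star> \<dots>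
        \<star> ho_arr M (L (RQob a) (RQob d) (RQob x))
      = ?T \<star> (harr Hr (ho_arr M (L (RQob a) (RQob b) (RQob d))) (ho_arr M (ident M (hob H ?ab ?ax)))
          \<star> eta (hob H ?ab ?ad) (hob H ?ab ?ax))
        \<star> ho_arr M (L ?ab ?ad ?ax \<cdot> L (RQob a) (RQob d) (RQob x))"
    by (simp add: Ho.assoc Hr.harr_comp Hr.harr_comp_assoc ho_arr_comp)
  also have "harr Hr (ho_arr M (L (RQob a) (RQob b) (RQob d))) (ho_arr M (ident M (hob H ?ab ?ax)))
          \<star> eta (hob H ?ab ?ad) (hob H ?ab ?ax)
      = eta ?bd (hob H ?ab ?ax) \<star> ho_arr M (harr H (L (RQob a) (RQob b) (RQob d)) (ident M (hob H ?ab ?ax)))"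
    using eta_natural[of "L (RQob a) (RQob b) (RQob d)" "ident M (hob H ?ab ?ax)"] by simp
  also have "?T \<star> \<dots> \<star> ho_arr M (L ?ab ?ad ?ax \<cdot> L (RQob a) (RQob d) (RQob x))
      = ?T \<star> eta ?bd (hob H ?ab ?ax) \<star> ho_arr M (harr H (L (RQob a) (RQob b) (RQob d)) (ident M (hob H ?ab ?ax))
        \<cdot> L ?ab ?ad ?ax \<cdot> L (RQob a) (RQob d) (RQob x))"
    by (simp add: Ho.assoc ho_arr_comp)
  also have "harr H (L (RQob a) (RQob b) (RQob d)) (ident M (hob H ?ab ?ax)) \<cdot> L ?ab ?ad ?ax \<cdot> L (RQob a) (RQob d) (RQob x)
      = harr H (ident M ?bd) (L (RQob a) (RQob b) (RQob x)) \<cdot> L (RQob b) (RQob d) (RQob x)"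
    by (rule skew_closed_category.C1[OF skew_closed]) simp_all
  finally have lhs: "?P \<star> (harr Hr (Lr a b d) (?one (hob Hr ?AB ?AX)) \<star> Lr ?AB ?AD ?AX \<star> Lr a d x) \<star> eta_RQ d x
      = ?T \<star> eta ?bd (hob H ?ab ?ax)
        \<star> ho_arr M (harr H (ident M ?bd) (L (RQob a) (RQob b) (RQob x)) \<cdot> L (RQob b) (RQob d) (RQob x))" .
  have "?P \<star> (harr Hr (?one ?BD) (Lr a b x) \<star> Lr b d x) \<star> eta_RQ d x
      = harr Hr (?one ?bd) (harr Hr (eta_RQ a b) (?one ?AX) \<star> Lr a b x)
        \<star> (harr Hr (eta_RQ b d) (?one (hob Hr b x)) \<star> Lr b d x \<star> eta_RQ d x)"
    by (simp add: Ho.assoc Hr.harr_comp Hr.harr_comp_assoc)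
  also have "harr Hr (eta_RQ b d) (?one (hob Hr b x)) \<star> Lr b d x \<star> eta_RQ d x
      = harr Hr (?one ?bd) (eta_RQ b x) \<star> eta ?bd ?bx \<star> ho_arr M (L (RQob b) (RQob d) (RQob x))"
    by (rule Lr_eta_RQ) simp_all
  also have "harr Hr (?one ?bd) (harr Hr (eta_RQ a b) (?one ?AX) \<star> Lr a b x) \<star> \<dots>
      = harr Hr (?one ?bd) (harr Hr (eta_RQ a b) (?one ?AX) \<star> Lr a b x \<star> eta_RQ b x)
        \<star> eta ?bd ?bx \<star> ho_arr M (L (RQob b) (RQob d) (RQob x))"
    by (simp add: Ho.assoc Hr.harr_comp Hr.harr_comp_assoc)
  also have "harr Hr (eta_RQ a b) (?one ?AX) \<star> Lr a b x \<star> eta_RQ b x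
      = harr Hr (?one ?ab) (eta_RQ a x) \<star> eta ?ab ?ax \<star> ho_arr M (L (RQob a) (RQob b) (RQob x))"
    by (rule Lr_eta_RQ) simp_all
  also have "harr Hr (?one ?bd) \<dots> \<star> eta ?bd ?bx \<star> ho_arr M (L (RQob b) (RQob d) (RQob x))
      = ?T \<star> (harr Hr (ho_arr M (ident M ?bd)) (ho_arr M (L (RQob a) (RQob b) (RQob x))) \<star> eta ?bd ?bx)
        \<star> ho_arr M (L (RQob b) (RQob d) (RQob x))"
    by (simp add: Ho.assoc Hr.harr_comp Hr.harr_comp_assoc)
  also have "harr Hr (ho_arr M (ident M ?bd)) (ho_arr M (L (RQob a) (RQob b) (RQob x))) \<star> eta ?bd ?bx
      = eta ?bd (hob H ?ab ?ax) \<star> ho_arr M (harr H (ident M ?bd) (L (RQob a) (RQob b) (RQob x)))"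
    using eta_natural[of "ident M ?bd" "L (RQob a) (RQob b) (RQob x)"] by simp
  also have "?T \<star> \<dots> \<star> ho_arr M (L (RQob b) (RQob d) (RQob x))
      = ?T \<star> eta ?bd (hob H ?ab ?ax)
        \<star> ho_arr M (harr H (ident M ?bd) (L (RQob a) (RQob b) (RQob x)) \<cdot> L (RQob b) (RQob d) (RQob x))"
    by (simp add: Ho.assoc ho_arr_comp)
  finally have "?P \<star> (harr Hr (Lr a b d) (?one (hob Hr ?AB ?AX)) \<star> Lr ?AB ?AD ?AX \<star> Lr a d x) \<star> eta_RQ d x
      = ?P \<star> (harr Hr (?one ?BD) (Lr a b x) \<star> Lr b d x) \<star> eta_RQ d x"
    unfolding lhs by (rule sym)
  then show ?thesis
    by (rule cancel_both[rotated -1]) (simp_all add: Hr.is_iso_harr)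
qed

lemma derived_C2:
  assumes [simp]: "a \<in> Obj M" "d \<in> Obj M"
  shows "ir (hob Hr a d) \<star> harr Hr (jr a) (ident (Ho M) (hob Hr a d)) \<star> Lr a a d
    = ident (Ho M) (hob Hr a d)"
proof -
  let ?one = "ident (Ho M)"
  let ?aa = "hob H (RQob a) (RQob a)" and ?ad = "hob H (RQob a) (RQob d)" and ?AD = "hob Hr a d"
  have "(ir ?AD \<star> harr Hr (jr a) (?one ?AD) \<star> Lr a a d) \<star> eta_RQ a d
      = ir ?AD \<star> harr Hr (ho_arr M (j (RQob a))) (?one ?AD)
        \<star> (harr Hr (eta_RQ a a) (?one ?AD) \<star> Lr a a d \<star> eta_RQ a d)"
    by (simp add: jr_eta_RQ Ho.assoc Hr.harr_comp Hr.harr_comp_assoc)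
  also have "harr Hr (eta_RQ a a) (?one ?AD) \<star> Lr a a d \<star> eta_RQ a d
      = harr Hr (?one ?aa) (eta_RQ a d) \<star> eta ?aa ?ad \<star> ho_arr M (L (RQob a) (RQob a) (RQob d))"
    by (rule Lr_eta_RQ) simp_all
  also have "ir ?AD \<star> harr Hr (ho_arr M (j (RQob a))) (?one ?AD) \<star> \<dots>
      = (ir ?AD \<star> harr Hr (?one I) (eta_RQ a d))
        \<star> (harr Hr (ho_arr M (j (RQob a))) (ho_arr M (ident M ?ad)) \<star> eta ?aa ?ad)
        \<star> ho_arr M (L (RQob a) (RQob a) (RQob d))"
    by (simp add: Ho.assoc Hr.harr_comp Hr.harr_comp_assoc)
  also have "ir ?AD \<star> harr Hr (?one I) (eta_RQ a d) = eta_RQ a d \<star> ir ?ad"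
    using ir_natural[of "eta_RQ a d"] by simp
  also have "harr Hr (ho_arr M (j (RQob a))) (ho_arr M (ident M ?ad)) \<star> eta ?aa ?ad
      = eta I ?ad \<star> ho_arr M (harr H (j (RQob a)) (ident M ?ad))"
    using eta_natural[of "j (RQob a)" "ident M ?ad"] by simp
  also have "(eta_RQ a d \<star> ir ?ad) \<star> \<dots> \<star> ho_arr M (L (RQob a) (RQob a) (RQob d))
      = eta_RQ a d \<star> (ir ?ad \<star> eta I ?ad)
        \<star> ho_arr M (harr H (j (RQob a)) (ident M ?ad) \<cdot> L (RQob a) (RQob a) (RQob d))"
    by (simp add: Ho.assoc ho_arr_comp)
  also have "\<dots> = eta_RQ a d \<star> ho_arr M (i ?ad \<cdot> harr H (j (RQob a)) (ident M ?ad) \<cdot> L (RQob a) (RQob a) (RQob d))"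
    by (simp add: ir_eta ho_arr_comp)
  also have "i ?ad \<cdot> harr H (j (RQob a)) (ident M ?ad) \<cdot> L (RQob a) (RQob a) (RQob d) = ident M ?ad"
    by (rule skew_closed_category.C2[OF skew_closed]) simp_all
  finally have "(ir ?AD \<star> harr Hr (jr a) (?one ?AD) \<star> Lr a a d) \<star> eta_RQ a d = ?one ?AD \<star> eta_RQ a d"
    by simp
  then show ?thesis
    by (rule Ho.iso_cancel_right[rotated -1]) simp_all
qed

lemma derived_C3:
  assumes [simp]: "a \<in> Obj M" "b \<in> Obj M"
  shows "Lr a b b \<star> jr b = jr (hob Hr a b)"
proof -
  let ?one = "ident (Ho M)"
  let ?ab = "hob H (RQob a) (RQob b)" and ?AB = "hob Hr a b"
  have "harr Hr (eta_RQ a b) (?one ?AB) \<star> (Lr a b b \<star> jr b)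
      = (harr Hr (eta_RQ a b) (?one ?AB) \<star> Lr a b b \<star> eta_RQ b b) \<star> ho_arr M (j (RQob b))"
    by (simp add: jr_eta_RQ Ho.assoc)
  also have "harr Hr (eta_RQ a b) (?one ?AB) \<star> Lr a b b \<star> eta_RQ b b
      = harr Hr (?one ?ab) (eta_RQ a b) \<star> eta ?ab ?ab \<star> ho_arr M (L (RQob a) (RQob b) (RQob b))"
    by (rule Lr_eta_RQ) simp_all
  also have "\<dots> \<star> ho_arr M (j (RQob b))
      = harr Hr (?one ?ab) (eta_RQ a b) \<star> eta ?ab ?ab \<star> ho_arr M (L (RQob a) (RQob b) (RQob b) \<cdot> j (RQob b))"
    by (simp add: Ho.assoc ho_arr_comp)
  also have "L (RQob a) (RQob b) (RQob b) \<cdot> j (RQob b) = j ?ab"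
    by (rule skew_closed_category.C3[OF skew_closed]) simp_all
  also have "harr Hr (?one ?ab) (eta_RQ a b) \<star> eta ?ab ?ab \<star> ho_arr M (j ?ab)
      = harr Hr (eta_RQ a b) (?one ?AB) \<star> jr ?AB"
    using jr_extranatural[of "eta_RQ a b"] by (simp add: jr_eq)
  finally show ?thesis
    by (rule Ho.iso_cancel_left[rotated -1]) (simp_all add: Hr.is_iso_harr)
qed

lemma derived_C4:
  assumes [simp]: "b \<in> Obj M" "d \<in> Obj M"
  shows "harr Hr (ident (Ho M) (hob Hr I b)) (ir d) \<star> Lr I b d = harr Hr (ir b) (ident (Ho M) d)"
proof -
  let ?one = "ident (Ho M)"
  let ?Ib = "hob H I (RQob b)" and ?Id = "hob H I (RQob d)"
  let ?P = "harr Hr (eta_RQ_unit b) (?one d)"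
  have "?P \<star> (harr Hr (?one (hob Hr I b)) (ir d) \<star> Lr I b d) \<star> eta_RQ b d
      = harr Hr (?one ?Ib) (ir d) \<star> (harr Hr (eta_RQ_unit b) (?one (hob Hr I d)) \<star> Lr I b d \<star> eta_RQ b d)"
    by (simp add: Ho.assoc Hr.harr_comp Hr.harr_comp_assoc)
  also have "harr Hr (eta_RQ_unit b) (?one (hob Hr I d)) \<star> Lr I b d \<star> eta_RQ b d
      = harr Hr (?one ?Ib) (eta_RQ_unit d) \<star> eta ?Ib ?Id \<star> ho_arr M (L I (RQob b) (RQob d))"
    by (rule Lr_eta_RQ_unit) simp_all
  also have "harr Hr (?one ?Ib) (ir d) \<star> \<dots>
      = harr Hr (?one ?Ib) (from_RQ d) \<star> (harr Hr (ho_arr M (ident M ?Ib)) (ho_arr M (i (RQob d)))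
        \<star> eta ?Ib ?Id) \<star> ho_arr M (L I (RQob b) (RQob d))"
    by (simp add: Ho.assoc Hr.harr_comp Hr.harr_comp_assoc ir_eta_RQ_unit)
  also have "harr Hr (ho_arr M (ident M ?Ib)) (ho_arr M (i (RQob d))) \<star> eta ?Ib ?Id
      = eta ?Ib (RQob d) \<star> ho_arr M (harr H (ident M ?Ib) (i (RQob d)))"
    using eta_natural[of "ident M ?Ib" "i (RQob d)"] by simp
  also have "harr Hr (?one ?Ib) (from_RQ d) \<star> \<dots> \<star> ho_arr M (L I (RQob b) (RQob d))
      = harr Hr (?one ?Ib) (from_RQ d) \<star> eta ?Ib (RQob d)
        \<star> ho_arr M (harr H (ident M ?Ib) (i (RQob d)) \<cdot> L I (RQob b) (RQob d))"
    by (simp add: Ho.assoc ho_arr_comp)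
  also have "harr H (ident M ?Ib) (i (RQob d)) \<cdot> L I (RQob b) (RQob d) = harr H (i (RQob b)) (ident M (RQob d))"
    by (rule skew_closed_category.C4[OF skew_closed]) simp_all
  also have "eta ?Ib (RQob d) \<star> ho_arr M (harr H (i (RQob b)) (ident M (RQob d)))
      = harr Hr (ho_arr M (i (RQob b))) (ho_arr M (ident M (RQob d))) \<star> eta (RQob b) (RQob d)"
    using eta_natural[of "i (RQob b)" "ident M (RQob d)"] by simp
  also have "harr Hr (?one ?Ib) (from_RQ d) \<star> \<dots>
      = harr Hr (ir b \<star> eta_RQ_unit b) (?one d) \<star> eta_RQ b d"
    by (simp add: ir_eta_RQ_unit eta_RQ_def eta_along_def Ho.assoc Hr.harr_comp Hr.harr_comp_assoc)
  also have "\<dots> = ?P \<star> harr Hr (ir b) (?one d) \<star> eta_RQ b d"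
    by (simp add: Ho.assoc Hr.harr_comp Hr.harr_comp_assoc)
  finally show ?thesis
    by (rule cancel_both[rotated -1]) (simp_all add: Hr.is_iso_harr)
qed

lemma derived_C5: "ir I \<star> jr I = ident (Ho M) I"
proof -
  have "ir I \<star> jr I = (ir I \<star> eta I I) \<star> ho_arr M (j I)"
    by (simp add: jr_eq Ho.assoc)
  also have "\<dots> = ho_arr M (i I \<cdot> j I)"
    by (simp add: ir_eta ho_arr_comp)
  also have "i I \<cdot> j I = ident M I"
    by (rule skew_closed_category.C5[OF skew_closed])
  finally show ?thesis by simp
qed

lemma skew_closed_Ho: "skew_closed_category (Ho M) Hr I Lr ir jr"
proof (rule skew_closed_category.intro[OF category_Ho], unfold_locales)
  show "is_functor (prod_cat (opp (Ho M)) (Ho M)) (Ho M) Hr" by (rule Hr.bifunctor)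
qed (use Lr_natural Lr_extranatural ir_natural jr_extranatural in
    \<open>auto simp: hom_def derived_C1 derived_C2 derived_C3 derived_C4 derived_C5\<close>)

end

theorem theorem5p5:
  fixes M :: "('o, 'm) model_cat"
    and H :: "('o, 'm) bifunc"
    and I :: 'o
    and L :: "'o \<Rightarrow> 'o \<Rightarrow> 'o \<Rightarrow> 'm"
    and i :: "'o \<Rightarrow> 'm"
    and j :: "'o \<Rightarrow> 'm"
    and k :: "'o \<Rightarrow> 'o \<Rightarrow> 'm"
    and e :: 'm
  assumes "model_category M"
    and "skew_closed_category M H I L i j"
    and "axiom_C M H I"
    and "k_choice M H k"
    and "e \<in> hom M I (OMap (Qfun M) I)"
    and "pmap M I \<cdot>\<^bsub>M\<^esub> e = ident M I"
  shows "\<exists>Hr :: ('o, 'o \<times> 'o \<times> 'm step list set) bifunc.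
      (\<forall>A\<in>Obj M. \<forall>B\<in>Obj M.
         hob Hr A B = hob H (OMap (Qfun M) A) (OMap (Rfun M) B))
    \<and> (\<forall>f\<in>Arr M. \<forall>g\<in>Arr M.
         harr Hr (ho_arr M f) (ho_arr M g)
           = ho_arr M (harr H (AMap (Qfun M) f) (AMap (Rfun M) g)))
    \<and> right_derived_bifunctor M H Hr
         (\<lambda>(A, B). ho_arr M (harr H (pmap M A) (qmap M B)))
    \<and> skew_closed_category (Ho M) Hr I (L_r M H L k) (i_r M H i e) (j_r M H j)"
proof -
  interpret model_category M by fact
  interpret skew_closed_model_category M H I L i j k e
    using assms skew_closed_category.bifunctor[OF assms(2)]
    by (simp add: skew_closed_model_category_def skew_closed_model_category_axioms_def
        axiom_C_category_def axiom_C_category_axioms_def internal_hom_def internal_hom_axioms_def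
        category_axioms)
  show ?thesis
    using right_derived skew_closed_Ho by (intro exI[of _ Hr]) (simp add: hob_Hr harr_Hr_ho_arr)
qed

end
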